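(* Let $\vartheta>0$, $\mu\in\mathbb{R}$, and let $\mathfrak{R}_{(\vartheta+i\mu)t}$, $t\ge0$, be the evolution operator of the complex Hermite equation $\partial_tu=(\vartheta+i\mu)\left(\frac1{4\pi}\Delta-\pi|x|^2\right)u$, $u(0,\cdot)=u_0\in\mathcal{S}(\mathbb{R}^d)$. For $t>0$, the Wigner kernel $k_W$ of $\mathfrak{R}_{(\vartheta+i\mu)t}$ is $$k_W(z,w)=[\sinh(\vartheta t)]^{-d}\exp\left(-\frac{2\pi}{\tanh(\vartheta t)}\left(|z|^2+|w|^2\right)\right)\exp\left(\frac{4\pi}{\sinh(\vartheta t)}\,S_{\mu t}^{-1}w\cdot z\right),\qquad z,w\in\mathbb{R}^{2d}.$$
   Context: $\mathfrak{R}_{(\vartheta+i\mu)t}$ is the propagator ($u(t,\cdot)=\mathfrak{R}_{(\vartheta+i\mu)t}u_0$), explicitly, for a suitable branch of the square root, $$\mathfrak{R}_{(\vartheta+i\mu)t}u_0(x)=\cosh((\vartheta+i\mu)t)^{-d/2}\int_{\mathbb{R}^d}\widehat{u_0}(\eta)e^{-\pi\tanh((\vartheta+i\mu)t)(|x|^2+|\eta|^2)}e^{2\pi i x\cdot\eta/\cosh((\vartheta+i\mu)t)}d\eta,$$ with $\widehat f(\xi)=\int f(x)e^{-2\pi i x\cdot\xi}dx$. $S_{\mu t}=\begin{pmatrix}\cos(\mu t)I&\sin(\mu t)I\\-\sin(\mu t)I&\cos(\mu t)I\end{pmatrix}\in\mathbb{R}^{2d\times2d}$, $I$ the $d\times d$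 identity. Cross-Wigner distribution: $W(f,g)(x,\xi)=\int_{\mathbb{R}^d}f(x+\frac y2)\overline{g(x-\frac y2)}e^{-2\pi i y\cdot\xi}dy$. The Wigner kernel of a continuous linear $T:\mathcal{S}(\mathbb{R}^d)\to\mathcal{S}'(\mathbb{R}^d)$ is the unique $k_W\in\mathcal{S}'(\mathbb{R}^{4d})$ with $W(Tf,Tg)(z)=\int_{\mathbb{R}^{2d}}k_W(z,w)W(f,g)(w)\,dw$ for all $f,g\in\mathcal{S}(\mathbb{R}^d)$ (integral in the distributional sense).
   Formalization: The printed kernel is false (for μ=0 and a Gaussian it is too small by 2^d, and the rotation is reversed); the formal theorem has the constant (2/sinh(ϑt))^d instead of [sinh(ϑt)]^{-d}, and S_{μt}^{-1}z·w instead of S_{μt}^{-1}w·z. *)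

theory Defs
  imports "HOL-Analysis.Analysis"
begin

section \<open>Schwartz functions and tempered distributions\<close>

text \<open>
  \<open>iterated_deriv [b\<^sub>1, \<dots>, b\<^sub>m] f\<close> is \<open>\<partial>\<^sub>b\<^sub>1 \<dots> \<partial>\<^sub>b\<^sub>m f\<close>; only lists of elements of \<open>Basis\<close> are used, so that
  these are the partial derivatives of all orders. A function is \<open>C\<^sup>\<infinity>\<close> iff all of them exist and
  are themselves Frechet differentiable.
\<close>

definition iterated_deriv ::
    "'a::euclidean_space list \<Rightarrow> ('a \<Rightarrow> complex) \<Rightarrow> 'a \<Rightarrow> complex" where
  "iterated_deriv bs f = foldr (\<lambda>b g x. frechet_derivative g (at x) b) bs f"

definition smooth :: "('a::euclidean_space \<Rightarrow> complex) \<Rightarrow> bool" where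
  "smooth f \<longleftrightarrow> (\<forall>bs. set bs \<subseteq> Basis \<longrightarrow> (\<forall>x. iterated_deriv bs f differentiable (at x)))"

definition schwartz :: "('a::euclidean_space \<Rightarrow> complex) set" where
  "schwartz = {f. smooth f \<and>
     (\<forall>k bs. set bs \<subseteq> Basis \<longrightarrow> bounded (range (\<lambda>x. (1 + norm x) ^ k *\<^sub>R iterated_deriv bs f x)))}"

definition schwartz_norm :: "nat \<Rightarrow> ('a::euclidean_space \<Rightarrow> complex) \<Rightarrow> real" where
  "schwartz_norm m f =
     (\<Sum>bs | set bs \<subseteq> Basis \<and> length bs \<le> m. SUP x. (1 + norm x) ^ m * norm (iterated_deriv bs f x))"

text \<open>
  Distributions are functionals on all functions; only their values on \<^term>\<open>schwartz\<close> are
  meaningful, so two of them are equal as distributions when they agree there. The norms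
  \<^term>\<open>schwartz_norm m\<close> generate the Schwartz topology and increase with \<open>m\<close>, so a linear
  functional is continuous iff it is bounded with respect to one of them.
\<close>

type_synonym 'a distr = "('a \<Rightarrow> complex) \<Rightarrow> complex"

definition linear_on_schwartz :: "'a::euclidean_space distr \<Rightarrow> bool" where
  "linear_on_schwartz F \<longleftrightarrow>
     (\<forall>f\<in>schwartz. \<forall>g\<in>schwartz. F (\<lambda>x. f x + g x) = F f + F g) \<and>
     (\<forall>c. \<forall>f\<in>schwartz. F (\<lambda>x. c * f x) = c * F f)"

definition tempered :: "'a::euclidean_space distr \<Rightarrow> bool" where
  "tempered F \<longleftrightarrow> linear_on_schwartz F \<and>
     (\<exists>C m. \<forall>f\<in>schwartz. norm (F f) \<le> C * schwartz_norm m f)"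

definition distr_of_fun :: "('a::euclidean_space \<Rightarrow> complex) \<Rightarrow> 'a distr" where
  "distr_of_fun u \<phi> = (LINT x|lborel. u x * \<phi> x)"

text \<open>
  Continuity from Schwartz functions to tempered distributions is with respect to the weak-*
  topology on the latter: for each test function \<open>\<phi>\<close> the functional \<open>f \<mapsto> \<langle>T f, \<phi>\<rangle>\<close> is linear and
  continuous.
\<close>

definition schwartz_operator ::
    "(('a::euclidean_space \<Rightarrow> complex) \<Rightarrow> 'b::euclidean_space distr) \<Rightarrow> bool" where
  "schwartz_operator T \<longleftrightarrow>
     (\<forall>f\<in>schwartz. tempered (T f)) \<and> (\<forall>\<phi>\<in>schwartz. tempered (\<lambda>f. T f \<phi>))"

section \<open>Wigner distributions and Wigner kernels\<close>

text \<open>The phase space \<open>\<real>\<^sup>2\<^sup>d\<close> is the product \<open>\<real>\<^sup>d \<times> \<real>\<^sup>d\<close> with its Euclidean structure.\<close>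

definition cross_wigner ::
    "(real^'n \<Rightarrow> complex) \<Rightarrow> (real^'n \<Rightarrow> complex) \<Rightarrow> (real^'n) \<times> (real^'n) \<Rightarrow> complex" where
  "cross_wigner f g = (\<lambda>(x, \<xi>).
     LINT y|lborel. f (x + y /\<^sub>R 2) * cnj (g (x - y /\<^sub>R 2)) * cis (- 2 * pi * (y \<bullet> \<xi>)))"

text \<open>
  The extension of \<open>W\<close> to tempered distributions by duality. For functions \<open>f\<close>, \<open>g\<close> the substitution
  \<open>a = x + y/2\<close>, \<open>b = x - y/2\<close> (of Jacobian 1) gives
  \<open>\<integral> W(f,g) \<Phi> = \<integral>\<integral> f(a) cnj(g(b)) \<Psi>(a,b) da db\<close> with
  \<open>\<Psi>(a,b) = \<integral> \<Phi>((a+b)/2, \<xi>) e\<^sup>-\<^sup>2\<^sup>\<pi>\<^sup>i\<^sup>(\<^sup>a\<^sup>-\<^sup>b\<^sup>)\<^sup>\<cdot>\<^sup>\<xi> d\<xi>\<close>; the right-hand side is the pairing of \<open>\<Psi>\<close> with the tensor product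
  of \<open>f\<close> and the conjugate of \<open>g\<close>, where \<open>\<langle>cnj G, \<phi>\<rangle> = cnj \<langle>G, cnj \<phi>\<rangle>\<close>.
\<close>

definition cross_wigner_dual ::
    "((real^'n) \<times> (real^'n) \<Rightarrow> complex) \<Rightarrow> real^'n \<Rightarrow> real^'n \<Rightarrow> complex" where
  "cross_wigner_dual \<Phi> a b =
     (LINT \<xi>|lborel. \<Phi> ((a + b) /\<^sub>R 2, \<xi>) * cis (- 2 * pi * ((a - b) \<bullet> \<xi>)))"

definition cross_wigner_distr ::
    "(real^'n) distr \<Rightarrow> (real^'n) distr \<Rightarrow> ((real^'n) \<times> (real^'n)) distr" where
  "cross_wigner_distr F G \<Phi> = F (\<lambda>a. cnj (G (\<lambda>b. cnj (cross_wigner_dual \<Phi> a b))))"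

text \<open>
  \<open>W(Tf,Tg)(z) = \<integral> k(z,w) W(f,g)(w) dw\<close> in the sense of distributions: tested against \<open>\<Phi>\<close>, the
  right-hand side is the (bilinear) pairing of \<open>k\<close> with \<open>\<Phi>(z) W(f,g)(w)\<close>.
\<close>

definition wigner_identity ::
    "((real^'n \<Rightarrow> complex) \<Rightarrow> (real^'n) distr) \<Rightarrow>
     (((real^'n) \<times> (real^'n)) \<times> ((real^'n) \<times> (real^'n))) distr \<Rightarrow> bool" where
  "wigner_identity T k \<longleftrightarrow>
     (\<forall>f\<in>schwartz. \<forall>g\<in>schwartz. \<forall>\<Phi>\<in>schwartz.
        cross_wigner_distr (T f) (T g) \<Phi> = k (\<lambda>(z, w). \<Phi> z * cross_wigner f g w))"

definition is_wigner_kernel ::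
    "((real^'n \<Rightarrow> complex) \<Rightarrow> (real^'n) distr) \<Rightarrow>
     (((real^'n) \<times> (real^'n)) \<times> ((real^'n) \<times> (real^'n))) distr \<Rightarrow> bool" where
  "is_wigner_kernel T k \<longleftrightarrow>
     schwartz_operator T \<and> tempered k \<and> wigner_identity T k \<and>
     (\<forall>k'. tempered k' \<and> wigner_identity T k' \<longrightarrow> (\<forall>\<Psi>\<in>schwartz. k' \<Psi> = k \<Psi>))"

section \<open>The complex Hermite propagator\<close>

definition fourier :: "(real^'n \<Rightarrow> complex) \<Rightarrow> real^'n \<Rightarrow> complex" where
  "fourier f \<xi> = (LINT x|lborel. f x * cis (- 2 * pi * (x \<bullet> \<xi>)))"

text \<open>
  The square root of \<open>cosh\<close> on \<open>Re \<zeta> > 0\<close> that extends continuously to the value 1 at \<open>\<zeta> = 0\<close>. It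
  is not \<^term>\<open>csqrt (cosh \<zeta>)\<close>: along \<open>\<zeta> = (\<theta> + i\<mu>)t\<close> the number \<open>cosh \<zeta>\<close> may wind around the
  origin, whereas \<open>1 + e\<^sup>-\<^sup>2\<^sup>\<zeta>\<close> stays in the right half-plane.
\<close>

definition sqrt_cosh :: "complex \<Rightarrow> complex" where
  "sqrt_cosh \<zeta> = exp (\<zeta> / 2) * csqrt ((1 + exp (- 2 * \<zeta>)) / 2)"

lemma sqrt_cosh_0: "sqrt_cosh 0 = 1"
  by (simp add: sqrt_cosh_def)

lemma sqrt_cosh_square: "(sqrt_cosh \<zeta>)\<^sup>2 = cosh \<zeta>"
proof -
  have "(sqrt_cosh \<zeta>)\<^sup>2 = exp \<zeta> * ((1 + exp (- 2 * \<zeta>)) / 2)"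
    by (simp add: sqrt_cosh_def power_mult_distrib flip: exp_double)
  also have "\<dots> = (exp \<zeta> + exp \<zeta> * exp (- 2 * \<zeta>)) / 2"
    by (simp add: field_simps)
  also have "exp \<zeta> * exp (- 2 * \<zeta>) = exp (- \<zeta>)"
    by (simp flip: exp_add)
  finally show ?thesis
    by (simp add: cosh_field_def)
qed

lemma continuous_on_sqrt_cosh: "continuous_on {\<zeta>. Re \<zeta> > 0} sqrt_cosh"
proof -
  have "(1 + exp (- 2 * \<zeta>)) / 2 \<notin> \<real>\<^sub>\<le>\<^sub>0" if "Re \<zeta> > 0" for \<zeta> :: complex
  proof -
    have "\<bar>Re (exp (- 2 * \<zeta>))\<bar> \<le> exp (- 2 * Re \<zeta>)"
      using abs_Re_le_cmod[of "exp (- 2 * \<zeta>)"] by simp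
    also have "\<dots> < 1"
      using that by simp
    finally have "Re ((1 + exp (- 2 * \<zeta>)) / 2) > 0"
      by simp
    then show ?thesis
      by (auto simp: complex_nonpos_Reals_iff)
  qed
  then show ?thesis
    unfolding sqrt_cosh_def
    by (intro continuous_intros continuous_on_compose2[OF continuous_on_csqrt]) auto
qed

text \<open>
  The solution operator \<open>u(0,\<cdot>) \<mapsto> u(t,\<cdot>)\<close> of
  \<open>\<partial>\<^sub>t u = (\<theta> + i\<mu>) (\<Delta>u / (4\<pi>) - \<pi>|x|\<^sup>2 u)\<close>, given by Mehler's formula at \<open>\<zeta> = (\<theta> + i\<mu>)t\<close>.
\<close>

definition hermite_propagator ::
    "complex \<Rightarrow> (real^'n \<Rightarrow> complex) \<Rightarrow> real^'n \<Rightarrow> complex" where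
  "hermite_propagator \<zeta> u\<^sub>0 x =
     inverse (sqrt_cosh \<zeta> ^ CARD('n)) *
     (LINT \<eta>|lborel. fourier u\<^sub>0 \<eta> *
        exp (- of_real pi * tanh \<zeta> * of_real ((norm x)\<^sup>2 + (norm \<eta>)\<^sup>2)) *
        exp (2 * of_real pi * \<i> * of_real (x \<bullet> \<eta>) / cosh \<zeta>))"

text \<open>
  The \<open>2d \<times> 2d\<close> block matrix \<open>((cos \<alpha>) I, (sin \<alpha>) I; -(sin \<alpha>) I, (cos \<alpha>) I)\<close> acting on phase space. For
  \<open>\<theta> = 0\<close> it is the classical flow of the equation, \<open>W(u(t), u(t))(z) = W(u\<^sub>0, u\<^sub>0)(S\<^sup>-\<^sup>1 z)\<close> with
  \<open>S = phase_rotation (\<mu>t)\<close>, which is why the Wigner kernel contains \<open>S\<^sup>-\<^sup>1 z \<bullet> w\<close> (equivalently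
  \<open>z \<bullet> S w\<close>) and not \<open>S\<^sup>-\<^sup>1 w \<bullet> z\<close>. The normalising constant of that kernel is
  \<open>(2 / sinh(\<theta>t))\<^sup>d\<close>: its integral over \<open>w\<close> must tend to 1 as \<open>t \<rightarrow> 0\<close>, where it is asymptotic to
  \<open>(2 / (\<theta>t))\<^sup>d exp (-(2\<pi> / (\<theta>t)) |S\<^sup>-\<^sup>1 z - w|\<^sup>2)\<close>.
\<close>

definition phase_rotation ::
    "real \<Rightarrow> (real^'n) \<times> (real^'n) \<Rightarrow> (real^'n) \<times> (real^'n)" where
  "phase_rotation \<alpha> = (\<lambda>(x, \<xi>).
     (cos \<alpha> *\<^sub>R x + sin \<alpha> *\<^sub>R \<xi>, - sin \<alpha> *\<^sub>R x + cos \<alpha> *\<^sub>R \<xi>))"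

lemma inv_phase_rotation: "inv (phase_rotation \<alpha>) = phase_rotation (- \<alpha>)"
proof (rule inv_unique_comp)
  have c: "cos a * (cos a * r) + sin a * (sin a * r) = r" for a r :: real
    using sin_cos_squared_add3[of a]
    by (metis distrib_right mult.assoc mult_1)
  have *: "phase_rotation a (phase_rotation (- a) z) = z" for a and z :: "(real^'n) \<times> (real^'n)"
    by (cases z) (auto simp: phase_rotation_def vec_eq_iff algebra_simps c)
  show "phase_rotation \<alpha> \<circ> phase_rotation (- \<alpha>) = id"
    using * by (auto simp: fun_eq_iff)
  show "phase_rotation (- \<alpha>) \<circ> phase_rotation \<alpha> = id"
    using *[of "- \<alpha>"] by (auto simp: fun_eq_iff)
qed

end

theory Submission
  imports Defs "HOL-Probability.Probability"
begin

text \<open>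
Mehler's formula makes the propagator an integral operator whose kernel
\<open>K(x,y) = \<kappa> exp (-\<pi> coth \<zeta> (|x|\<^sup>2 + |y|\<^sup>2) + 2\<pi> x \<bullet> y / sinh \<zeta>)\<close> decays like a
Gaussian in \<open>x\<close>, uniformly in \<open>y\<close> (\<open>hermite_propagator_eq_mehler\<close>, \<open>mehler_kernel_bound\<close>).
The value \<open>W(Rf,Rg)(x,\<xi>)\<close> is therefore the integral of \<open>f(y) cnj(g(y'))\<close> against the Fourier transform at \<open>\<xi>\<close> of
\<open>p \<mapsto> K(x + p/2, y) cnj(K(x - p/2, y'))\<close>. Because of the conjugation, the quadratic part in \<open>p\<close> has
the real coefficient \<open>Re (coth \<zeta>) / 2\<close>, so that this Fourier transform is elementary, and it
coincides with the dual Wigner transform of the real Gaussian \<open>k(z, \<cdot>)\<close> at \<open>(y, y')\<close>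
(\<open>mehler_wigner_dual\<close>). Transposing the Wigner transform by Fubini's theorem (\<open>wigner_pairing\<close>) gives
\<open>W(Rf,Rg)(z) = \<integral> k(z,w) W(f,g)(w) dw\<close> pointwise, and pairing with a test function gives the identity
between distributions.

For uniqueness, the Wigner transform of two Gaussians is again a Gaussian
(\<open>cross_wigner_gaussian_packet\<close>). Hence two tempered kernels that satisfy the identity agree on every
packet \<open>v \<mapsto> exp (-2\<pi> |v - u|\<^sup>2 + 2\<pi>i \<nu> \<bullet> (v - u))\<close>. The packets have a fixed width,
and by the uncertainty principle Wigner transforms cannot be arbitrarily concentrated, but a Gaussian
average over the frequency \<open>\<nu>\<close> produces arbitrarily narrow Gaussians centred at \<open>u\<close>,
and a further average over \<open>u\<close> with weight \<open>\<Psi>(u)\<close> produces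
regularisations of any Schwartz function \<open>\<Psi>\<close> (\<open>superposition_packets_eq_regularise\<close>). Tempered
functionals pass through such averages (\<open>tempered_superposition_unique\<close>), and the regularisations
converge to \<open>\<Psi>\<close> in the Schwartz space (\<open>regularise_tendsto\<close>), so the two kernels agree at \<open>\<Psi>\<close>.
\<close>

section \<open>Integration on Euclidean spaces\<close>

lemma lborel_coordinate_product:
  fixes f :: "'a::euclidean_space \<Rightarrow> real \<Rightarrow> 'c::{real_normed_field,banach,second_countable_topology}"
  assumes "\<And>b. b \<in> Basis \<Longrightarrow> integrable lborel (f b)"
  shows integrable_coordinate_product: "integrable lborel (\<lambda>x. \<Prod>b\<in>Basis. f b (x \<bullet> b))"
    and integral_coordinate_product:
      "(LINT x|lborel. (\<Prod>b\<in>Basis. f b (x \<bullet> b))) = (\<Prod>b\<in>Basis. LINT r|lborel. f b r)"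
proof -
  interpret product_sigma_finite "\<lambda>_::'a. lborel :: real measure"
    by standard
  have m [measurable]: "f b \<in> borel_measurable borel" if "b \<in> Basis" for b
    using borel_measurable_integrable[OF assms[OF that]] by simp
  have eq: "(\<Prod>b\<in>Basis. f b ((\<Sum>c\<in>Basis. g c *\<^sub>R c) \<bullet> b)) = (\<Prod>b\<in>Basis. f b (g b))" for g :: "'a \<Rightarrow> real"
    by (intro prod.cong refl) (simp add: inner_sum_left_Basis)
  have d: "(\<lambda>x. \<Prod>b\<in>Basis. f b (x \<bullet> b)) \<in> borel_measurable borel"
    by (intro borel_measurable_prod) (auto intro!: measurable_compose[OF _ m])
  have meas: "(\<lambda>g. \<Sum>b\<in>Basis. g b *\<^sub>R b) \<in> (\<Pi>\<^sub>M b\<in>(Basis::'a set). lborel) \<rightarrow>\<^sub>M borel"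
    by measurable
  show "integrable lborel (\<lambda>x. \<Prod>b\<in>Basis. f b (x \<bullet> b))"
    unfolding lborel_eq[where 'a='a]
    by (subst integrable_distr_eq[OF meas d]) (simp only: eq, intro product_integrable_prod assms finite_Basis)
  show "(LINT x|lborel. (\<Prod>b\<in>Basis. f b (x \<bullet> b))) = (\<Prod>b\<in>Basis. LINT r|lborel. f b r)"
    unfolding lborel_eq[where 'a='a]
    by (subst integral_distr[OF meas d]) (simp only: eq, intro product_integral_prod assms finite_Basis)
qed

text \<open>
The exponent provides a factor \<open>(1 + |x|)\<^sup>-\<^sup>2 \<le> 1 / (1 + (x \<bullet> b)\<^sup>2)\<close> for each coordinate, and the product
of these bounds is integrable by Fubini's theorem.
\<close>

lemma integrable_inverse_polynomial_weight:
  "integrable lborel (\<lambda>x::'a::euclidean_space. inverse ((1 + norm x) ^ (2 * DIM('a))))"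
proof (rule Bochner_Integration.integrable_bound)
  have "integrable lborel (\<lambda>r::real. inverse (1 + r\<^sup>2))"
    using integrable_inverse_1_plus_square by (simp add: set_integrable_def)
  then show "integrable lborel (\<lambda>x::'a. \<Prod>b\<in>Basis. inverse (1 + (x \<bullet> b)\<^sup>2))"
    by (intro integrable_coordinate_product)
  have "inverse ((1 + norm x) ^ (2 * DIM('a))) \<le> (\<Prod>b\<in>Basis. inverse (1 + (x \<bullet> b)\<^sup>2))" for x :: 'a
  proof -
    have "(\<Prod>b\<in>(Basis::'a set). inverse ((1 + norm x)\<^sup>2)) \<le> (\<Prod>b\<in>Basis. inverse (1 + (x \<bullet> b)\<^sup>2))"
    proof (rule prod_mono)
      fix b :: 'a assume b: "b \<in> Basis"
      have "(x \<bullet> b)\<^sup>2 \<le> (norm x)\<^sup>2"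
        using Basis_le_norm[OF b, of x] by (simp add: abs_le_square_iff[symmetric])
      also have "1 + (norm x)\<^sup>2 \<le> (1 + norm x)\<^sup>2"
        by (simp add: power2_sum)
      finally have le: "1 + (x \<bullet> b)\<^sup>2 \<le> (1 + norm x)\<^sup>2" by simp
      have "0 < 1 + (x \<bullet> b)\<^sup>2"
        by (simp add: add_pos_nonneg)
      with le show "0 \<le> inverse ((1 + norm x)\<^sup>2) \<and> inverse ((1 + norm x)\<^sup>2) \<le> inverse (1 + (x \<bullet> b)\<^sup>2)"
        by (auto intro!: le_imp_inverse_le)
    qed
    then show ?thesis
      by (simp add: power_mult power_inverse)
  qed
  then show "AE x in (lborel :: 'a measure). norm (inverse ((1 + norm x) ^ (2 * DIM('a)))) \<le>
      norm (\<Prod>b\<in>Basis. inverse (1 + (x \<bullet> b)\<^sup>2))"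
    by (intro AE_I2) (auto simp: abs_of_nonneg prod_nonneg)
qed measurable

text \<open>
The substitution is invertible, so the two integrals exist together, and the formula is compatible
with the value 0 of a divergent integral.
\<close>

lemma
  fixes f :: "'a::euclidean_space \<Rightarrow> 'b::{banach,second_countable_topology}"
  assumes c: "c \<noteq> 0"
  shows lborel_integrable_affine: "integrable lborel (\<lambda>x. f (t + c *\<^sub>R x)) \<longleftrightarrow> integrable lborel f"
    and lborel_integral_affine:
      "(LINT x|lborel. f x) = \<bar>c\<bar> ^ DIM('a) *\<^sub>R (LINT x|lborel. f (t + c *\<^sub>R x))"
proof -
  have aff: "integrable lborel (\<lambda>x. g (s + d *\<^sub>R x)) \<and>
      (LINT x|lborel. g x) = \<bar>d\<bar> ^ DIM('a) *\<^sub>R (LINT x|lborel. g (s + d *\<^sub>R x))"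
    if g: "integrable lborel g" and d: "d \<noteq> 0" for g :: "'a \<Rightarrow> 'b" and s d
  proof -
    have [measurable]: "g \<in> borel_measurable borel"
      using borel_measurable_integrable[OF g] by simp
    have "integrable (density (distr lborel borel (\<lambda>x. s + d *\<^sub>R x)) (\<lambda>_. ennreal (\<bar>d\<bar> ^ DIM('a)))) g"
      using g lborel_affine[OF d, of s] by simp
    then have "integrable lborel (\<lambda>x. \<bar>d\<bar> ^ DIM('a) *\<^sub>R g (s + d *\<^sub>R x))"
      by (simp add: integrable_density integrable_distr_eq)
    then have "integrable lborel (\<lambda>x. inverse (\<bar>d\<bar> ^ DIM('a)) *\<^sub>R (\<bar>d\<bar> ^ DIM('a) *\<^sub>R g (s + d *\<^sub>R x)))"
      by (rule integrable_scaleR_right)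
    with d have "integrable lborel (\<lambda>x. g (s + d *\<^sub>R x))"
      by simp
    moreover have "(LINT x|lborel. g x) =
        (LINT x|density (distr lborel borel (\<lambda>x. s + d *\<^sub>R x)) (\<lambda>_. ennreal (\<bar>d\<bar> ^ DIM('a))). g x)"
      using lborel_affine[OF d, of s] by simp
    ultimately show ?thesis
      by (simp add: integral_density integral_distr)
  qed
  have cancel: "(\<lambda>x. f (t + c *\<^sub>R (- (1 / c) *\<^sub>R t + (1 / c) *\<^sub>R x))) = f"
    using c by (simp add: algebra_simps)
  show iff: "integrable lborel (\<lambda>x. f (t + c *\<^sub>R x)) \<longleftrightarrow> integrable lborel f"
    using aff[of f c t] aff[of "\<lambda>x. f (t + c *\<^sub>R x)" "1 / c" "- (1 / c) *\<^sub>R t"] c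
    unfolding cancel by auto
  show "(LINT x|lborel. f x) = \<bar>c\<bar> ^ DIM('a) *\<^sub>R (LINT x|lborel. f (t + c *\<^sub>R x))"
    using aff[of f c t] c iff by (cases "integrable lborel f") (auto simp: not_integrable_integral_eq)
qed

lemma
  fixes f :: "'a::euclidean_space \<times> 'b::euclidean_space \<Rightarrow> 'c::{banach,second_countable_topology}"
  assumes f: "integrable lborel f"
  shows integral_lborel_fst: "(LINT x|lborel. LINT y|lborel. f (x, y)) = (LINT z|lborel. f z)"
    and integral_lborel_snd: "(LINT y|lborel. LINT x|lborel. f (x, y)) = (LINT z|lborel. f z)"
  using lborel_pair.integral_fst'[of f] lborel_pair.integral_snd[of "\<lambda>x y. f (x, y)"] f
  by (simp_all add: lborel_prod)

lemma integral_lborel_swap: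
  fixes f :: "'a::euclidean_space \<times> 'b::euclidean_space \<Rightarrow> 'c::{banach,second_countable_topology}"
  assumes "integrable lborel f"
  shows "(LINT x|lborel. LINT y|lborel. f (x, y)) = (LINT y|lborel. LINT x|lborel. f (x, y))"
  by (simp add: integral_lborel_fst[OF assms] integral_lborel_snd[OF assms])

lemma integrable_tensor:
  fixes F :: "'a::euclidean_space \<Rightarrow> 'c::{real_normed_field,banach,second_countable_topology}"
    and G :: "'b::euclidean_space \<Rightarrow> 'c"
  assumes F: "integrable lborel F" and G: "integrable lborel G"
  shows "integrable lborel (\<lambda>(x, y). F x * G y)"
proof -
  have [measurable]: "F \<in> borel_measurable borel" "G \<in> borel_measurable borel"
    using borel_measurable_integrable[OF F] borel_measurable_integrable[OF G] by simp_all
  have "integrable (lborel \<Otimes>\<^sub>M lborel) (\<lambda>(x, y). F x * G y)"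
  proof (rule lborel_pair.Fubini_integrable)
    show "(\<lambda>(x, y). F x * G y) \<in> borel_measurable (lborel \<Otimes>\<^sub>M lborel)"
      by measurable
    show "integrable lborel (\<lambda>x. LINT y|lborel. norm (case (x, y) of (x, y) \<Rightarrow> F x * G y))"
      using F G by (simp add: norm_mult)
    show "AE x in lborel. integrable lborel (\<lambda>y. case (x, y) of (x, y) \<Rightarrow> F x * G y)"
      using G by simp
  qed
  then show ?thesis
    by (simp add: lborel_prod)
qed

lemma integrable_of_norm_le:
  fixes f :: "'a::euclidean_space \<Rightarrow> complex" and g :: "'a \<Rightarrow> real"
  assumes "integrable lborel g" "f \<in> borel_measurable borel" "\<And>x. norm (f x) \<le> g x"
  shows "integrable lborel f"
  by (rule Bochner_Integration.integrable_bound[OF assms(1)])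
    (use assms(2,3) in \<open>auto intro!: AE_I2 order_trans[OF assms(3) abs_ge_self]\<close>)

lemma integrable_mult_bounded:
  fixes f g :: "'a::euclidean_space \<Rightarrow> complex"
  assumes f: "integrable lborel f" and [measurable]: "g \<in> borel_measurable borel"
    and B: "\<And>x. norm (g x) \<le> B"
  shows "integrable lborel (\<lambda>x. f x * g x)" "integrable lborel (\<lambda>x. g x * f x)"
proof -
  have [measurable]: "f \<in> borel_measurable borel"
    using borel_measurable_integrable[OF f] by simp
  have "integrable lborel (\<lambda>x. norm (f x) * B)"
    using f by simp
  then show "integrable lborel (\<lambda>x. f x * g x)"
  proof (rule Bochner_Integration.integrable_bound)
    have "0 \<le> B"
      by (rule order_trans[OF norm_ge_zero B])
    then show "AE x in lborel. norm (f x * g x) \<le> norm (norm (f x) * B)"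
      by (simp add: norm_mult mult_left_mono B)
  qed measurable
  then show "integrable lborel (\<lambda>x. g x * f x)"
    by (simp add: mult.commute)
qed

lemma distr_lborel_swap:
  "distr lborel borel (\<lambda>(y, x). (x, y)) = (lborel :: ('a::euclidean_space \<times> 'b::euclidean_space) measure)"
proof -
  have "distr lborel borel (\<lambda>(y::'b, x::'a). (x, y)) =
      distr (lborel \<Otimes>\<^sub>M lborel) (lborel \<Otimes>\<^sub>M lborel) (\<lambda>(y::'b, x::'a). (x, y))"
    by (rule distr_cong) (simp_all only: lborel_prod sets_lborel)
  also have "\<dots> = lborel \<Otimes>\<^sub>M lborel"
    by (rule lborel_pair.distr_pair_swap[symmetric])
  finally show ?thesis
    by (simp only: lborel_prod)
qed

text \<open>
A shear with an arbitrary measurable displacement \<open>t\<close>, combined with a reflection of the fibres if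
\<open>s = -1\<close>, preserves Lebesgue measure because it does so on each fibre over \<open>x\<close>. Shears of this kind
are the only changes of variables on a product that the Wigner transform requires.
\<close>

lemma distr_lborel_fibre:
  fixes t :: "'a::euclidean_space \<Rightarrow> 'b::euclidean_space"
  assumes t [measurable]: "t \<in> borel_measurable borel" and s: "\<bar>s\<bar> = 1"
  shows "distr lborel borel (\<lambda>(x, y). (x, t x + s *\<^sub>R y)) = lborel"
proof (rule measure_eqI)
  have T [measurable]: "(\<lambda>(x, y). (x, t x + s *\<^sub>R y)) \<in> borel \<rightarrow>\<^sub>M borel"
    unfolding borel_prod[symmetric] by measurable
  fix A assume "A \<in> sets (distr lborel borel (\<lambda>(x, y). (x, t x + s *\<^sub>R y)))"
  then have A [measurable]: "A \<in> sets borel" by simp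
  have A' [measurable]: "A \<in> sets (borel \<Otimes>\<^sub>M borel)"
    using A by (simp only: borel_prod)
  have tr: "(\<integral>\<^sup>+y. g (c + s *\<^sub>R y) \<partial>lborel) = (\<integral>\<^sup>+y. g y \<partial>lborel)"
    if [measurable]: "g \<in> borel_measurable borel" for g :: "'b \<Rightarrow> ennreal" and c
  proof -
    have "lborel = distr lborel borel (\<lambda>x::'b. c + s *\<^sub>R x)"
      using lborel_affine[of s c] s by (auto simp: density_1)
    then have "(\<integral>\<^sup>+y. g y \<partial>lborel) = (\<integral>\<^sup>+y. g y \<partial>distr lborel borel (\<lambda>x::'b. c + s *\<^sub>R x))"
      by simp
    then show ?thesis
      by (simp add: nn_integral_distr)
  qed
  have "emeasure (distr lborel borel (\<lambda>(x, y). (x, t x + s *\<^sub>R y))) A =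
      (\<integral>\<^sup>+z. indicator A (case z of (x, y) \<Rightarrow> (x, t x + s *\<^sub>R y)) \<partial>lborel)"
    by (subst nn_integral_indicator[symmetric, of _ "distr _ _ _"], simp)
      (subst nn_integral_distr, auto)
  also have "\<dots> = (\<integral>\<^sup>+x. \<integral>\<^sup>+y. indicator A (x, t x + s *\<^sub>R y) \<partial>lborel \<partial>lborel)"
    unfolding lborel_prod[symmetric] by (subst lborel.nn_integral_fst[symmetric]) auto
  also have "\<dots> = (\<integral>\<^sup>+x. \<integral>\<^sup>+y. indicator A (x, y) \<partial>lborel \<partial>lborel)"
  proof (rule nn_integral_cong)
    fix x :: 'a
    show "(\<integral>\<^sup>+y. indicator A (x, t x + s *\<^sub>R y) \<partial>lborel) = (\<integral>\<^sup>+y. indicator A (x, y) \<partial>lborel)"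
      by (rule tr) measurable
  qed
  also have "\<dots> = (\<integral>\<^sup>+z. indicator A z \<partial>lborel)"
    unfolding lborel_prod[symmetric] by (subst lborel.nn_integral_fst) auto
  finally show "emeasure (distr lborel borel (\<lambda>(x, y). (x, t x + s *\<^sub>R y))) A = emeasure lborel A"
    by simp
qed simp

text \<open>
The coordinates in which a Wigner transform is written: midpoint and difference of two points.
\<close>

definition midpoint_map :: "'a::euclidean_space \<times> 'a \<Rightarrow> 'a \<times> 'a" where
  "midpoint_map = (\<lambda>(x, p). (x + p /\<^sub>R 2, x - p /\<^sub>R 2))"

text \<open>
The Jacobian is 1 because the map is a composition of coordinate swaps and shears, namely
\<open>(x, p) \<mapsto> (x + p/2, p) \<mapsto> (a, a - p)\<close>.
\<close>

lemma
  shows measurable_midpoint_map [measurable]: "midpoint_map \<in> (borel :: ('a::euclidean_space \<times> 'a) measure) \<rightarrow>\<^sub>M borel"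
    and distr_midpoint_map: "distr lborel borel midpoint_map = (lborel :: ('a::euclidean_space \<times> 'a) measure)"
proof -
  let ?\<sigma> = "\<lambda>(y, x). (x, y) :: 'a \<times> 'a"
  let ?f = "\<lambda>(p, x). (p, (1/2) *\<^sub>R p + 1 *\<^sub>R x) :: 'a \<times> 'a"
  let ?g = "\<lambda>(a, p). (a, a + (-1) *\<^sub>R p) :: 'a \<times> 'a"
  have m [measurable]: "?\<sigma> \<in> borel \<rightarrow>\<^sub>M borel" "?f \<in> borel \<rightarrow>\<^sub>M borel" "?g \<in> borel \<rightarrow>\<^sub>M borel"
    unfolding borel_prod[symmetric] by measurable
  have eq: "midpoint_map = ?g \<circ> (?\<sigma> \<circ> (?f \<circ> ?\<sigma>))"
    by (auto simp: midpoint_map_def fun_eq_iff add.commute scaleR_2[symmetric])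
      (simp_all add: algebra_simps flip: scaleR_add_left)
  show "midpoint_map \<in> (borel :: ('a \<times> 'a) measure) \<rightarrow>\<^sub>M borel"
    unfolding eq by (rule measurable_comp[OF measurable_comp[OF measurable_comp[OF m(1,2)] m(1)] m(3)])
  have f: "distr lborel borel ?f = lborel"
    by (rule distr_lborel_fibre) simp_all
  have g: "distr lborel borel ?g = lborel"
    by (rule distr_lborel_fibre) simp_all
  have comp: "distr lborel borel (k \<circ> h) = lborel"
    if "distr lborel borel h = lborel" "distr lborel borel k = lborel"
      and [measurable]: "h \<in> borel \<rightarrow>\<^sub>M borel" "k \<in> borel \<rightarrow>\<^sub>M borel" for h k :: "'a \<times> 'a \<Rightarrow> 'a \<times> 'a"
  proof -
    have "distr (distr lborel borel h) borel k = distr lborel borel (k \<circ> h)"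
      by (rule distr_distr) measurable
    with that(1,2) show ?thesis by simp
  qed
  show "distr lborel borel midpoint_map = (lborel :: ('a \<times> 'a) measure)"
    unfolding eq
    by (rule comp[OF comp[OF comp[OF distr_lborel_swap f] distr_lborel_swap] g]; intro measurable_comp[OF m(1,2)] measurable_comp[OF measurable_comp[OF m(1,2)] m(1)] m)
qed

lemma
  fixes f :: "'a::euclidean_space \<times> 'a \<Rightarrow> 'c::{banach,second_countable_topology}"
  assumes f: "integrable lborel f"
  shows integrable_midpoint: "integrable lborel (\<lambda>(x, p). f (x + p /\<^sub>R 2, x - p /\<^sub>R 2))"
    and integral_midpoint: "(LINT z|lborel. f z) =
      (LINT x|lborel. LINT p|lborel. f (x + p /\<^sub>R 2, x - p /\<^sub>R 2))"
proof -
  have [measurable]: "f \<in> borel_measurable borel"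
    using borel_measurable_integrable[OF f] by simp
  have eq: "(\<lambda>z. f (midpoint_map z)) = (\<lambda>(x, p). f (x + p /\<^sub>R 2, x - p /\<^sub>R 2))"
    by (auto simp: midpoint_map_def)
  have "integrable (distr lborel borel midpoint_map) f"
    using f by (simp add: distr_midpoint_map)
  then show int: "integrable lborel (\<lambda>(x, p). f (x + p /\<^sub>R 2, x - p /\<^sub>R 2))"
    by (subst (asm) integrable_distr_eq) (simp_all add: eq)
  have "(LINT z|lborel. f z) = (LINT z|distr lborel borel midpoint_map. f z)"
    by (simp add: distr_midpoint_map)
  also have "\<dots> = (LINT z|lborel. (\<lambda>(x, p). f (x + p /\<^sub>R 2, x - p /\<^sub>R 2)) z)"
    by (subst integral_distr) (simp_all add: eq[unfolded fun_eq_iff, rule_format])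
  finally show "(LINT z|lborel. f z) = (LINT x|lborel. LINT p|lborel. f (x + p /\<^sub>R 2, x - p /\<^sub>R 2))"
    using integral_lborel_fst[OF int] by simp
qed

text \<open>
Differentiation under the integral sign. By the mean value inequality the difference quotient of
\<open>f\<close> is bounded by \<open>B\<close> on the convex set \<open>S\<close>, so \<open>2 B\<close> dominates the remainder of the linear
approximation, and dominated convergence applies along every sequence that tends to \<open>x\<close>.
\<close>

lemma has_derivative_integral_dominated:
  fixes f :: "'v::real_normed_vector \<Rightarrow> 'u \<Rightarrow> 'c::{banach,second_countable_topology}"
  assumes S: "open S" "convex S" and x: "x \<in> S"
    and int: "\<And>v. v \<in> S \<Longrightarrow> integrable M (f v)"
    and deriv: "\<And>v u. v \<in> S \<Longrightarrow> ((\<lambda>v. f v u) has_derivative f' v u) (at v)"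
    and meas [measurable]: "\<And>h. (\<lambda>u. f' x u h) \<in> borel_measurable M"
    and bound: "\<And>v u h. v \<in> S \<Longrightarrow> norm (f' v u h) \<le> B u * norm h"
    and B: "integrable M B" "\<And>u. 0 \<le> B u"
  shows "((\<lambda>v. LINT u|M. f v u) has_derivative (\<lambda>h. LINT u|M. f' x u h)) (at x)"
proof -
  have int': "integrable M (\<lambda>u. f' x u h)" for h
    by (rule Bochner_Integration.integrable_bound[OF integrable_mult_left[OF B(1), of "norm h"]])
      (use bound[OF x] B(2) in auto)
  have lin: "linear (f' x u)" for u
    using deriv[OF x] has_derivative_linear by blast
  have lip: "norm (f y u - f x u) \<le> B u * norm (y - x)" if "y \<in> S" for y u
    using that S(2) x
    by (intro differentiable_bound[where S=S and f'="\<lambda>v. f' v u"] onorm_bound B(2))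
      (auto intro!: bound has_derivative_at_withinI deriv)
  let ?q = "\<lambda>y u. (f y u - f x u - f' x u (y - x)) /\<^sub>R norm (y - x)"
  have bl: "bounded_linear (\<lambda>h. LINT u|M. f' x u h)"
  proof (rule bounded_linear_intro[where K="LINT u|M. B u"])
    show "norm (LINT u|M. f' x u h) \<le> norm h * (LINT u|M. B u)" for h
    proof -
      have "norm (LINT u|M. f' x u h) \<le> (LINT u|M. norm (f' x u h))"
        by (rule integral_norm_bound)
      also have "\<dots> \<le> (LINT u|M. B u * norm h)"
        by (intro integral_mono integrable_norm int' integrable_mult_left B bound x)
      finally show ?thesis by (simp add: mult.commute)
    qed
  qed (auto simp: linear_add[OF lin] linear_scale[OF lin] int')
  have "((\<lambda>y. LINT u|M. ?q y u) \<longlongrightarrow> 0) (at x within S)"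
    unfolding tendsto_at_iff_sequentially
  proof (intro allI impI)
    fix X assume X: "\<forall>i. X i \<in> S - {x}" "X \<longlonglongrightarrow> x"
    have "(\<lambda>i. LINT u|M. ?q (X i) u) \<longlonglongrightarrow> (LINT u|M. 0)"
    proof (rule integral_dominated_convergence[where w="\<lambda>u. 2 * B u"])
      have mf: "(\<lambda>u. f (X i) u) \<in> borel_measurable M" "(\<lambda>u. f x u) \<in> borel_measurable M" for i
        using X(1) x int by auto
      show "(\<lambda>u. ?q (X i) u) \<in> borel_measurable M" for i
        using mf by measurable
      show "AE u in M. (\<lambda>i. ?q (X i) u) \<longlonglongrightarrow> 0"
      proof (intro AE_I2)
        fix u
        have "((\<lambda>y. ?q y u) \<longlongrightarrow> 0) (at x within S)"
          using has_derivative_at_withinI[OF deriv[OF x, of u], of S]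
          by (simp add: has_derivative_at_within)
        then show "(\<lambda>i. ?q (X i) u) \<longlonglongrightarrow> 0"
          using X unfolding tendsto_at_iff_sequentially comp_def by blast
      qed
      show "AE u in M. norm (?q (X i) u) \<le> 2 * B u" for i
      proof (intro AE_I2)
        fix u
        have "norm (f (X i) u - f x u - f' x u (X i - x)) \<le> B u * norm (X i - x) + B u * norm (X i - x)"
          by (rule order_trans[OF norm_triangle_ineq4], intro add_mono lip bound x) (use X in auto)
        moreover have "0 < norm (X i - x)"
          using X by auto
        ultimately have "norm (f (X i) u - f x u - f' x u (X i - x)) / norm (X i - x) \<le> 2 * B u"
          by (subst pos_divide_le_eq) (auto simp: mult.assoc)
        then show "norm (?q (X i) u) \<le> 2 * B u"
          by (simp only: norm_scaleR) (simp add: divide_inverse mult.commute)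
      qed
    qed (use B in auto)
    then show "((\<lambda>y. LINT u|M. ?q y u) \<circ> X) \<longlonglongrightarrow> 0"
      by (simp add: comp_def)
  qed
  moreover have "(LINT u|M. ?q y u) =
      ((LINT u|M. f y u) - (LINT u|M. f x u) - (LINT u|M. f' x u (y - x))) /\<^sub>R norm (y - x)"
    if "y \<in> S" for y
    using int[OF that] int[OF x] int' by simp
  then have "\<forall>\<^sub>F y in at x within S. (LINT u|M. ?q y u) =
      ((LINT u|M. f y u) - (LINT u|M. f x u) - (LINT u|M. f' x u (y - x))) /\<^sub>R norm (y - x)"
    unfolding eventually_at_filter by (intro always_eventually allI impI)
  ultimately have "((\<lambda>y. ((LINT u|M. f y u) - (LINT u|M. f x u) - (LINT u|M. f' x u (y - x))) /\<^sub>R norm (y - x))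
      \<longlongrightarrow> 0) (at x within S)"
    by (rule tendsto_cong[THEN iffD1, rotated])
  then show ?thesis
    unfolding has_derivative_at_within at_within_open[OF x S(1)] using bl by blast
qed

lemma measurable_cis_compose [measurable (raw)]:
  assumes [measurable]: "f \<in> borel_measurable M"
  shows "(\<lambda>x. cis (f x)) \<in> borel_measurable M"
  by (intro measurable_compose[OF assms] borel_measurable_continuous_onI continuous_intros)

lemma measurable_cnj_compose [measurable (raw)]:
  assumes "f \<in> borel_measurable M"
  shows "(\<lambda>x. cnj (f x)) \<in> borel_measurable M"
  by (intro measurable_compose[OF assms] borel_measurable_continuous_onI continuous_intros)

section \<open>Schwartz functions\<close>

lemma iterated_deriv_Nil [simp]: "iterated_deriv [] f = f"
  by (simp add: iterated_deriv_def)

lemma iterated_deriv_Cons: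
  "iterated_deriv (b # bs) f = (\<lambda>x. frechet_derivative (iterated_deriv bs f) (at x) b)"
  by (simp add: iterated_deriv_def)

text \<open>
To find all partial derivatives of \<open>f\<close> and to see that \<open>f\<close> is smooth, it suffices to exhibit a family
\<open>J\<close> of candidates that is closed under total differentiation. This avoids inductions over the
derivatives of concrete functions: sums, translates and integrals of Schwartz functions are all
treated by writing down their jets.
\<close>

lemma
  fixes J :: "'a::euclidean_space list \<Rightarrow> 'a \<Rightarrow> complex"
  assumes J0: "J [] = f"
    and J: "\<And>bs x. set bs \<subseteq> Basis \<Longrightarrow>
      (J bs has_derivative (\<lambda>h. \<Sum>b\<in>Basis. (h \<bullet> b) *\<^sub>R J (b # bs) x)) (at x)"
  shows iterated_deriv_jet: "set bs \<subseteq> Basis \<Longrightarrow> iterated_deriv bs f = J bs"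
    and smooth_jet: "smooth f"
proof -
  show eq: "iterated_deriv bs f = J bs" if "set bs \<subseteq> Basis" for bs
    using that
  proof (induction bs)
    case (Cons b bs)
    have "frechet_derivative (J bs) (at x) b = J (b # bs) x" for x
    proof -
      have "frechet_derivative (J bs) (at x) b = (\<Sum>c\<in>Basis. (b \<bullet> c) *\<^sub>R J (c # bs) x)"
        using Cons.prems by (subst frechet_derivative_at[OF J[of bs x], symmetric]) auto
      also have "\<dots> = (\<Sum>c\<in>Basis. if b = c then J (c # bs) x else 0)"
        using Cons.prems by (intro sum.cong) (auto simp: inner_Basis)
      finally show ?thesis
        using Cons.prems by simp
    qed
    moreover have "iterated_deriv bs f = J bs"
      using Cons by simp
    ultimately show ?case
      by (intro ext) (simp only: iterated_deriv_Cons)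
  qed (simp add: J0)
  show "smooth f"
    unfolding smooth_def
  proof (intro allI impI)
    fix bs :: "'a list" and x assume bs: "set bs \<subseteq> Basis"
    show "iterated_deriv bs f differentiable at x"
      unfolding eq[OF bs] differentiable_def using J[OF bs] by blast
  qed
qed

lemma iterated_deriv_has_derivative:
  assumes "smooth f" "set bs \<subseteq> Basis"
  shows "(iterated_deriv bs f has_derivative
           (\<lambda>h. \<Sum>b\<in>Basis. (h \<bullet> b) *\<^sub>R iterated_deriv (b # bs) f x)) (at x)"
proof -
  let ?D = "frechet_derivative (iterated_deriv bs f) (at x)"
  have D: "(iterated_deriv bs f has_derivative ?D) (at x)"
    using assms by (simp add: smooth_def flip: frechet_derivative_works)
  then interpret bounded_linear ?D
    by (rule has_derivative_bounded_linear)
  have eq: "?D h = (\<Sum>b\<in>Basis. (h \<bullet> b) *\<^sub>R ?D b)" for h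
  proof -
    have "?D (\<Sum>b\<in>Basis. (h \<bullet> b) *\<^sub>R b) = (\<Sum>b\<in>Basis. (h \<bullet> b) *\<^sub>R ?D b)"
      unfolding sum scaleR by (rule refl)
    then show ?thesis
      unfolding euclidean_representation .
  qed
  have "?D = (\<lambda>h. \<Sum>b\<in>Basis. (h \<bullet> b) *\<^sub>R iterated_deriv (b # bs) f x)"
    by (rule ext, subst eq) (simp only: iterated_deriv_Cons)
  with D show ?thesis
    by (rule has_derivative_eq_rhs)
qed

lemma continuous_on_iterated_deriv:
  assumes "smooth f" "set bs \<subseteq> Basis"
  shows "continuous_on UNIV (iterated_deriv bs f)"
  using has_derivative_continuous[OF iterated_deriv_has_derivative[OF assms]]
  by (intro continuous_at_imp_continuous_on) simp

lemma schwartz_smooth: "f \<in> schwartz \<Longrightarrow> smooth f"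
  by (simp add: schwartz_def)

lemma schwartz_measurable:
  assumes "f \<in> schwartz"
  shows "f \<in> borel_measurable borel"
  using continuous_on_iterated_deriv[OF schwartz_smooth[OF assms], of "[]"]
  by (simp add: borel_measurable_continuous_onI)

lemma schwartz_decay:
  assumes "f \<in> schwartz" "set bs \<subseteq> Basis"
  obtains C where "C \<ge> 0" "\<And>x. (1 + norm x) ^ k * norm (iterated_deriv bs f x) \<le> C"
proof -
  have "bounded (range (\<lambda>x. (1 + norm x) ^ k *\<^sub>R iterated_deriv bs f x))"
    using assms by (auto simp: schwartz_def)
  then obtain C where "\<And>x. norm ((1 + norm x) ^ k *\<^sub>R iterated_deriv bs f x) \<le> C"
    by (auto simp: bounded_iff)
  then have C: "(1 + norm x) ^ k * norm (iterated_deriv bs f x) \<le> C" for x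
    by simp
  have "C \<ge> 0"
    by (rule order_trans[OF _ C[of 0]]) simp
  then show ?thesis
    using that C by blast
qed

lemma schwartzI:
  assumes "smooth f"
    and "\<And>k bs. set bs \<subseteq> Basis \<Longrightarrow> \<exists>C. \<forall>x. (1 + norm x) ^ k * norm (iterated_deriv bs f x) \<le> C"
  shows "f \<in> schwartz"
  using assms by (fastforce simp: schwartz_def bounded_iff)

lemma schwartz_bounded:
  assumes "f \<in> schwartz"
  obtains B where "\<And>x. norm (f x) \<le> B"
  using schwartz_decay[OF assms, of "[]" 0] by auto

lemma
  assumes "f \<in> schwartz" "g \<in> schwartz"
  shows schwartz_add: "(\<lambda>x. f x + g x) \<in> schwartz"
    and iterated_deriv_add: "set bs \<subseteq> Basis \<Longrightarrow>
      iterated_deriv bs (\<lambda>x. f x + g x) = (\<lambda>x. iterated_deriv bs f x + iterated_deriv bs g x)"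
proof -
  let ?J = "\<lambda>bs x. iterated_deriv bs f x + iterated_deriv bs g x"
  have J: "(?J bs has_derivative (\<lambda>h. \<Sum>b\<in>Basis. (h \<bullet> b) *\<^sub>R ?J (b # bs) x)) (at x)"
    if "set bs \<subseteq> Basis" for bs x
    by (rule has_derivative_eq_rhs, rule has_derivative_add)
      (use assms that in \<open>auto intro!: iterated_deriv_has_derivative schwartz_smooth
        simp: scaleR_add_right sum.distrib \<close>)
  note jet = iterated_deriv_jet[of ?J, OF _ J] smooth_jet[of ?J, OF _ J]
  show eq: "iterated_deriv bs (\<lambda>x. f x + g x) = ?J bs" if "set bs \<subseteq> Basis" for bs
    using jet(1) that by simp
  show "(\<lambda>x. f x + g x) \<in> schwartz"
  proof (rule schwartzI)
    fix k and bs :: "'a list" assume bs: "set bs \<subseteq> Basis"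
    obtain C D where C: "\<And>x. (1 + norm x) ^ k * norm (iterated_deriv bs f x) \<le> C"
      and D: "\<And>x. (1 + norm x) ^ k * norm (iterated_deriv bs g x) \<le> D"
      using schwartz_decay[OF assms(1) bs] schwartz_decay[OF assms(2) bs] by metis
    have "(1 + norm x) ^ k * norm (?J bs x) \<le> C + D" for x
    proof -
      have "(1 + norm x) ^ k * norm (?J bs x) \<le>
          (1 + norm x) ^ k * (norm (iterated_deriv bs f x) + norm (iterated_deriv bs g x))"
        by (intro mult_left_mono norm_triangle_ineq) simp
      with C[of x] D[of x] show ?thesis by (simp add: distrib_left)
    qed
    then show "\<exists>C. \<forall>x. (1 + norm x) ^ k * norm (iterated_deriv bs (\<lambda>x. f x + g x) x) \<le> C"
      unfolding eq[OF bs] by blast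
  qed (use jet in auto)
qed

lemma
  assumes "f \<in> schwartz"
  shows schwartz_cmult: "(\<lambda>x. c * f x) \<in> schwartz"
    and iterated_deriv_cmult: "set bs \<subseteq> Basis \<Longrightarrow>
      iterated_deriv bs (\<lambda>x. c * f x) = (\<lambda>x. c * iterated_deriv bs f x)"
proof -
  let ?J = "\<lambda>bs x. c * iterated_deriv bs f x"
  have J: "(?J bs has_derivative (\<lambda>h. \<Sum>b\<in>Basis. (h \<bullet> b) *\<^sub>R ?J (b # bs) x)) (at x)"
    if "set bs \<subseteq> Basis" for bs x
    by (rule has_derivative_eq_rhs, rule has_derivative_mult_right)
      (use assms that in \<open>auto intro!: iterated_deriv_has_derivative schwartz_smooth
        simp: sum_distrib_left \<close>)
  note jet = iterated_deriv_jet[of ?J, OF _ J] smooth_jet[of ?J, OF _ J]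
  show eq: "iterated_deriv bs (\<lambda>x. c * f x) = ?J bs" if "set bs \<subseteq> Basis" for bs
    using jet(1) that by simp
  show "(\<lambda>x. c * f x) \<in> schwartz"
  proof (rule schwartzI)
    fix k and bs :: "'a list" assume bs: "set bs \<subseteq> Basis"
    obtain C where C: "\<And>x. (1 + norm x) ^ k * norm (iterated_deriv bs f x) \<le> C"
      using schwartz_decay[OF assms bs] by metis
    have "(1 + norm x) ^ k * norm (?J bs x) \<le> norm c * C" for x
      using mult_left_mono[OF C[of x] norm_ge_zero[of c]] by (simp add: norm_mult mult_ac)
    then show "\<exists>C. \<forall>x. (1 + norm x) ^ k * norm (iterated_deriv bs (\<lambda>x. c * f x) x) \<le> C"
      unfolding eq[OF bs] by blast
  qed (use jet in auto)
qed

lemma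
  assumes "f \<in> schwartz" "g \<in> schwartz"
  shows schwartz_diff: "(\<lambda>x. f x - g x) \<in> schwartz"
    and iterated_deriv_diff: "set bs \<subseteq> Basis \<Longrightarrow>
      iterated_deriv bs (\<lambda>x. f x - g x) = (\<lambda>x. iterated_deriv bs f x - iterated_deriv bs g x)"
  using schwartz_add[OF assms(1) schwartz_cmult[OF assms(2), of "-1"]]
    iterated_deriv_add[OF assms(1) schwartz_cmult[OF assms(2), of "-1"], of bs]
    iterated_deriv_cmult[OF assms(2), of bs "-1"] by simp_all

lemma finite_derivative_multiindices:
  "finite {bs :: 'a::euclidean_space list. set bs \<subseteq> Basis \<and> length bs \<le> m}"
  by (rule finite_lists_length_le) simp

lemma schwartz_norm_bound:
  fixes f :: "'a::euclidean_space \<Rightarrow> complex"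
  assumes "f \<in> schwartz" "set bs \<subseteq> Basis" "length bs \<le> m"
  shows "(1 + norm x) ^ m * norm (iterated_deriv bs f x) \<le> schwartz_norm m f"
proof -
  let ?s = "\<lambda>bs. SUP x. (1 + norm x) ^ m * norm (iterated_deriv bs f x)"
  have le: "(1 + norm x) ^ m * norm (iterated_deriv bs f x) \<le> ?s bs" if "set bs \<subseteq> Basis" for bs x
  proof (rule cSUP_upper)
    obtain C where "\<And>x. (1 + norm x) ^ m * norm (iterated_deriv bs f x) \<le> C"
      using schwartz_decay[OF assms(1) \<open>set bs \<subseteq> Basis\<close>] by metis
    then show "bdd_above (range (\<lambda>x. (1 + norm x) ^ m * norm (iterated_deriv bs f x)))"
      by (auto simp: bdd_above_def)
  qed simp
  have "0 \<le> ?s bs" if "set bs \<subseteq> Basis" for bs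
    using le[OF that, of 0] by (rule order_trans[rotated]) simp
  then have "?s bs \<le> schwartz_norm m f"
    unfolding schwartz_norm_def using assms
    by (intro member_le_sum finite_derivative_multiindices) auto
  with le[OF assms(2), of x] show ?thesis by linarith
qed

lemma schwartz_norm_le:
  fixes f :: "'a::euclidean_space \<Rightarrow> complex"
  assumes "\<And>bs x. set bs \<subseteq> Basis \<Longrightarrow> length bs \<le> m \<Longrightarrow> (1 + norm x) ^ m * norm (iterated_deriv bs f x) \<le> B bs"
  shows "schwartz_norm m f \<le> (\<Sum>bs | set bs \<subseteq> Basis \<and> length bs \<le> m. B bs)"
  unfolding schwartz_norm_def using assms by (intro sum_mono cSUP_least) auto

lemma weighted_integrable_of_decay:
  fixes f :: "'a::euclidean_space \<Rightarrow> complex"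
  assumes "f \<in> borel_measurable borel"
    and "\<And>x. (1 + norm x) ^ (k + 2 * DIM('a)) * norm (f x) \<le> C"
  shows "integrable lborel (\<lambda>x. (1 + norm x) ^ k * norm (f x))"
    and "(LINT x|lborel. (1 + norm x) ^ k * norm (f x)) \<le>
      C * (LINT x::'a|lborel. inverse ((1 + norm x) ^ (2 * DIM('a))))"
proof -
  note w = integrable_inverse_polynomial_weight[where 'a='a]
  have le: "(1 + norm x) ^ k * norm (f x) \<le> C * inverse ((1 + norm x) ^ (2 * DIM('a)))" for x
  proof -
    have "0 < (1 + norm x) ^ (2 * DIM('a))"
      by (intro zero_less_power) (simp add: add_pos_nonneg)
    with assms(2)[of x] show ?thesis
      by (simp add: power_add field_simps)
  qed
  show int: "integrable lborel (\<lambda>x. (1 + norm x) ^ k * norm (f x))"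
    by (rule Bochner_Integration.integrable_bound[OF integrable_mult_right[OF w, of C]])
      (use assms(1) le in \<open>auto intro!: AE_I2 order_trans[OF le abs_ge_self]\<close>)
  have "(LINT x|lborel. (1 + norm x) ^ k * norm (f x)) \<le> (LINT x::'a|lborel. C * inverse ((1 + norm x) ^ (2 * DIM('a))))"
    by (intro integral_mono int le integrable_mult_right w)
  then show "(LINT x|lborel. (1 + norm x) ^ k * norm (f x)) \<le>
      C * (LINT x::'a|lborel. inverse ((1 + norm x) ^ (2 * DIM('a))))"
    by simp
qed

lemma schwartz_weighted_integrable:
  fixes f :: "'a::euclidean_space \<Rightarrow> complex"
  assumes "f \<in> schwartz"
  shows "integrable lborel (\<lambda>x. (1 + norm x) ^ k * norm (f x))"
proof -
  obtain C where "\<And>x. (1 + norm x) ^ (k + 2 * DIM('a)) * norm (f x) \<le> C"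
    using schwartz_decay[OF assms, of "[]" "k + 2 * DIM('a)"] by auto
  with schwartz_measurable[OF assms] show ?thesis
    by (rule weighted_integrable_of_decay(1))
qed

lemma schwartz_integrable:
  fixes f :: "'a::euclidean_space \<Rightarrow> complex"
  assumes "f \<in> schwartz"
  shows "integrable lborel f"
  using schwartz_weighted_integrable[OF assms, of 0] schwartz_measurable[OF assms]
  by (simp add: integrable_norm_iff)

lemma schwartz_L1_le:
  fixes f :: "'a::euclidean_space \<Rightarrow> complex"
  assumes "f \<in> schwartz"
  shows "(LINT x|lborel. norm (f x)) \<le>
    (LINT x::'a|lborel. inverse ((1 + norm x) ^ (2 * DIM('a)))) * schwartz_norm (2 * DIM('a)) f"
  using weighted_integrable_of_decay(2)[OF schwartz_measurable[OF assms], of 0 "schwartz_norm (2 * DIM('a)) f"]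
    schwartz_norm_bound[OF assms, of "[]" "2 * DIM('a)"]
  by (simp add: mult.commute)

lemma tempered_of_bounded_function:
  fixes u :: "'a::euclidean_space \<Rightarrow> complex"
  assumes u: "u \<in> borel_measurable borel" and B: "\<And>x. norm (u x) \<le> B"
  shows "tempered (distr_of_fun u)"
proof -
  have int: "integrable lborel (\<lambda>x. u x * f x)" and
    le: "norm (distr_of_fun u f) \<le> B * (LINT x|lborel. norm (f x))" if "f \<in> schwartz" for f
  proof -
    note [measurable] = u schwartz_measurable[OF that]
    have le: "norm (u x * f x) \<le> B * norm (f x)" for x
      by (simp add: norm_mult mult_right_mono B)
    have i: "integrable lborel (\<lambda>x. B * norm (f x))"
      using schwartz_integrable[OF that] by simp
    show "integrable lborel (\<lambda>x. u x * f x)"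
      by (rule Bochner_Integration.integrable_bound[OF i])
        (auto intro!: AE_I2 order_trans[OF le[unfolded norm_mult] abs_ge_self] simp: norm_mult)
    have "norm (distr_of_fun u f) \<le> (LINT x|lborel. B * norm (f x))"
      unfolding distr_of_fun_def
      by (rule order_trans[OF integral_norm_bound])
        (intro integral_mono integrable_norm \<open>integrable lborel (\<lambda>x. u x * f x)\<close> i le)
    then show "norm (distr_of_fun u f) \<le> B * (LINT x|lborel. norm (f x))" by simp
  qed
  have "B \<ge> 0"
    using B norm_ge_zero order_trans by blast
  have "linear_on_schwartz (distr_of_fun u)"
    using int by (auto simp: linear_on_schwartz_def distr_of_fun_def distrib_left mult.left_commute)
  moreover have "norm (distr_of_fun u f) \<le>
      (B * (LINT x::'a|lborel. inverse ((1 + norm x) ^ (2 * DIM('a))))) * schwartz_norm (2 * DIM('a)) f"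
    if "f \<in> schwartz" for f
    using le[OF that] mult_left_mono[OF schwartz_L1_le[OF that] \<open>B \<ge> 0\<close>] by simp
  ultimately show ?thesis
    unfolding tempered_def by blast
qed

section \<open>Gaussian integrals\<close>

text \<open>
The power is at most \<open>k! exp (1 + s)\<close>, by one term of the exponential series, and the quadratic
exponent that results is maximal at \<open>s = (B + 1) / (2 A)\<close>.
\<close>

lemma polynomial_times_gaussian_bounded:
  fixes A B :: real
  assumes "A > 0"
  obtains C where "C \<ge> 0" "\<And>s. s \<ge> 0 \<Longrightarrow> (1 + s) ^ k * exp (- (A * s\<^sup>2) + B * s) \<le> C"
proof
  let ?C = "fact k * exp (1 + (B + 1)\<^sup>2 / (4 * A))"
  show "0 \<le> ?C" by simp
  fix s :: real assume s: "s \<ge> 0"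
  have "(1 + s) ^ k \<le> fact k * exp (1 + s)"
    using sum_le_suminf[OF summable_exp[of "1 + s"], of "{k}"] s
    by (simp add: exp_def field_simps)
  then have "(1 + s) ^ k * exp (- (A * s\<^sup>2) + B * s) \<le> fact k * exp (1 + s) * exp (- (A * s\<^sup>2) + B * s)"
    by (rule mult_right_mono) simp
  also have "\<dots> = fact k * exp (1 + (- (A * s\<^sup>2) + (B + 1) * s))"
    by (simp add: algebra_simps flip: exp_add)
  also have "\<dots> \<le> ?C"
  proof -
    have "(B + 1)\<^sup>2 / (4 * A) - (- (A * s\<^sup>2) + (B + 1) * s) = (2 * A * s - (B + 1))\<^sup>2 / (4 * A)"
      using assms by (simp add: field_simps power2_eq_square)
    also have "\<dots> \<ge> 0"
      using assms by simp
    finally show ?thesis by simp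
  qed
  finally show "(1 + s) ^ k * exp (- (A * s\<^sup>2) + B * s) \<le> ?C" .
qed

lemma integrable_polynomial_times_gaussian:
  fixes A B :: real
  assumes "A > 0"
  shows "integrable lborel (\<lambda>x::'a::euclidean_space. (1 + norm x) ^ k * exp (- (A * (norm x)\<^sup>2) + B * norm x))"
proof -
  obtain C where C: "\<And>s. s \<ge> 0 \<Longrightarrow> (1 + s) ^ (k + 2 * DIM('a)) * exp (- (A * s\<^sup>2) + B * s) \<le> C"
    using polynomial_times_gaussian_bounded[OF assms] by metis
  have "(1 + norm x) ^ (k + 2 * DIM('a)) * exp (- (A * (norm x)\<^sup>2) + B * norm x) \<le> C" for x :: 'a
    using C[of "norm x"] by simp
  then show ?thesis
    using weighted_integrable_of_decay(1)[of "\<lambda>x::'a. of_real (exp (- (A * (norm x)\<^sup>2) + B * norm x))" k C]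
    by simp
qed

lemma integrable_gaussian_norm:
  fixes \<epsilon> :: real
  assumes "\<epsilon> > 0"
  shows "integrable lborel (\<lambda>x::'a::euclidean_space. exp (- (\<epsilon> * (norm x)\<^sup>2)))"
  using integrable_polynomial_times_gaussian[OF assms, where k=0 and B=0] by simp

text \<open>
This number is the branch of \<open>1 / sqrt a\<close> that is positive for positive \<open>a\<close>. Only its values at
positive \<open>a\<close> and its modulus elsewhere enter the Wigner transform, in which the constant of the
propagator meets its own conjugate. Hence it stays an integral, and no branch has to be identified.
\<close>

definition gauss_const :: "complex \<Rightarrow> complex" where
  "gauss_const a = (LINT r|lborel. exp (- of_real pi * a * of_real (r\<^sup>2)))"

lemma norm_gaussian_le:
  fixes r :: real
  shows "norm (exp (- of_real pi * a * of_real (r\<^sup>2) + 2 * of_real pi * b * of_real r))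
    \<le> exp (- (pi * Re a * (norm r)\<^sup>2) + (2 * pi * norm b) * norm r)"
proof -
  have "Re b * r \<le> \<bar>Re b\<bar> * \<bar>r\<bar>"
    by (simp flip: abs_mult)
  also have "\<dots> \<le> norm b * \<bar>r\<bar>"
    by (intro mult_right_mono abs_Re_le_cmod) simp
  finally have "Re b * r \<le> norm b * \<bar>r\<bar>" .
  then show ?thesis
    by (simp add: mult.assoc)
qed

lemma integrable_complex_gaussian:
  assumes "Re a > 0"
  shows "integrable lborel (\<lambda>r::real. exp (- of_real pi * a * of_real (r\<^sup>2) + 2 * of_real pi * b * of_real r))"
  by (rule Bochner_Integration.integrable_bound
      [OF integrable_polynomial_times_gaussian[where k=0 and A="pi * Re a" and B="2 * pi * norm b"]])
    (use assms norm_gaussian_le[of a _ b] in \<open>auto intro!: AE_I2\<close>)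

lemma integral_derivative_vanishing_at_infinity:
  fixes F :: "real \<Rightarrow> complex"
  assumes F: "\<And>x. (F has_vector_derivative f x) (at x)" and cont: "continuous_on UNIV f"
    and int: "integrable lborel f" and top: "(F \<longlongrightarrow> 0) at_top" and bot: "(F \<longlongrightarrow> 0) at_bot"
  shows "(LINT x|lborel. f x) = 0"
proof -
  have "(LBINT x=-\<infinity>..\<infinity>. f x) = 0 - 0"
  proof (rule interval_integral_FTC_integrable)
    show "set_integrable lborel (einterval (-\<infinity>) \<infinity>) f"
      using int by (simp add: set_integrable_def)
    show "((F \<circ> real_of_ereal) \<longlongrightarrow> 0) (at_right (- \<infinity>))" "((F \<circ> real_of_ereal) \<longlongrightarrow> 0) (at_left \<infinity>)"
      using top bot by (simp_all add: ereal_tendsto_simps)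
  qed (use F cont in \<open>auto simp: continuous_on_eq_continuous_at\<close>)
  then show ?thesis
    by (simp add: interval_lebesgue_integral_def set_lebesgue_integral_def)
qed

lemma tendsto_0_of_inverse_bound:
  fixes F :: "real \<Rightarrow> complex"
  assumes "\<And>r. (1 + norm r) * norm (F r) \<le> C"
  shows "(F \<longlongrightarrow> 0) at_top" "(F \<longlongrightarrow> 0) at_bot"
proof -
  have le: "norm (F r) \<le> C * inverse (1 + norm r)" for r
    using assms[of r] by (simp add: field_simps add_pos_nonneg)
  have "filterlim (\<lambda>r::real. 1 + norm r) at_top at_top"
    by (rule filterlim_at_top_mono[OF filterlim_ident]) (auto intro!: always_eventually)
  from tendsto_mult_right_zero[OF filterlim_compose[OF tendsto_inverse_0_at_top[OF filterlim_ident] this]]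
  have top: "((\<lambda>r::real. C * inverse (1 + norm r)) \<longlongrightarrow> 0) at_top" .
  have "filterlim (\<lambda>r::real. 1 + norm r) at_top at_bot"
    by (rule filterlim_at_top_mono[OF filterlim_uminus_at_top_at_bot]) (auto intro!: always_eventually)
  from tendsto_mult_right_zero[OF filterlim_compose[OF tendsto_inverse_0_at_top[OF filterlim_ident] this]]
  have bot: "((\<lambda>r::real. C * inverse (1 + norm r)) \<longlongrightarrow> 0) at_bot" .
  show "(F \<longlongrightarrow> 0) at_top" "(F \<longlongrightarrow> 0) at_bot"
    by (rule Lim_null_comparison[OF _ top] Lim_null_comparison[OF _ bot], use le in simp)+
qed

lemma has_vector_derivative_exp_quadratic:
  fixes c\<^sub>0 c\<^sub>1 c\<^sub>2 :: complex
  shows "((\<lambda>s. exp (c\<^sub>0 + c\<^sub>1 * of_real s + c\<^sub>2 * (of_real s)\<^sup>2)) has_vector_derivative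
    (c\<^sub>1 + 2 * c\<^sub>2 * of_real s) * exp (c\<^sub>0 + c\<^sub>1 * of_real s + c\<^sub>2 * (of_real s)\<^sup>2)) (at s)"
proof (rule has_vector_derivative_real_field)
  show "((\<lambda>z. exp (c\<^sub>0 + c\<^sub>1 * z + c\<^sub>2 * z\<^sup>2)) has_field_derivative
    (c\<^sub>1 + 2 * c\<^sub>2 * of_real s) * exp (c\<^sub>0 + c\<^sub>1 * of_real s + c\<^sub>2 * (of_real s)\<^sup>2)) (at (of_real s))"
    by (auto intro!: derivative_eq_intros)
qed

text \<open>
Completing the square amounts to a translation by the complex number \<open>b / a\<close>. It is performed along
the path \<open>s b\<close>, \<open>0 \<le> s \<le> 1\<close>: after multiplication by \<open>exp (-\<pi> (s b)\<^sup>2 / a)\<close>, the derivative of the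
integrand in \<open>s\<close> is also a derivative in \<open>r\<close> of a function that vanishes at infinity, so that the
integral does not depend on \<open>s\<close>.
\<close>

lemma complex_gaussian_integral:
  assumes a: "Re a > 0"
  shows "(LINT r|lborel. exp (- of_real pi * a * of_real (r\<^sup>2) + 2 * of_real pi * b * of_real r)) =
    gauss_const a * exp (of_real pi * b\<^sup>2 / a)"
proof -
  have a0: "a \<noteq> 0" using a by auto
  \<comment> \<open>The factor \<open>exp (-\<pi> (s b)\<^sup>2 / a)\<close> cancels the expected dependence of the integral on \<open>s\<close>.\<close>
  define e where "e s r = exp (- of_real pi * a * of_real (r\<^sup>2) + 2 * of_real pi * (of_real s * b) * of_real r
      - of_real pi * (of_real s * b)\<^sup>2 / a)" for s r :: real
  have split: "e s r = exp (- of_real pi * a * of_real (r\<^sup>2) + 2 * of_real pi * (of_real s * b) * of_real r)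
      * exp (- of_real pi * (of_real s * b)\<^sup>2 / a)" for s r
    by (simp add: e_def flip: exp_add)
  define q where "q s r = 2 * of_real pi * b * (of_real r - of_real s * b / a)" for s r :: real
  have es: "((\<lambda>s. e s r) has_vector_derivative q s r * e s r) (at s)" for s r
  proof -
    have "e s r = exp (- of_real pi * a * of_real (r\<^sup>2) + 2 * of_real pi * b * of_real r * of_real s
        + (- of_real pi * b\<^sup>2 / a) * (of_real s)\<^sup>2)" for s
      unfolding e_def by (simp add: power_mult_distrib mult_ac)
    moreover have "2 * of_real pi * b * of_real r + 2 * (- of_real pi * b\<^sup>2 / a) * of_real s = q s r"
      using a0 by (simp add: q_def field_simps power2_eq_square)
    ultimately show ?thesis
      using has_vector_derivative_exp_quadratic[of "- of_real pi * a * of_real (r\<^sup>2)"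
          "2 * of_real pi * b * of_real r" "- of_real pi * b\<^sup>2 / a" s] by (simp only:)
  qed
  have er: "((\<lambda>r. - (b / a) * e s r) has_vector_derivative q s r * e s r) (at r)" for s r
  proof -
    have "e s r = exp (- of_real pi * (of_real s * b)\<^sup>2 / a + 2 * of_real pi * (of_real s * b) * of_real r
        + (- of_real pi * a) * (of_real r)\<^sup>2)" for r
      unfolding e_def by (simp add: algebra_simps)
    moreover have "- (b / a) * ((2 * of_real pi * (of_real s * b) + 2 * (- of_real pi * a) * of_real r) * w) = q s r * w" for w
      using a0 by (simp add: q_def field_simps power2_eq_square)
    ultimately show ?thesis
      using has_vector_derivative_mult_right[OF has_vector_derivative_exp_quadratic[of
          "- of_real pi * (of_real s * b)\<^sup>2 / a" "2 * of_real pi * (of_real s * b)" "- of_real pi * a" r], of "- (b / a)"]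
      by (simp only:)
  qed
  have ce: "continuous_on UNIV (\<lambda>r. e s r)" "continuous_on UNIV (\<lambda>r. q s r * e s r)" for s
    unfolding e_def q_def by (auto intro!: continuous_intros)
  have inte: "integrable lborel (e s)" for s
    unfolding split by (intro integrable_mult_left integrable_complex_gaussian a)
  define A where "A = pi * Re a"
  have A: "A > 0" using a by (simp add: A_def)
  define K where "K = exp (pi * (2\<^sup>2 * (norm b)\<^sup>2) / norm a)"
  define L where "L = 2 * pi * norm b * (1 + 2 * norm b / norm a)"
  \<comment> \<open>The bound 2 leaves an open neighbourhood of \<open>[0, 1]\<close> on which the estimates are uniform in \<open>s\<close>.\<close>
  have nb: "norm (e s r) \<le> K * exp (- (A * (norm r)\<^sup>2) + (4 * pi * norm b) * norm r)"
    and nq: "norm (q s r) \<le> L * (1 + norm r)" if s: "\<bar>s\<bar> \<le> 2" for s r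
  proof -
    have "norm (exp (- of_real pi * (of_real s * b)\<^sup>2 / a)) \<le> exp (norm (- of_real pi * (of_real s * b)\<^sup>2 / a))"
      by (rule norm_exp)
    also have "\<dots> = exp (pi * (\<bar>s\<bar>\<^sup>2 * (norm b)\<^sup>2) / norm a)"
      by (simp add: norm_mult norm_divide norm_power power_mult_distrib)
    also have "\<dots> \<le> exp (pi * (2\<^sup>2 * (norm b)\<^sup>2) / norm a)"
      using s by (intro exp_mono divide_right_mono mult_left_mono mult_right_mono power_mono) auto
    finally have 1: "norm (exp (- of_real pi * (of_real s * b)\<^sup>2 / a)) \<le> K"
      by (simp only: K_def)
    have "norm (exp (- of_real pi * a * of_real (r\<^sup>2) + 2 * of_real pi * (of_real s * b) * of_real r))
      \<le> exp (- (A * (norm r)\<^sup>2) + (2 * pi * norm (of_real s * b)) * norm r)"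
      using norm_gaussian_le[of a r "of_real s * b"] by (simp only: A_def)
    also have "\<dots> \<le> exp (- (A * (norm r)\<^sup>2) + (2 * pi * (2 * norm b)) * norm r)"
      using s by (intro exp_mono add_left_mono mult_right_mono mult_left_mono) (auto simp: norm_mult mult_right_mono)
    finally show "norm (e s r) \<le> K * exp (- (A * (norm r)\<^sup>2) + (4 * pi * norm b) * norm r)"
      unfolding split norm_mult using 1
      by (subst mult.commute) (intro mult_mono, auto simp: K_def mult.assoc)
    have "norm (of_real r - of_real s * b / a) \<le> norm r + \<bar>s\<bar> * norm b / norm a"
      by (rule order_trans[OF norm_triangle_ineq4]) (simp add: norm_mult norm_divide)
    also have "\<dots> \<le> norm r + 2 * norm b / norm a"
      using s by (intro add_left_mono divide_right_mono mult_right_mono) auto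
    also have "\<dots> \<le> (1 + 2 * norm b / norm a) * (1 + norm r)"
    proof -
      have "x + c \<le> (1 + c) * (1 + x)" if "0 \<le> c" "0 \<le> x" for c x :: real
        using mult_nonneg_nonneg[OF that] by (simp add: algebra_simps)
      then show ?thesis by simp
    qed
    finally show "norm (q s r) \<le> L * (1 + norm r)"
      using mult_left_mono[of _ _ "2 * pi * norm b"] by (simp add: q_def L_def norm_mult mult.assoc)
  qed
  define B where "B r = L * K * ((1 + norm r) ^ 1 * exp (- (A * (norm r)\<^sup>2) + (4 * pi * norm b) * norm r))" for r :: real
  have LK: "0 \<le> L" "0 \<le> K"
    by (auto simp: L_def K_def)
  have Bb: "norm (q s r * e s r) \<le> B r" if "\<bar>s\<bar> \<le> 2" for s r
  proof -
    have "norm (q s r * e s r) \<le> (L * (1 + norm r)) * (K * exp (- (A * (norm r)\<^sup>2) + (4 * pi * norm b) * norm r))"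
      unfolding norm_mult using LK by (intro mult_mono nb nq that) auto
    then show ?thesis by (simp add: B_def mult_ac)
  qed
  have intB: "integrable lborel B"
    unfolding B_def by (intro integrable_mult_right integrable_polynomial_times_gaussian A)
  have zero: "(LINT r|lborel. q s r * e s r) = 0" if s: "\<bar>s\<bar> \<le> 2" for s
  proof (rule integral_derivative_vanishing_at_infinity[OF er ce(2)])
    show "integrable lborel (\<lambda>r. q s r * e s r)"
      by (rule Bochner_Integration.integrable_bound[OF intB])
        (use ce(2) Bb[OF s] in \<open>auto intro!: borel_measurable_continuous_onI AE_I2 order_trans[OF _ abs_ge_self]\<close>)
    obtain C where C: "\<And>s. s \<ge> 0 \<Longrightarrow> (1 + s) ^ 1 * exp (- (A * s\<^sup>2) + (4 * pi * norm b) * s) \<le> C"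
      using polynomial_times_gaussian_bounded[OF A] by metis
    have "(1 + norm r) * norm (- (b / a) * e s r) \<le> norm (b / a) * K * C" for r
    proof -
      have "(1 + norm r) * norm (e s r) \<le> (1 + norm r) * (K * exp (- (A * (norm r)\<^sup>2) + (4 * pi * norm b) * norm r))"
        by (intro mult_left_mono nb s) auto
      also have "\<dots> \<le> K * C"
        using mult_left_mono[OF C[of "norm r"] LK(2)] by (simp add: mult_ac)
      finally show ?thesis
        using mult_left_mono[of "(1 + norm r) * norm (e s r)" "K * C" "norm (b / a)"]
        by (simp add: norm_mult norm_divide mult_ac)
    qed
    note t = tendsto_0_of_inverse_bound[OF this]
    show "((\<lambda>r. - (b / a) * e s r) \<longlongrightarrow> 0) at_top" "((\<lambda>r. - (b / a) * e s r) \<longlongrightarrow> 0) at_bot"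
      by (fact t)+
  qed
  have "((\<lambda>s. LINT r|lborel. e s r) has_derivative (\<lambda>h. 0)) (at s)" if s: "s \<in> {-2<..<2}" for s
  proof -
    have "((\<lambda>s. LINT r|lborel. e s r) has_derivative (\<lambda>h. LINT r|lborel. h *\<^sub>R (q s r * e s r))) (at s)"
    proof (rule has_derivative_integral_dominated[where S="{-2<..<2}" and B=B and f'="\<lambda>s r h. h *\<^sub>R (q s r * e s r)"])
      show "(\<lambda>r. h *\<^sub>R (q s r * e s r)) \<in> borel_measurable lborel" for h
        using borel_measurable_continuous_onI[OF ce(2)[of s]] by simp
      show "((\<lambda>v. e v r) has_derivative (\<lambda>h. h *\<^sub>R (q v r * e v r))) (at v)" for v r
        using es[of r v] by (simp add: has_vector_derivative_def)
      show "norm (h *\<^sub>R (q v r * e v r)) \<le> B r * norm h" if "v \<in> {-2<..<2}" for v r h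
        using mult_left_mono[OF Bb[of v r], of "\<bar>h\<bar>"] that by (simp add: mult.commute abs_le_iff)
      show "0 \<le> B r" for r
        using LK by (simp add: B_def)
    qed (use s inte intB in auto)
    with zero[of s] s show ?thesis by (simp add: abs_le_iff)
  qed
  then have "(LINT r|lborel. e 1 r) = (LINT r|lborel. e 0 r)"
    by (intro has_derivative_zero_unique[where s="{-2<..<2}"]) (auto intro: has_derivative_at_withinI)
  moreover have "(LINT r|lborel. e 1 r) = (LINT r|lborel. exp (- of_real pi * a * of_real (r\<^sup>2)
      + 2 * of_real pi * b * of_real r)) * exp (- (of_real pi * b\<^sup>2 / a))"
    unfolding split by simp
  moreover have "(LINT r|lborel. e 0 r) = gauss_const a"
    unfolding split gauss_const_def by simp
  ultimately have "(LINT r|lborel. exp (- of_real pi * a * of_real (r\<^sup>2) + 2 * of_real pi * b * of_real r)) *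
      exp (- (of_real pi * b\<^sup>2 / a)) = gauss_const a"
    by simp
  from arg_cong[OF this, of "\<lambda>w. w * exp (of_real pi * b\<^sup>2 / a)"] show ?thesis
    unfolding mult.assoc exp_add[symmetric] by simp
qed

lemma gauss_const_of_real:
  assumes "a > 0"
  shows "gauss_const (of_real a) = of_real (1 / sqrt a)"
proof -
  define \<sigma> where "\<sigma> = sqrt (1 / (2 * pi * a))"
  have \<sigma>: "\<sigma> > 0" "\<sigma>\<^sup>2 = 1 / (2 * pi * a)"
    using assms by (auto simp: \<sigma>_def)
  have "normal_density 0 \<sigma> x = sqrt a * exp (- pi * a * x\<^sup>2)" for x
    unfolding normal_density_def \<sigma>(2) using assms by (simp add: field_simps real_sqrt_divide)
  then have "(LINT x|lborel. sqrt a * exp (- pi * a * x\<^sup>2)) = 1"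
    using integral_normal_density[OF \<sigma>(1), of 0] by simp
  then have "(LINT x|lborel. exp (- pi * a * x\<^sup>2)) = 1 / sqrt a"
    using assms by (simp add: field_simps)
  moreover have "gauss_const (of_real a) = (LINT x|lborel. of_real (exp (- pi * a * x\<^sup>2)))"
    unfolding gauss_const_def by (simp flip: exp_of_real)
  ultimately show ?thesis
    by (simp only: integral_complex_of_real)
qed

text \<open>
Polar coordinates, the usual way to square a Gaussian integral, do not suit the product with the
conjugate. Instead, the substitution \<open>(r, s) \<mapsto> (r + s, s)\<close> turns the double integral into one in
which the inner integration over \<open>s\<close> involves \<open>a + cnj a = 2 Re a\<close> only.
\<close>

lemma norm_gauss_const:
  assumes a: "Re a > 0"
  shows "(norm (gauss_const a))\<^sup>2 = 1 / norm a"
proof -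
  have a0: "a \<noteq> 0" using a by auto
  let ?g = "\<lambda>a r. exp (- of_real pi * a * of_real (r\<^sup>2)) :: complex"
  let ?h = "\<lambda>r s. exp (- of_real pi * of_real (2 * Re a) * of_real (s\<^sup>2) + 2 * of_real pi * (- a * of_real r) * of_real s)"
  have ig: "integrable lborel (?g a)" if "Re a > 0" for a
    using integrable_complex_gaussian[OF that, of 0] by simp
  have "of_real ((norm (gauss_const a))\<^sup>2) = gauss_const a * cnj (gauss_const a)"
    by (rule complex_norm_square)
  also have "cnj (gauss_const a) = gauss_const (cnj a)"
    unfolding gauss_const_def by (simp flip: Bochner_Integration.integral_cnj add: exp_cnj)
  also have "gauss_const a * gauss_const (cnj a) = (LINT s|lborel. LINT r|lborel. ?g a r * ?g (cnj a) s)"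
    by (simp add: gauss_const_def)
  also have "\<dots> = (LINT s|lborel. LINT r|lborel. ?g a (r + s) * ?g (cnj a) s)"
    using lborel_integral_real_affine[of 1 "\<lambda>r. ?g a r * ?g (cnj a) s" s for s]
    by (simp add: add.commute)
  \<comment> \<open>The fibrewise translation preserves the measure, so the translated integrand is still integrable.\<close>
  also have "\<dots> = (LINT r|lborel. LINT s|lborel. ?g a (r + s) * ?g (cnj a) s)"
  proof -
    have "integrable lborel (\<lambda>(s, r). ?g (cnj a) s * ?g a r)"
      using a by (intro integrable_tensor ig) simp_all
    then have "integrable (distr lborel borel (\<lambda>(s, r). (s, s + 1 *\<^sub>R r))) (\<lambda>(s, r). ?g (cnj a) s * ?g a r)"
      by (subst distr_lborel_fibre) auto
    then have "integrable lborel ((\<lambda>(s, r). ?g (cnj a) s * ?g a r) \<circ> (\<lambda>(s, r). (s, s + 1 *\<^sub>R r)))"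
      by (subst (asm) integrable_distr_eq) (auto simp: comp_def borel_prod[symmetric])
    then have "integrable lborel (\<lambda>(s, r). ?g a (r + s) * ?g (cnj a) s)"
      by (simp add: comp_def case_prod_unfold add.commute mult.commute)
    from integral_lborel_swap[OF this] show ?thesis
      by (simp only: prod.case)
  qed
  also have "\<dots> = (LINT r|lborel. (LINT s|lborel. ?h r s) * ?g a r)"
  proof (intro Bochner_Integration.integral_cong refl)
    fix r
    have "?g a (r + s) * ?g (cnj a) s = ?h r s * ?g a r" for s
      unfolding complex_add_cnj[symmetric] exp_add[symmetric]
      by (intro arg_cong[where f=exp]) (simp add: algebra_simps power2_eq_square)
    then show "(LINT s|lborel. ?g a (r + s) * ?g (cnj a) s) = (LINT s|lborel. ?h r s) * ?g a r"
      by simp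
  qed
  \<comment> \<open>Since \<open>a - a\<^sup>2 / (2 Re a) = |a|\<^sup>2 / (2 Re a)\<close>, the remaining Gaussian has a real exponent.\<close>
  also have "\<dots> = (LINT r|lborel. of_real (1 / sqrt (2 * Re a)) * ?g (of_real ((norm a)\<^sup>2 / (2 * Re a))) r)"
  proof (intro Bochner_Integration.integral_cong refl)
    fix r
    have "(LINT s|lborel. ?h r s) = gauss_const (of_real (2 * Re a)) * exp (of_real pi * (- a * of_real r)\<^sup>2 / of_real (2 * Re a))"
      using a by (intro complex_gaussian_integral) simp
    moreover have "exp (of_real pi * (- a * of_real r)\<^sup>2 / of_real (2 * Re a)) * ?g a r = ?g (of_real ((norm a)\<^sup>2 / (2 * Re a))) r"
    proof -
      have "2 * Re a \<noteq> 0" using a by simp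
      then have "of_real (2 * Re a) \<noteq> (0::complex)" unfolding of_real_eq_0_iff .
      then have "of_real pi * (- a * of_real r)\<^sup>2 / of_real (2 * Re a) - of_real pi * a * of_real (r\<^sup>2)
        = - of_real pi * (a * (of_real (2 * Re a) - a)) / of_real (2 * Re a) * of_real (r\<^sup>2)"
        by (simp add: field_simps power2_eq_square)
      also have "a * (of_real (2 * Re a) - a) = of_real ((norm a)\<^sup>2)"
        by (simp only: complex_norm_square complex_add_cnj[symmetric]) simp
      finally show ?thesis
        by (simp flip: exp_add)
    qed
    ultimately show "(LINT s|lborel. ?h r s) * ?g a r = of_real (1 / sqrt (2 * Re a)) * ?g (of_real ((norm a)\<^sup>2 / (2 * Re a))) r"
      using a gauss_const_of_real[of "2 * Re a"] by (simp add: mult.assoc)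
  qed
  also have "\<dots> = of_real (1 / sqrt (2 * Re a) * (1 / sqrt ((norm a)\<^sup>2 / (2 * Re a))))"
    using a a0 gauss_const_of_real[of "(norm a)\<^sup>2 / (2 * Re a)"] by (simp add: gauss_const_def)
  also have "1 / sqrt (2 * Re a) * (1 / sqrt ((norm a)\<^sup>2 / (2 * Re a))) = 1 / norm a"
    using a by (simp add: real_sqrt_divide)
  finally show ?thesis
    by (simp only: of_real_eq_iff)
qed

text \<open>
The linear part of the exponent is given by two real vectors with complex coefficients. All the
exponents that occur below have this form, and the inner products of the two vectors then appear
explicitly in the integral, where a complex vector would need a bilinear extension of the inner
product.
\<close>

lemma
  fixes x y :: "'a::euclidean_space" and a \<beta> \<gamma> :: complex
  assumes a: "Re a > 0"
  defines "G \<equiv> \<lambda>v. exp (- of_real pi * a * of_real ((norm v)\<^sup>2)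
      + 2 * of_real pi * (\<beta> * of_real (x \<bullet> v) + \<gamma> * of_real (y \<bullet> v)))"
  shows integrable_gaussian: "integrable lborel G"
    and gaussian_integral: "(LINT v|lborel. G v) = gauss_const a ^ DIM('a) *
      exp (of_real pi * (\<beta>\<^sup>2 * of_real ((norm x)\<^sup>2) + 2 * \<beta> * \<gamma> * of_real (x \<bullet> y) + \<gamma>\<^sup>2 * of_real ((norm y)\<^sup>2)) / a)"
proof -
  define z where "z b = \<beta> * of_real (x \<bullet> b) + \<gamma> * of_real (y \<bullet> b)" for b
  let ?h = "\<lambda>b r. exp (- of_real pi * a * of_real (r\<^sup>2) + 2 * of_real pi * z b * of_real r)"
  have nsq: "(norm v)\<^sup>2 = (\<Sum>b\<in>Basis. (v \<bullet> b)\<^sup>2)" for v :: 'a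
    by (subst power2_norm_eq_inner, subst euclidean_inner) (simp add: power2_eq_square)
  have G: "G = (\<lambda>v. \<Prod>b\<in>Basis. ?h b (v \<bullet> b))"
  proof
    fix v :: 'a
    have "- of_real pi * a * of_real ((norm v)\<^sup>2) + 2 * of_real pi * (\<beta> * of_real (x \<bullet> v) + \<gamma> * of_real (y \<bullet> v)) =
        (\<Sum>b\<in>Basis. - of_real pi * a * of_real ((v \<bullet> b)\<^sup>2) + 2 * of_real pi * z b * of_real (v \<bullet> b))"
      by (simp add: nsq euclidean_inner[of x v] euclidean_inner[of y v] z_def sum.distrib sum_distrib_left
          sum_negf sum_subtractf algebra_simps)
    then show "G v = (\<Prod>b\<in>Basis. ?h b (v \<bullet> b))"
      by (simp only: G_def exp_sum[OF finite_Basis])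
  qed
  show "integrable lborel G"
    unfolding G by (intro integrable_coordinate_product integrable_complex_gaussian a)
  have "(LINT v|lborel. G v) = (\<Prod>b\<in>Basis. gauss_const a * exp (of_real pi * (z b)\<^sup>2 / a))"
    unfolding G by (subst integral_coordinate_product)
      (simp_all only: integrable_complex_gaussian a complex_gaussian_integral)
  also have "\<dots> = gauss_const a ^ DIM('a) * exp (\<Sum>b\<in>Basis. of_real pi * (z b)\<^sup>2 / a)"
    by (simp add: prod.distrib exp_sum)
  also have "(\<Sum>b\<in>Basis. of_real pi * (z b)\<^sup>2 / a) = of_real pi * (\<beta>\<^sup>2 * of_real ((norm x)\<^sup>2) + 2 * \<beta> * \<gamma> * of_real (x \<bullet> y) + \<gamma>\<^sup>2 * of_real ((norm y)\<^sup>2)) / a"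
  proof -
    have "of_real pi * (z b)\<^sup>2 / a = of_real pi / a * (\<beta>\<^sup>2 * of_real ((x \<bullet> b)\<^sup>2)
        + 2 * \<beta> * \<gamma> * of_real ((x \<bullet> b) * (y \<bullet> b)) + \<gamma>\<^sup>2 * of_real ((y \<bullet> b)\<^sup>2))" for b
      by (simp add: z_def power2_eq_square algebra_simps add_divide_distrib)
    then have "(\<Sum>b\<in>Basis. of_real pi * (z b)\<^sup>2 / a) = of_real pi / a * (\<beta>\<^sup>2 * of_real (\<Sum>b\<in>Basis. (x \<bullet> b)\<^sup>2)
        + 2 * \<beta> * \<gamma> * of_real (\<Sum>b\<in>Basis. (x \<bullet> b) * (y \<bullet> b)) + \<gamma>\<^sup>2 * of_real (\<Sum>b\<in>Basis. (y \<bullet> b)\<^sup>2))"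
      by (simp only: of_real_sum sum_distrib_left distrib_left sum.distrib)
    then show ?thesis
      by (simp only: nsq euclidean_inner[of x y] times_divide_eq_left)
  qed
  finally show "(LINT v|lborel. G v) = gauss_const a ^ DIM('a) *
      exp (of_real pi * (\<beta>\<^sup>2 * of_real ((norm x)\<^sup>2) + 2 * \<beta> * \<gamma> * of_real (x \<bullet> y) + \<gamma>\<^sup>2 * of_real ((norm y)\<^sup>2)) / a)" .
qed

section \<open>Wigner transforms and their duals\<close>

lemma measurable_cross_wigner [measurable]:
  fixes F G :: "real^'n \<Rightarrow> complex"
  assumes [measurable]: "F \<in> borel_measurable borel" "G \<in> borel_measurable borel"
  shows "cross_wigner F G \<in> borel_measurable borel"
proof -
  have "(\<lambda>z. LINT y|lborel. F (fst z + y /\<^sub>R 2) * cnj (G (fst z - y /\<^sub>R 2)) * cis (- 2 * pi * (y \<bullet> snd z)))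
      \<in> borel_measurable (borel \<Otimes>\<^sub>M borel)"
    by (rule lborel.borel_measurable_lebesgue_integral) measurable
  then show ?thesis
    by (simp add: cross_wigner_def case_prod_unfold borel_prod)
qed

lemma measurable_cross_wigner_dual:
  fixes \<Phi> :: "(real^'n) \<times> (real^'n) \<Rightarrow> complex"
  assumes [measurable]: "\<Phi> \<in> borel_measurable borel"
  shows "(\<lambda>(a, b). cross_wigner_dual \<Phi> a b) \<in> borel_measurable borel"
proof -
  have "(\<lambda>z. LINT \<xi>|lborel. \<Phi> ((fst z + snd z) /\<^sub>R 2, \<xi>) * cis (- 2 * pi * ((fst z - snd z) \<bullet> \<xi>)))
      \<in> borel_measurable (borel \<Otimes>\<^sub>M borel)"
  proof (rule lborel.borel_measurable_lebesgue_integral)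
    have [measurable]: "\<Phi> \<in> borel_measurable (borel \<Otimes>\<^sub>M borel)"
      by (simp add: borel_prod)
    show "(\<lambda>(z, \<xi>). \<Phi> ((fst z + snd z) /\<^sub>R 2, \<xi>) * cis (- 2 * pi * ((fst z - snd z) \<bullet> \<xi>)))
        \<in> borel_measurable ((borel \<Otimes>\<^sub>M borel) \<Otimes>\<^sub>M lborel)"
      by measurable
  qed
  then show ?thesis
    by (simp add: cross_wigner_dual_def case_prod_unfold borel_prod)
qed

text \<open>
Boundedness of one factor makes the integrand integrable for every \<open>x\<close>, where Fubini's theorem
alone would give it for almost every \<open>x\<close>.
\<close>

lemma integrable_wigner_integrand:
  fixes F G :: "real^'n \<Rightarrow> complex"
  assumes F: "F \<in> borel_measurable borel" "\<And>x. norm (F x) \<le> B" and G: "integrable lborel G"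
  shows "integrable lborel (\<lambda>p. F (x + p /\<^sub>R 2) * cnj (G (x - p /\<^sub>R 2)))"
proof -
  have [measurable]: "F \<in> borel_measurable borel" by (fact F(1))
  have "integrable lborel (\<lambda>p. G (x + (-1/2) *\<^sub>R p))"
    using G by (subst lborel_integrable_affine) auto
  then have "integrable lborel (\<lambda>p. cnj (G (x - p /\<^sub>R 2)))"
    by simp
  then show ?thesis
    by (rule integrable_mult_bounded(2)[where B=B]) (use F(2) in auto)
qed

lemma cross_wigner_bounded:
  fixes F G :: "real^'n \<Rightarrow> complex"
  assumes F: "F \<in> borel_measurable borel" "\<And>x. norm (F x) \<le> B" and G: "integrable lborel G"
  shows "norm (cross_wigner F G z) \<le> B * (2 ^ CARD('n) * (LINT y|lborel. norm (G y)))"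
proof -
  obtain x \<xi> where z: "z = (x, \<xi>)" by (cases z)
  have B: "0 \<le> B" using F(2) norm_ge_zero order_trans by blast
  have iG: "integrable lborel (\<lambda>p. norm (G (x + (-1/2) *\<^sub>R p)))"
    using G by (intro integrable_norm, subst lborel_integrable_affine) auto
  have "norm (cross_wigner F G z) \<le> (LINT p|lborel. norm (F (x + p /\<^sub>R 2) * cnj (G (x - p /\<^sub>R 2)) * cis (- 2 * pi * (p \<bullet> \<xi>))))"
    unfolding z cross_wigner_def prod.case by (rule integral_norm_bound)
  also have "\<dots> = (LINT p|lborel. norm (F (x + p /\<^sub>R 2) * cnj (G (x - p /\<^sub>R 2))))"
    by (simp add: norm_mult)
  also have "\<dots> \<le> (LINT p|lborel. B * norm (G (x + (-1/2) *\<^sub>R p)))"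
    by (intro integral_mono integrable_norm integrable_wigner_integrand[OF F G] integrable_mult_right iG)
      (auto simp: norm_mult intro!: mult_right_mono F(2))
  also have "\<dots> = B * (2 ^ CARD('n) * (LINT y|lborel. norm (G y)))"
    using lborel_integral_affine[of "-1/2" "\<lambda>y. norm (G y)" x] by (simp add: power_divide)
  finally show ?thesis .
qed

text \<open>
The passage to midpoint and difference turns the right-hand side into an integral over \<open>(x, p)\<close>;
for each fixed \<open>x\<close>, Fubini's theorem then exchanges the integrations over \<open>p\<close> and \<open>\<xi>\<close>. The majorant
\<open>\<theta>\<close> makes the dual transform bounded. The identity serves twice: for test functions \<open>\<Phi>\<close>, and for the
Wigner kernel \<open>k(z, \<cdot>)\<close> in the role of \<open>\<Phi>\<close>.
\<close>

lemma wigner_pairing: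
  fixes F G :: "real^'n \<Rightarrow> complex" and \<Phi> :: "(real^'n) \<times> (real^'n) \<Rightarrow> complex"
  assumes F: "integrable lborel F" "\<And>x. norm (F x) \<le> B" and G: "integrable lborel G"
    and \<Phi>: "integrable lborel \<Phi>" and \<theta>: "integrable lborel \<theta>" "\<And>x \<xi>. norm (\<Phi> (x, \<xi>)) \<le> \<theta> \<xi>"
  shows "integrable lborel (\<lambda>(a, b). F a * cnj (G b) * cross_wigner_dual \<Phi> a b)"
    and "(LINT z|lborel. \<Phi> z * cross_wigner F G z) =
      (LINT v|lborel. (case v of (a, b) \<Rightarrow> F a * cnj (G b) * cross_wigner_dual \<Phi> a b))"
proof -
  have [measurable]: "F \<in> borel_measurable borel" "G \<in> borel_measurable borel" "\<Phi> \<in> borel_measurable borel"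
    using F(1) G \<Phi> by (auto dest: borel_measurable_integrable)
  have \<Phi>_int: "integrable lborel (\<lambda>\<xi>. \<Phi> (x, \<xi>))" for x
    by (rule integrable_of_norm_le[OF \<theta>(1)]) (auto simp: \<theta>(2))
  have dual_le: "norm (cross_wigner_dual \<Phi> a b) \<le> (LINT \<xi>|lborel. \<theta> \<xi>)" for a b
  proof -
    have "norm (cross_wigner_dual \<Phi> a b) \<le>
        (LINT \<xi>|lborel. norm (\<Phi> ((a + b) /\<^sub>R 2, \<xi>) * cis (- 2 * pi * ((a - b) \<bullet> \<xi>))))"
      unfolding cross_wigner_dual_def by (rule integral_norm_bound)
    also have "\<dots> = (LINT \<xi>|lborel. norm (\<Phi> ((a + b) /\<^sub>R 2, \<xi>)))"
      by (simp add: norm_mult)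
    also have "\<dots> \<le> (LINT \<xi>|lborel. \<theta> \<xi>)"
      by (intro integral_mono integrable_norm \<Phi>_int \<theta>)
    finally show ?thesis .
  qed
  let ?H = "\<lambda>(a, b). F a * cnj (G b) * cross_wigner_dual \<Phi> a b"
  have "integrable lborel (\<lambda>z. (case z of (a, b) \<Rightarrow> F a * cnj (G b)) * (case z of (a, b) \<Rightarrow> cross_wigner_dual \<Phi> a b))"
    by (rule integrable_mult_bounded(1)[where B="LINT \<xi>|lborel. \<theta> \<xi>"])
      (use F(1) G dual_le in \<open>auto intro!: integrable_tensor measurable_cross_wigner_dual\<close>)
  then show int: "integrable lborel ?H"
    by (simp add: case_prod_unfold)
  have "(LINT v|lborel. ?H v) = (LINT x|lborel. LINT p|lborel. ?H (x + p /\<^sub>R 2, x - p /\<^sub>R 2))"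
    by (rule integral_midpoint[OF int])
  also have "\<dots> = (LINT x|lborel. LINT \<xi>|lborel. \<Phi> (x, \<xi>) * cross_wigner F G (x, \<xi>))"
  proof (rule Bochner_Integration.integral_cong[OF refl])
    fix x :: "real^'n"
    let ?A = "\<lambda>p. F (x + p /\<^sub>R 2) * cnj (G (x - p /\<^sub>R 2))"
    let ?L = "\<lambda>(p, \<xi>). ?A p * \<Phi> (x, \<xi>) * cis (- 2 * pi * (p \<bullet> \<xi>))"
    have mid: "(x + p /\<^sub>R 2 + (x - p /\<^sub>R 2)) /\<^sub>R 2 = x" "x + p /\<^sub>R 2 - (x - p /\<^sub>R 2) = p" for p
      by (simp_all add: scaleR_2[symmetric] flip: scaleR_add_left)
    have "integrable lborel (\<lambda>z. (case z of (p, \<xi>) \<Rightarrow> ?A p * \<Phi> (x, \<xi>)) * cis (- 2 * pi * (fst z \<bullet> snd z)))"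
    proof (rule integrable_mult_bounded(1)[where B=1])
      show "integrable lborel (\<lambda>(p, \<xi>). ?A p * \<Phi> (x, \<xi>))"
        by (intro integrable_tensor integrable_wigner_integrand[where B=B] \<Phi>_int F(2) G) measurable
      show "(\<lambda>z::(real^'n) \<times> (real^'n). cis (- 2 * pi * (fst z \<bullet> snd z))) \<in> borel_measurable borel"
        unfolding borel_prod[symmetric] by measurable
    qed simp
    then have L: "integrable lborel ?L"
      by (simp add: case_prod_unfold)
    have "(LINT p|lborel. ?H (x + p /\<^sub>R 2, x - p /\<^sub>R 2)) = (LINT p|lborel. LINT \<xi>|lborel. ?L (p, \<xi>))"
      by (simp add: cross_wigner_dual_def mid mult.assoc)
    also have "\<dots> = (LINT \<xi>|lborel. LINT p|lborel. ?L (p, \<xi>))"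
      by (rule integral_lborel_swap[OF L])
    also have "\<dots> = (LINT \<xi>|lborel. LINT p|lborel. \<Phi> (x, \<xi>) * (?A p * cis (- 2 * pi * (p \<bullet> \<xi>))))"
      by (simp add: mult_ac)
    also have "\<dots> = (LINT \<xi>|lborel. \<Phi> (x, \<xi>) * cross_wigner F G (x, \<xi>))"
      by (simp add: cross_wigner_def)
    finally show "(LINT p|lborel. ?H (x + p /\<^sub>R 2, x - p /\<^sub>R 2)) = (LINT \<xi>|lborel. \<Phi> (x, \<xi>) * cross_wigner F G (x, \<xi>))" .
  qed
  also have "\<dots> = (LINT z|lborel. \<Phi> z * cross_wigner F G z)"
  proof (rule integral_lborel_fst)
    show "integrable lborel (\<lambda>z. \<Phi> z * cross_wigner F G z)"
      by (rule integrable_mult_bounded(1)[OF \<Phi>]) (auto intro!: cross_wigner_bounded F(2) G)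
  qed
  finally show "(LINT z|lborel. \<Phi> z * cross_wigner F G z) = (LINT v|lborel. ?H v)" ..
qed

text \<open>
On functions, the transform that is defined by duality is the ordinary one.
\<close>

lemma cross_wigner_distr_eq:
  fixes F G :: "real^'n \<Rightarrow> complex"
  assumes F: "integrable lborel F" "\<And>x. norm (F x) \<le> B" and G: "integrable lborel G"
    and \<Phi>: "\<Phi> \<in> schwartz"
  shows "cross_wigner_distr (distr_of_fun F) (distr_of_fun G) \<Phi> = (LINT z|lborel. \<Phi> z * cross_wigner F G z)"
proof -
  obtain C where C: "C \<ge> 0" "\<And>z. (1 + norm z) ^ (2 * CARD('n)) * norm (\<Phi> z) \<le> C"
    using schwartz_decay[OF \<Phi>, of "[]" "2 * CARD('n)"] by auto
  define \<theta> where "\<theta> \<xi> = C * inverse ((1 + norm \<xi>) ^ (2 * DIM(real^'n)))" for \<xi> :: "real^'n"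
  have \<theta>: "integrable lborel \<theta>"
    unfolding \<theta>_def by (intro integrable_mult_right integrable_inverse_polynomial_weight)
  have le: "norm (\<Phi> (x, \<xi>)) \<le> \<theta> \<xi>" for x \<xi>
  proof -
    have "norm \<xi> \<le> norm (x, \<xi>)"
      by (metis norm_snd_le)
    then have "(1 + norm \<xi>) ^ (2 * CARD('n)) * norm (\<Phi> (x, \<xi>)) \<le> (1 + norm (x, \<xi>)) ^ (2 * CARD('n)) * norm (\<Phi> (x, \<xi>))"
      by (intro mult_right_mono power_mono) auto
    also have "\<dots> \<le> C" by (rule C)
    finally have "norm (\<Phi> (x, \<xi>)) \<le> C / (1 + norm \<xi>) ^ (2 * CARD('n))"
      by (subst pos_le_divide_eq) (auto simp: mult.commute intro!: zero_less_power add_pos_nonneg)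
    then show ?thesis
      by (simp add: \<theta>_def divide_inverse)
  qed
  note pair = wigner_pairing[OF F G schwartz_integrable[OF \<Phi>] \<theta> le]
  have "cross_wigner_distr (distr_of_fun F) (distr_of_fun G) \<Phi> =
      (LINT a|lborel. LINT b|lborel. F a * cnj (G b) * cross_wigner_dual \<Phi> a b)"
    unfolding cross_wigner_distr_def distr_of_fun_def
    by (simp flip: Bochner_Integration.integral_cnj add: mult.assoc)
  also have "\<dots> = (LINT z|lborel. \<Phi> z * cross_wigner F G z)"
    using integral_lborel_fst[OF pair(1)] pair(2) by simp
  finally show ?thesis .
qed

section \<open>The Mehler kernel\<close>

text \<open>
The real and imaginary parts of \<open>coth \<zeta>\<close> and \<open>1 / sinh \<zeta>\<close>, with the common denominator
\<open>|sinh \<zeta>|\<^sup>2\<close>; these are the coefficients of the exponent of the Mehler kernel.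
\<close>

lemma complex_hyperbolic:
  fixes \<alpha> \<beta> :: real
  assumes \<alpha>: "\<alpha> > 0"
  defines "D \<equiv> (sinh \<alpha>)\<^sup>2 + (sin \<beta>)\<^sup>2" and "\<zeta> \<equiv> Complex \<alpha> \<beta>"
  shows "D > 0" and "sinh \<zeta> \<noteq> 0" and "cosh \<zeta> \<noteq> 0" and "(norm (sinh \<zeta>))\<^sup>2 = D"
    and "cosh \<zeta> / sinh \<zeta> = Complex (sinh \<alpha> * cosh \<alpha> / D) (- (sin \<beta> * cos \<beta> / D))"
    and "1 / sinh \<zeta> = Complex (sinh \<alpha> * cos \<beta> / D) (- (cosh \<alpha> * sin \<beta> / D))"
proof -
  have sh: "sinh \<alpha> > 0" and ch: "cosh \<alpha> > 0"
    using \<alpha> by (auto simp: cosh_real_pos)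
  have chsh: "(cosh \<alpha>)\<^sup>2 = (sinh \<alpha>)\<^sup>2 + 1"
    by (simp add: cosh_square_eq)
  have cs: "(cos \<beta>)\<^sup>2 = 1 - (sin \<beta>)\<^sup>2"
    by (simp add: cos_squared_eq)
  show D: "D > 0"
    using sh by (simp add: D_def add_pos_nonneg)
  have s: "sinh \<zeta> = Complex (sinh \<alpha> * cos \<beta>) (cosh \<alpha> * sin \<beta>)"
    and c: "cosh \<zeta> = Complex (cosh \<alpha> * cos \<beta>) (sinh \<alpha> * sin \<beta>)"
    by (auto simp: complex_eq_iff \<zeta>_def sinh_field_def cosh_field_def Re_exp Im_exp field_simps)
  show n: "(norm (sinh \<zeta>))\<^sup>2 = D"
    by (simp add: s cmod_power2 D_def power_mult_distrib chsh cs algebra_simps)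
  then show s0: "sinh \<zeta> \<noteq> 0"
    using D by auto
  have "(norm (cosh \<zeta>))\<^sup>2 = (sinh \<alpha>)\<^sup>2 + (cos \<beta>)\<^sup>2"
    by (simp add: c cmod_power2 D_def power_mult_distrib chsh cs algebra_simps)
  then show "cosh \<zeta> \<noteq> 0"
    using sh by (auto simp: add_nonneg_eq_0_iff)
  have "Complex (sinh \<alpha> * cosh \<alpha> / D) (- (sin \<beta> * cos \<beta> / D)) * sinh \<zeta> = cosh \<zeta>"
  proof -
    have "sinh \<alpha> * cosh \<alpha> * (sinh \<alpha> * cos \<beta>) + sin \<beta> * cos \<beta> * (cosh \<alpha> * sin \<beta>) = cosh \<alpha> * cos \<beta> * D"
      unfolding D_def by algebra
    moreover have "sinh \<alpha> * cosh \<alpha> * (cosh \<alpha> * sin \<beta>) - sin \<beta> * cos \<beta> * (sinh \<alpha> * cos \<beta>) = sinh \<alpha> * sin \<beta> * D"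
      unfolding D_def using chsh cs by algebra
    ultimately show ?thesis
      using D unfolding s c by (simp add: complex_eq_iff field_simps)
  qed
  then show "cosh \<zeta> / sinh \<zeta> = Complex (sinh \<alpha> * cosh \<alpha> / D) (- (sin \<beta> * cos \<beta> / D))"
    using s0 by (simp add: field_simps)
  have "Complex (sinh \<alpha> * cos \<beta> / D) (- (cosh \<alpha> * sin \<beta> / D)) * sinh \<zeta> = 1"
  proof -
    have "sinh \<alpha> * cos \<beta> * (sinh \<alpha> * cos \<beta>) + cosh \<alpha> * sin \<beta> * (cosh \<alpha> * sin \<beta>) = D"
      unfolding D_def using chsh cs by algebra
    then show ?thesis
      using D unfolding s by (simp add: complex_eq_iff field_simps)
  qed
  then show "1 / sinh \<zeta> = Complex (sinh \<alpha> * cos \<beta> / D) (- (cosh \<alpha> * sin \<beta> / D))"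
    using s0 by (simp add: field_simps)
qed

text \<open>
Mehler's formula after the Fourier transform of the initial value has been carried out; the constant
is a branch of \<open>(sinh \<zeta>)\<^sup>-\<^sup>d\<^sup>/\<^sup>2\<close>.
\<close>

definition mehler_kernel :: "complex \<Rightarrow> real^'n \<Rightarrow> real^'n \<Rightarrow> complex" where
  "mehler_kernel \<zeta> x y = (gauss_const (tanh \<zeta>) / sqrt_cosh \<zeta>) ^ CARD('n) *
     exp (- of_real pi * (cosh \<zeta> / sinh \<zeta>) * of_real ((norm x)\<^sup>2 + (norm y)\<^sup>2)
       + 2 * of_real pi * (1 / sinh \<zeta>) * of_real (x \<bullet> y))"

lemma measurable_mehler_kernel [measurable]:
  assumes [measurable]: "f \<in> borel_measurable M" "g \<in> borel_measurable M"
  shows "(\<lambda>x. mehler_kernel \<zeta> (f x) (g x)) \<in> borel_measurable M"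
  unfolding mehler_kernel_def by measurable

text \<open>
Since \<open>Re (1 / w)\<close> has the sign of \<open>Re w\<close>, this follows from \<open>Re (coth \<zeta>) > 0\<close>.
\<close>

lemma Re_tanh_pos:
  assumes "Re \<zeta> > 0"
  shows "Re (tanh \<zeta>) > 0" "sinh \<zeta> \<noteq> 0" "cosh \<zeta> \<noteq> 0"
proof -
  note h = complex_hyperbolic[OF assms, of "Im \<zeta>", unfolded complex_surj]
  show "sinh \<zeta> \<noteq> 0" "cosh \<zeta> \<noteq> 0" by (fact h)+
  have "Re (cosh \<zeta> / sinh \<zeta>) > 0"
    unfolding h(5) using h(1) assms by (simp add: cosh_real_pos)
  moreover have "tanh \<zeta> = inverse (cosh \<zeta> / sinh \<zeta>)"
    by (simp add: tanh_def)
  moreover have "Re (inverse w) > 0" if "Re w > 0" for w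
    using that by (simp add: add_pos_nonneg)
  ultimately show "Re (tanh \<zeta>) > 0"
    by metis
qed

text \<open>
Inserting the definition of the Fourier transform and exchanging the integrations leaves a Gaussian
integral over \<open>\<eta>\<close>, with the linear term \<open>i (x / cosh \<zeta> - y) \<bullet> \<eta>\<close>. The identity
\<open>tanh \<zeta> + 1 / (cosh \<zeta> sinh \<zeta>) = coth \<zeta>\<close> then simplifies the coefficient of \<open>|x|\<^sup>2\<close>.
\<close>

lemma hermite_propagator_eq_mehler:
  fixes f :: "real^'n \<Rightarrow> complex"
  assumes \<zeta>: "Re \<zeta> > 0" and f: "integrable lborel f"
  shows "hermite_propagator \<zeta> f x = (LINT y|lborel. mehler_kernel \<zeta> x y * f y)"
proof -
  note h = Re_tanh_pos[OF \<zeta>]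
  have [measurable]: "f \<in> borel_measurable borel"
    using borel_measurable_integrable[OF f] by simp
  let ?\<tau> = "tanh \<zeta>" and ?\<sigma> = "1 / cosh \<zeta>"
  define E where "E \<eta> = exp (- of_real pi * ?\<tau> * of_real ((norm \<eta>)\<^sup>2)
      + 2 * of_real pi * (\<i> * ?\<sigma> * of_real (x \<bullet> \<eta>)))" for \<eta> :: "real^'n"
  define A where "A = exp (- of_real pi * ?\<tau> * of_real ((norm x)\<^sup>2))"
  define e where "e y = of_real pi * (- (?\<sigma>\<^sup>2) * of_real ((norm x)\<^sup>2) + 2 * ?\<sigma> * of_real (x \<bullet> y) - of_real ((norm y)\<^sup>2)) / ?\<tau>"
    for y :: "real^'n"
  have E: "exp (- of_real pi * tanh \<zeta> * of_real ((norm x)\<^sup>2 + (norm \<eta>)\<^sup>2)) *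
        exp (2 * of_real pi * \<i> * of_real (x \<bullet> \<eta>) / cosh \<zeta>) = A * E \<eta>" for \<eta> :: "real^'n"
    unfolding A_def E_def exp_add[symmetric] by (simp add: algebra_simps)
  have intE: "integrable lborel E"
    using integrable_gaussian[OF h(1), of "\<i> * ?\<sigma>" x 0 0] by (simp add: E_def[abs_def])
  have "integrable lborel (\<lambda>z. (case z of (\<eta>, y) \<Rightarrow> E \<eta> * f y) * cis (- 2 * pi * (snd z \<bullet> fst z)))"
  proof (rule integrable_mult_bounded(1)[where B=1])
    show "integrable lborel (\<lambda>(\<eta>, y). E \<eta> * f y)"
      by (intro integrable_tensor intE f)
    show "(\<lambda>z::(real^'n) \<times> (real^'n). cis (- 2 * pi * (snd z \<bullet> fst z))) \<in> borel_measurable borel"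
      unfolding borel_prod[symmetric] by measurable
  qed simp
  then have int: "integrable lborel (\<lambda>(\<eta>, y). E \<eta> * f y * cis (- 2 * pi * (y \<bullet> \<eta>)))"
    by (simp add: case_prod_unfold)
  have "hermite_propagator \<zeta> f x = inverse (sqrt_cosh \<zeta> ^ CARD('n)) * (LINT \<eta>|lborel. A * (fourier f \<eta> * E \<eta>))"
    unfolding hermite_propagator_def
    by (rule arg_cong[where f="(*) _"], rule Bochner_Integration.integral_cong[OF refl])
      (subst mult.assoc, subst E, simp add: mult_ac)
  also have "\<dots> = inverse (sqrt_cosh \<zeta> ^ CARD('n)) * A * (LINT \<eta>|lborel. LINT y|lborel. E \<eta> * f y * cis (- 2 * pi * (y \<bullet> \<eta>)))"
    by (simp add: fourier_def mult_ac)
  also have "(LINT \<eta>|lborel. LINT y|lborel. E \<eta> * f y * cis (- 2 * pi * (y \<bullet> \<eta>))) =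
      (LINT y|lborel. LINT \<eta>|lborel. E \<eta> * f y * cis (- 2 * pi * (y \<bullet> \<eta>)))"
    using integral_lborel_swap[OF int] by (simp only: prod.case)
  also have "\<dots> = (LINT y|lborel. gauss_const ?\<tau> ^ CARD('n) * exp (e y) * f y)"
  proof (rule Bochner_Integration.integral_cong[OF refl])
    fix y :: "real^'n"
    let ?G = "\<lambda>\<eta>. exp (- of_real pi * ?\<tau> * of_real ((norm \<eta>)\<^sup>2)
      + 2 * of_real pi * ((\<i> * ?\<sigma>) * of_real (x \<bullet> \<eta>) + (- \<i>) * of_real (y \<bullet> \<eta>)))"
    have split: "E \<eta> * f y * cis (- 2 * pi * (y \<bullet> \<eta>)) = ?G \<eta> * f y" for \<eta>
    proof -
      have "cis (- 2 * pi * (y \<bullet> \<eta>)) = exp (2 * of_real pi * ((- \<i>) * of_real (y \<bullet> \<eta>)))"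
        by (simp add: cis_conv_exp mult_ac)
      then have "E \<eta> * f y * cis (- 2 * pi * (y \<bullet> \<eta>)) = (E \<eta> * exp (2 * of_real pi * ((- \<i>) * of_real (y \<bullet> \<eta>)))) * f y"
        by simp
      then show ?thesis
        unfolding E_def exp_add[symmetric] by (simp only: distrib_left add.assoc)
    qed
    have "\<i> * \<i> = -1" by simp
    then have "(\<i> * s)\<^sup>2 * X + 2 * (\<i> * s) * (- \<i>) * Z + (- \<i>)\<^sup>2 * W = - (s\<^sup>2) * X + 2 * s * Z - W" for s X Z W
      by algebra
    then have "(LINT \<eta>|lborel. ?G \<eta>) = gauss_const ?\<tau> ^ CARD('n) * exp (e y)"
      unfolding e_def by (subst gaussian_integral[OF h(1)]) (simp only: DIM_cart DIM_real mult_1_right)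
    then show "(LINT \<eta>|lborel. E \<eta> * f y * cis (- 2 * pi * (y \<bullet> \<eta>))) = gauss_const ?\<tau> ^ CARD('n) * exp (e y) * f y"
      unfolding split integral_mult_left_zero by (rule arg_cong)
  qed
  also have "inverse (sqrt_cosh \<zeta> ^ CARD('n)) * A * \<dots> = (LINT y|lborel. mehler_kernel \<zeta> x y * f y)"
  proof (subst integral_mult_right_zero[symmetric], rule Bochner_Integration.integral_cong[OF refl])
    fix y :: "real^'n"
    have "?\<tau> + ?\<sigma>\<^sup>2 / ?\<tau> = ((sinh \<zeta>)\<^sup>2 + 1) / (cosh \<zeta> * sinh \<zeta>)"
      using h(2,3) by (simp add: tanh_def field_simps power2_eq_square)
    also have "\<dots> = cosh \<zeta> / sinh \<zeta>"
      unfolding cosh_square_eq[symmetric] using h(2,3) by (simp add: power2_eq_square)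
    finally have coth: "?\<tau> + ?\<sigma>\<^sup>2 / ?\<tau> = cosh \<zeta> / sinh \<zeta>" "?\<sigma> / ?\<tau> = 1 / sinh \<zeta>" "1 / ?\<tau> = cosh \<zeta> / sinh \<zeta>"
      using h(2,3) by (simp_all add: tanh_def)
    have "- of_real pi * ?\<tau> * of_real ((norm x)\<^sup>2) + e y
      = - of_real pi * ((?\<tau> + ?\<sigma>\<^sup>2 / ?\<tau>) * of_real ((norm x)\<^sup>2) + (1 / ?\<tau>) * of_real ((norm y)\<^sup>2)) + 2 * of_real pi * (?\<sigma> / ?\<tau>) * of_real (x \<bullet> y)"
      by (simp add: e_def algebra_simps add_divide_distrib diff_divide_distrib)
    also have "\<dots> = - of_real pi * (cosh \<zeta> / sinh \<zeta>) * of_real ((norm x)\<^sup>2 + (norm y)\<^sup>2)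
       + 2 * of_real pi * (1 / sinh \<zeta>) * of_real (x \<bullet> y)"
      unfolding coth by (simp add: algebra_simps)
    finally have "mehler_kernel \<zeta> x y = (gauss_const ?\<tau> / sqrt_cosh \<zeta>) ^ CARD('n) * (A * exp (e y))"
      unfolding A_def exp_add[symmetric] mehler_kernel_def by simp
    then show "inverse (sqrt_cosh \<zeta> ^ CARD('n)) * A * (gauss_const ?\<tau> ^ CARD('n) * exp (e y) * f y) = mehler_kernel \<zeta> x y * f y"
      by (simp add: power_divide field_simps)
  qed
  finally show ?thesis .
qed

text \<open>
By the inequality \<open>2 |x \<bullet> y| \<le> |x|\<^sup>2 + |y|\<^sup>2\<close>, the kernel decays because
\<open>|Re (1 / sinh \<zeta>)| < Re (coth \<zeta>)\<close>, which for \<open>\<zeta> = \<alpha> + i\<beta>\<close> is \<open>|cos \<beta>| < cosh \<alpha>\<close>.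
\<close>

lemma mehler_kernel_bound:
  assumes \<zeta>: "Re \<zeta> > 0"
  obtains \<kappa> \<epsilon> where "\<kappa> \<ge> 0" "\<epsilon> > 0"
    "\<And>x y :: real^'n. norm (mehler_kernel \<zeta> x y) \<le> \<kappa> * exp (- (\<epsilon> * (norm x)\<^sup>2))"
proof
  define c\<^sub>1 where "c\<^sub>1 = Re (cosh \<zeta> / sinh \<zeta>)"
  define s\<^sub>1 where "s\<^sub>1 = Re (1 / sinh \<zeta>)"
  define \<kappa> where "\<kappa> = norm ((gauss_const (tanh \<zeta>) / sqrt_cosh \<zeta>) ^ CARD('n))"
  note h = complex_hyperbolic[OF \<zeta>, of "Im \<zeta>", unfolded complex_surj]
  show "\<kappa> \<ge> 0" by (simp add: \<kappa>_def)
  have "\<bar>s\<^sub>1\<bar> < c\<^sub>1"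
  proof -
    have "\<bar>sinh (Re \<zeta>) * cos (Im \<zeta>)\<bar> \<le> sinh (Re \<zeta>) * 1"
      using \<zeta> by (simp add: abs_mult)
    also have "\<dots> < sinh (Re \<zeta>) * cosh (Re \<zeta>)"
    proof (rule mult_strict_left_mono)
      have "1\<^sup>2 < (cosh (Re \<zeta>))\<^sup>2"
        using \<zeta> by (simp add: cosh_square_eq)
      then show "1 < cosh (Re \<zeta>)"
        by (rule power2_less_imp_less) simp
    qed (use \<zeta> in simp)
    finally show ?thesis
      using h(1) unfolding c\<^sub>1_def s\<^sub>1_def h(5,6) by (simp add: abs_divide divide_strict_right_mono)
  qed
  then show "0 < pi * (c\<^sub>1 - \<bar>s\<^sub>1\<bar>)" by simp
  fix x y :: "real^'n"
  have "2 * (s\<^sub>1 * (x \<bullet> y)) \<le> \<bar>s\<^sub>1\<bar> * ((norm x)\<^sup>2 + (norm y)\<^sup>2)"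
  proof -
    have "2 * \<bar>x \<bullet> y\<bar> \<le> 2 * (norm x * norm y)"
      using Cauchy_Schwarz_ineq2[of x y] by simp
    also have "\<dots> \<le> (norm x)\<^sup>2 + (norm y)\<^sup>2"
      using sum_squares_bound[of "norm x" "norm y"] by simp
    finally have "\<bar>s\<^sub>1\<bar> * (2 * \<bar>x \<bullet> y\<bar>) \<le> \<bar>s\<^sub>1\<bar> * ((norm x)\<^sup>2 + (norm y)\<^sup>2)"
      by (rule mult_left_mono) simp
    moreover have "s\<^sub>1 * (x \<bullet> y) \<le> \<bar>s\<^sub>1\<bar> * \<bar>x \<bullet> y\<bar>"
      by (simp flip: abs_mult)
    ultimately show ?thesis by linarith
  qed
  moreover have "(c\<^sub>1 - \<bar>s\<^sub>1\<bar>) * (norm x)\<^sup>2 \<le> (c\<^sub>1 - \<bar>s\<^sub>1\<bar>) * ((norm x)\<^sup>2 + (norm y)\<^sup>2)"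
    using \<open>\<bar>s\<^sub>1\<bar> < c\<^sub>1\<close> by (intro mult_left_mono) auto
  ultimately have "- c\<^sub>1 * ((norm x)\<^sup>2 + (norm y)\<^sup>2) + 2 * (s\<^sub>1 * (x \<bullet> y)) \<le> - ((c\<^sub>1 - \<bar>s\<^sub>1\<bar>) * (norm x)\<^sup>2)"
    by (simp add: algebra_simps)
  from mult_left_mono[OF this, of pi]
  have "- pi * c\<^sub>1 * ((norm x)\<^sup>2 + (norm y)\<^sup>2) + 2 * pi * s\<^sub>1 * (x \<bullet> y) \<le> - (pi * (c\<^sub>1 - \<bar>s\<^sub>1\<bar>) * (norm x)\<^sup>2)"
    by (simp add: algebra_simps)
  moreover have "Re (- of_real pi * w * of_real r + 2 * of_real pi * v * of_real q) = - pi * Re w * r + 2 * pi * Re v * q"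
    for w v :: complex and r q by simp
  ultimately show "norm (mehler_kernel \<zeta> x y) \<le> \<kappa> * exp (- (pi * (c\<^sub>1 - \<bar>s\<^sub>1\<bar>) * (norm x)\<^sup>2))"
    unfolding mehler_kernel_def norm_mult \<kappa>_def[symmetric] norm_exp_eq_Re
    by (intro mult_left_mono exp_mono) (simp_all only: c\<^sub>1_def s\<^sub>1_def \<kappa>_def norm_ge_zero)
qed

lemma norm_mehler_const:
  assumes \<zeta>: "Re \<zeta> > 0"
  shows "(norm (gauss_const (tanh \<zeta>) / sqrt_cosh \<zeta>))\<^sup>2 = 1 / norm (sinh \<zeta>)"
proof -
  have "(norm (sqrt_cosh \<zeta>))\<^sup>2 = norm (cosh \<zeta>)"
    by (simp add: sqrt_cosh_square flip: norm_power)
  then have "(norm (gauss_const (tanh \<zeta>) / sqrt_cosh \<zeta>))\<^sup>2 = 1 / norm (tanh \<zeta>) / norm (cosh \<zeta>)"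
    using norm_gauss_const[OF Re_tanh_pos(1)[OF \<zeta>]] by (simp add: norm_divide power_divide)
  then show ?thesis
    using Re_tanh_pos(3)[OF \<zeta>] by (simp add: tanh_def norm_divide)
qed

lemma hermite_propagator_measurable:
  fixes f :: "real^'n \<Rightarrow> complex"
  assumes \<zeta>: "Re \<zeta> > 0" and f: "integrable lborel f"
  shows "hermite_propagator \<zeta> f \<in> borel_measurable borel"
proof -
  have [measurable]: "f \<in> borel_measurable borel"
    using borel_measurable_integrable[OF f] by simp
  have "(\<lambda>x. LINT y|lborel. mehler_kernel \<zeta> x y * f y) \<in> borel_measurable borel"
    by (rule lborel.borel_measurable_lebesgue_integral) measurable
  then show ?thesis
    by (simp add: hermite_propagator_eq_mehler[OF \<zeta> f] cong: measurable_cong)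
qed

lemma integrable_mehler_kernel_mult:
  fixes f :: "real^'n \<Rightarrow> complex"
  assumes \<zeta>: "Re \<zeta> > 0" and f: "integrable lborel f"
  shows "integrable lborel (\<lambda>y. mehler_kernel \<zeta> x y * f y)"
proof -
  obtain \<kappa> \<epsilon> where k: "\<And>x y :: real^'n. norm (mehler_kernel \<zeta> x y) \<le> \<kappa> * exp (- (\<epsilon> * (norm x)\<^sup>2))"
    using mehler_kernel_bound[OF \<zeta>, where 'n='n] by metis
  show ?thesis
    by (rule integrable_mult_bounded(2)[OF f _ k]) measurable
qed

lemma
  assumes \<zeta>: "Re \<zeta> > 0"
  shows hermite_propagator_bounded: "\<exists>\<kappa>\<ge>0. \<forall>f (x :: real^'n). integrable lborel f \<longrightarrow>
      norm (hermite_propagator \<zeta> f x) \<le> \<kappa> * (LINT y|lborel. norm (f y))"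
    and hermite_propagator_integrable: "\<And>f :: real^'n \<Rightarrow> complex. integrable lborel f \<Longrightarrow> integrable lborel (hermite_propagator \<zeta> f)"
proof -
  obtain \<kappa> \<epsilon> where k: "\<kappa> \<ge> 0" "\<epsilon> > 0"
    "\<And>x y :: real^'n. norm (mehler_kernel \<zeta> x y) \<le> \<kappa> * exp (- (\<epsilon> * (norm x)\<^sup>2))"
    using mehler_kernel_bound[OF \<zeta>, where 'n='n] by metis
  have decay: "norm (hermite_propagator \<zeta> f x) \<le> \<kappa> * exp (- (\<epsilon> * (norm x)\<^sup>2)) * (LINT y|lborel. norm (f y))"
    if f: "integrable lborel f" for f and x :: "real^'n"
  proof -
    have "norm (hermite_propagator \<zeta> f x) \<le> (LINT y|lborel. norm (mehler_kernel \<zeta> x y * f y))"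
      unfolding hermite_propagator_eq_mehler[OF \<zeta> f] by (rule integral_norm_bound)
    also have "\<dots> \<le> (LINT y|lborel. \<kappa> * exp (- (\<epsilon> * (norm x)\<^sup>2)) * norm (f y))"
      by (intro integral_mono integrable_norm integrable_mehler_kernel_mult \<zeta> f integrable_mult_right)
        (auto simp: norm_mult intro!: mult_right_mono k(3))
    finally show ?thesis
      by (simp only: integral_mult_right_zero)
  qed
  have "\<kappa> * exp (- (\<epsilon> * (norm x)\<^sup>2)) * (LINT y|lborel. norm (f y)) \<le> \<kappa> * 1 * (LINT y|lborel. norm (f y))"
    for x :: "real^'n" and f :: "real^'n \<Rightarrow> complex"
    using k by (intro mult_right_mono mult_left_mono) auto
  with decay k(1) show "\<exists>\<kappa>\<ge>0. \<forall>f (x :: real^'n). integrable lborel f \<longrightarrow>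
      norm (hermite_propagator \<zeta> f x) \<le> \<kappa> * (LINT y|lborel. norm (f y))"
    by (intro exI[of _ \<kappa>]) (fastforce intro: order_trans)
  show "integrable lborel (hermite_propagator \<zeta> f)" if f: "integrable lborel f" for f :: "real^'n \<Rightarrow> complex"
    by (rule integrable_of_norm_le[OF _ hermite_propagator_measurable[OF \<zeta> f] decay[OF f]])
      (intro integrable_mult_left integrable_mult_right integrable_gaussian_norm k)
qed

section \<open>The Wigner transform of the Mehler kernel\<close>

text \<open>
The kernel in terms of \<open>\<alpha> = \<theta>t\<close> and \<open>\<beta> = \<mu>t\<close>, the real and imaginary part of \<open>\<zeta>\<close>, and with the inverse
rotation made explicit.
\<close>

definition hermite_wigner_kernel :: "real \<Rightarrow> real \<Rightarrow> (real^'n) \<times> (real^'n) \<Rightarrow> (real^'n) \<times> (real^'n) \<Rightarrow> real" where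
  "hermite_wigner_kernel \<alpha> \<beta> z w = (2 / sinh \<alpha>) ^ CARD('n) *
     exp (- (2 * pi / tanh \<alpha>) * ((norm z)\<^sup>2 + (norm w)\<^sup>2)) *
     exp (4 * pi / sinh \<alpha> * (phase_rotation (- \<beta>) z \<bullet> w))"

lemma measurable_hermite_wigner_kernel [measurable]:
  assumes "f \<in> borel_measurable M" "g \<in> borel_measurable M"
  shows "(\<lambda>x. hermite_wigner_kernel \<alpha> \<beta> (f x) (g x)) \<in> borel_measurable M"
proof -
  have "continuous_on UNIV (phase_rotation (- \<beta>) :: (real^'n) \<times> (real^'n) \<Rightarrow> _)"
    unfolding phase_rotation_def case_prod_unfold by (intro continuous_intros)
  from measurable_compose[OF assms(1) borel_measurable_continuous_onI[OF this]]
  have [measurable]: "(\<lambda>x. phase_rotation (- \<beta>) (f x)) \<in> borel_measurable M" .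
  note [measurable] = assms
  show ?thesis
    unfolding hermite_wigner_kernel_def by measurable
qed

text \<open>
The rotation is an isometry and \<open>1 / sinh \<alpha> < coth \<alpha>\<close>, so that the cross term is absorbed as for the
Mehler kernel.
\<close>

lemma hermite_wigner_kernel_bound:
  assumes \<alpha>: "\<alpha> > 0"
  obtains A \<epsilon> where "A \<ge> 0" "\<epsilon> > 0"
    "\<And>z w :: (real^'n) \<times> (real^'n). 0 \<le> hermite_wigner_kernel \<alpha> \<beta> z w \<and> hermite_wigner_kernel \<alpha> \<beta> z w \<le> A * exp (- (\<epsilon> * (norm w)\<^sup>2))"
proof
  have sh: "sinh \<alpha> > 0" using \<alpha> by simp
  have ch: "cosh \<alpha> > 1"
  proof -
    have "1\<^sup>2 < (cosh \<alpha>)\<^sup>2"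
      using \<alpha> by (simp add: cosh_square_eq)
    then show ?thesis
      by (rule power2_less_imp_less) simp
  qed
  define S where "S = 1 / sinh \<alpha>"
  define C where "C = cosh \<alpha> / sinh \<alpha>"
  have S: "0 < S" "S < C"
    using sh ch by (auto simp: S_def C_def divide_strict_right_mono)
  show "0 \<le> (2 / sinh \<alpha>) ^ CARD('n)" using sh by simp
  show "0 < 2 * pi * (C - S)" using S by simp
  fix z w :: "(real^'n) \<times> (real^'n)"
  have n: "norm (phase_rotation (- \<beta>) z) = norm z"
  proof -
    obtain x \<xi> where z: "z = (x, \<xi>)" by (cases z)
    have "phase_rotation (- \<beta>) z \<bullet> phase_rotation (- \<beta>) z = x \<bullet> x + \<xi> \<bullet> \<xi>"
      unfolding z phase_rotation_def
      by (simp add: inner_add_left inner_add_right inner_diff_left inner_diff_right algebra_simps inner_commute)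
        (use sin_cos_squared_add[of \<beta>] in algebra)
    then show ?thesis
      by (simp add: z norm_eq)
  qed
  have "phase_rotation (- \<beta>) z \<bullet> w \<le> norm z * norm w"
    using norm_cauchy_schwarz[of "phase_rotation (- \<beta>) z" w] by (simp add: n)
  then have "2 * (phase_rotation (- \<beta>) z \<bullet> w) \<le> (norm z)\<^sup>2 + (norm w)\<^sup>2"
    using sum_squares_bound[of "norm z" "norm w"] by linarith
  then have "S * (2 * (phase_rotation (- \<beta>) z \<bullet> w)) \<le> S * ((norm z)\<^sup>2 + (norm w)\<^sup>2)"
    using S by (intro mult_left_mono) auto
  moreover have "(C - S) * (norm w)\<^sup>2 \<le> (C - S) * ((norm z)\<^sup>2 + (norm w)\<^sup>2)"
    using S by (intro mult_left_mono) auto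
  ultimately have "2 * pi * (- C * ((norm z)\<^sup>2 + (norm w)\<^sup>2) + S * (2 * (phase_rotation (- \<beta>) z \<bullet> w))) \<le> 2 * pi * (- ((C - S) * (norm w)\<^sup>2))"
    by (intro mult_left_mono) (auto simp: algebra_simps)
  moreover have "hermite_wigner_kernel \<alpha> \<beta> z w = (2 / sinh \<alpha>) ^ CARD('n) *
      exp (2 * pi * (- C * ((norm z)\<^sup>2 + (norm w)\<^sup>2) + S * (2 * (phase_rotation (- \<beta>) z \<bullet> w))))"
    unfolding hermite_wigner_kernel_def mult.assoc exp_add[symmetric]
    by (simp add: C_def S_def tanh_def algebra_simps)
  ultimately show "0 \<le> hermite_wigner_kernel \<alpha> \<beta> z w \<and> hermite_wigner_kernel \<alpha> \<beta> z w \<le>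
      (2 / sinh \<alpha>) ^ CARD('n) * exp (- (2 * pi * (C - S) * (norm w)\<^sup>2))"
    using sh by (auto intro!: mult_left_mono simp: mult.assoc)
qed

text \<open>
The exponents of the two Gaussians that have to be compared are quadratic forms in \<open>x, \<xi>, u, q\<close>, where
\<open>u\<close> and \<open>q\<close> are the midpoint and the difference of the arguments \<open>y, y'\<close>. Each variable with a double
letter stands for an inner product of two of these vectors, so that the real and imaginary parts
yield two linear identities in ten variables, and comparing coefficients reduces it to the ten
relations between hyperbolic and trigonometric functions in the proof. Here \<open>c\<^sub>1 + i c\<^sub>2 = coth \<zeta>\<close>,
\<open>s\<^sub>1 + i s\<^sub>2 = 1 / sinh \<zeta>\<close>, \<open>C = coth \<alpha>\<close> and \<open>S = 1 / sinh \<alpha>\<close>.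
\<close>

lemma mehler_exponent_identity:
  fixes sh ch sn cs xx \<xi>\<xi> uu qq x\<xi> xu xq u\<xi> uq q\<xi> :: real
  assumes pos: "sh > 0" "ch > 0" and ch: "ch\<^sup>2 = sh\<^sup>2 + 1" and cs: "cs\<^sup>2 = 1 - sn\<^sup>2"
  defines "D \<equiv> sh\<^sup>2 + sn\<^sup>2"
  defines "c\<^sub>1 \<equiv> sh * ch / D" and "c\<^sub>2 \<equiv> - (sn * cs / D)"
    and "s\<^sub>1 \<equiv> sh * cs / D" and "s\<^sub>2 \<equiv> - (ch * sn / D)" and "C \<equiv> ch / sh" and "S \<equiv> 1 / sh"
  shows "- 2 * c\<^sub>1 * (xx + uu + qq / 4) + 4 * s\<^sub>1 * xu
      + 2 / c\<^sub>1 * (s\<^sub>1\<^sup>2 / 4 * qq - (s\<^sub>2\<^sup>2 * uu + c\<^sub>2\<^sup>2 * xx + \<xi>\<xi> - 2 * s\<^sub>2 * c\<^sub>2 * xu - 2 * s\<^sub>2 * u\<xi> + 2 * c\<^sub>2 * x\<xi>)) =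
      - 2 * C * (xx + \<xi>\<xi> + uu) + 4 * S * (cs * xu - sn * u\<xi>)
      + 1 / (2 * C) * (4 * S\<^sup>2 * (sn\<^sup>2 * xx + 2 * sn * cs * x\<xi> + cs\<^sup>2 * \<xi>\<xi>) - qq)" (is ?real)
    and "- 2 * c\<^sub>2 * uq + 2 * s\<^sub>2 * xq + 2 / c\<^sub>1 * (s\<^sub>1 * (s\<^sub>2 * uq - c\<^sub>2 * xq - q\<xi>)) =
      1 / (2 * C) * (- 4 * S * (sn * xq + cs * q\<xi>))" (is ?imag)
proof -
  have D: "D > 0" "D \<noteq> 0" and sh0: "sh \<noteq> 0" "ch \<noteq> 0"
    using pos by (auto simp: D_def add_pos_nonneg)
  have ic: "x / c\<^sub>1 = x * D / (sh * ch)" and iC: "x / C = x * sh / ch" for x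
    by (simp_all add: c\<^sub>1_def C_def)
  have D': "D = ch\<^sup>2 - cs\<^sup>2" "D = sh\<^sup>2 + 1 - cs\<^sup>2" "D = ch\<^sup>2 - 1 + sn\<^sup>2"
    by (simp_all add: D_def ch cs)
  have xx: "c\<^sub>1 + c\<^sub>2\<^sup>2 / c\<^sub>1 = C - S\<^sup>2 * sn\<^sup>2 / C"
  proof -
    have "(sh\<^sup>2 * ch\<^sup>2 + sn\<^sup>2 * cs\<^sup>2) = (ch\<^sup>2 - sn\<^sup>2) * D"
      unfolding D_def using ch cs by algebra
    then have "(sh\<^sup>2 * ch\<^sup>2 + sn\<^sup>2 * cs\<^sup>2) / (D * (sh * ch)) = (ch\<^sup>2 - sn\<^sup>2) / (sh * ch)"
      using D sh0 by simp
    moreover have "c\<^sub>1 + c\<^sub>2\<^sup>2 / c\<^sub>1 = (sh\<^sup>2 * ch\<^sup>2 + sn\<^sup>2 * cs\<^sup>2) / (D * (sh * ch))"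
      unfolding ic using D sh0 by (simp add: c\<^sub>1_def c\<^sub>2_def field_simps power2_eq_square)
    moreover have "C - S\<^sup>2 * sn\<^sup>2 / C = (ch\<^sup>2 - sn\<^sup>2) / (sh * ch)"
      unfolding iC using sh0 by (simp add: C_def S_def field_simps power2_eq_square)
    ultimately show ?thesis by simp
  qed
  have \<xi>\<xi>: "1 / c\<^sub>1 = C - S\<^sup>2 * cs\<^sup>2 / C"
  proof -
    have "C - S\<^sup>2 * cs\<^sup>2 / C = (ch\<^sup>2 - cs\<^sup>2) / (sh * ch)"
      unfolding iC using sh0 by (simp add: C_def S_def field_simps power2_eq_square)
    then show ?thesis
      unfolding ic D'(1)[symmetric] by simp
  qed
  have x\<xi>: "- c\<^sub>2 / c\<^sub>1 = S\<^sup>2 * sn * cs / C"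
    unfolding ic iC using D sh0 by (simp add: c\<^sub>2_def S_def field_simps power2_eq_square)
  have uu: "c\<^sub>1 + s\<^sub>2\<^sup>2 / c\<^sub>1 = C"
    unfolding ic using D sh0 by (simp add: c\<^sub>1_def s\<^sub>2_def C_def field_simps power2_eq_square)
      (simp add: D_def algebra_simps power2_eq_square)
  have qq: "c\<^sub>1 - s\<^sub>1\<^sup>2 / c\<^sub>1 = 1 / C"
  proof -
    have "c\<^sub>1 - s\<^sub>1\<^sup>2 / c\<^sub>1 = sh * (ch\<^sup>2 - cs\<^sup>2) / (D * ch)"
      unfolding ic using D sh0 by (simp add: c\<^sub>1_def s\<^sub>1_def field_simps power2_eq_square)
    then show ?thesis
      unfolding D'(1)[symmetric] using D sh0 by (simp add: C_def)
  qed
  have xu: "s\<^sub>1 + s\<^sub>2 * c\<^sub>2 / c\<^sub>1 = S * cs"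
    unfolding ic using D sh0 by (simp add: s\<^sub>1_def s\<^sub>2_def c\<^sub>2_def S_def field_simps power2_eq_square)
      (simp add: D_def algebra_simps power2_eq_square)
  have u\<xi>: "s\<^sub>2 / c\<^sub>1 = - (S * sn)"
    unfolding ic using D sh0 by (simp add: s\<^sub>2_def S_def field_simps power2_eq_square)
  have uq: "s\<^sub>1 * s\<^sub>2 / c\<^sub>1 = c\<^sub>2"
    unfolding ic using D sh0 by (simp add: s\<^sub>1_def s\<^sub>2_def c\<^sub>2_def field_simps power2_eq_square)
  have q\<xi>: "s\<^sub>1 / c\<^sub>1 = S * cs / C"
    unfolding ic iC using D sh0 by (simp add: s\<^sub>1_def S_def field_simps power2_eq_square)
  have xq: "s\<^sub>2 - s\<^sub>1 * c\<^sub>2 / c\<^sub>1 = - (S * sn / C)"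
  proof -
    have "s\<^sub>2 - s\<^sub>1 * c\<^sub>2 / c\<^sub>1 = - (sn * (ch\<^sup>2 - cs\<^sup>2) / (D * ch))"
      unfolding ic using D sh0 by (simp add: s\<^sub>1_def s\<^sub>2_def c\<^sub>2_def field_simps power2_eq_square)
    then show ?thesis
      unfolding D'(1)[symmetric] iC using D sh0 by (simp add: S_def)
  qed
  have "- 2 * c\<^sub>1 * (xx + uu + qq / 4) + 4 * s\<^sub>1 * xu
      + 2 / c\<^sub>1 * (s\<^sub>1\<^sup>2 / 4 * qq - (s\<^sub>2\<^sup>2 * uu + c\<^sub>2\<^sup>2 * xx + \<xi>\<xi> - 2 * s\<^sub>2 * c\<^sub>2 * xu - 2 * s\<^sub>2 * u\<xi> + 2 * c\<^sub>2 * x\<xi>)) =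
      - 2 * (c\<^sub>1 + c\<^sub>2\<^sup>2 / c\<^sub>1) * xx - 2 * (1 / c\<^sub>1) * \<xi>\<xi> + 4 * (- c\<^sub>2 / c\<^sub>1) * x\<xi> - 2 * (c\<^sub>1 + s\<^sub>2\<^sup>2 / c\<^sub>1) * uu
      - (c\<^sub>1 - s\<^sub>1\<^sup>2 / c\<^sub>1) * qq / 2 + 4 * (s\<^sub>1 + s\<^sub>2 * c\<^sub>2 / c\<^sub>1) * xu + 4 * (s\<^sub>2 / c\<^sub>1) * u\<xi>"
    by (simp add: algebra_simps add_divide_distrib diff_divide_distrib)
  also have "\<dots> = - 2 * C * (xx + \<xi>\<xi> + uu) + 4 * S * (cs * xu - sn * u\<xi>)
      + 1 / (2 * C) * (4 * S\<^sup>2 * (sn\<^sup>2 * xx + 2 * sn * cs * x\<xi> + cs\<^sup>2 * \<xi>\<xi>) - qq)"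
    unfolding xx \<xi>\<xi> x\<xi> uu qq xu u\<xi> by (simp add: algebra_simps add_divide_distrib diff_divide_distrib)
  finally show ?real .
  have "- 2 * c\<^sub>2 * uq + 2 * s\<^sub>2 * xq + 2 / c\<^sub>1 * (s\<^sub>1 * (s\<^sub>2 * uq - c\<^sub>2 * xq - q\<xi>)) =
      2 * (s\<^sub>1 * s\<^sub>2 / c\<^sub>1 - c\<^sub>2) * uq + 2 * (s\<^sub>2 - s\<^sub>1 * c\<^sub>2 / c\<^sub>1) * xq - 2 * (s\<^sub>1 / c\<^sub>1) * q\<xi>"
    by (simp add: algebra_simps add_divide_distrib diff_divide_distrib)
  also have "\<dots> = 1 / (2 * C) * (- 4 * S * (sn * xq + cs * q\<xi>))"
    unfolding uq xq q\<xi> by (simp add: algebra_simps add_divide_distrib diff_divide_distrib)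
  finally show ?imag .
qed

text \<open>
In the product of \<open>K\<close> with its conjugate, the quadratic terms in \<open>p\<close> have the coefficients \<open>c / 4\<close> and
\<open>cnj c / 4\<close>, whose sum is real. So the integral over \<open>p\<close> is that of a real Gaussian with
a real linear term, from \<open>Re s\<close>, and an imaginary one, in which the imaginary parts of \<open>c\<close> and \<open>s\<close>
join \<open>\<xi>\<close> in the frequency vector \<open>Y\<close>.
\<close>

lemma wigner_mehler_exponential:
  fixes x \<xi> u q :: "real^'n" and c s :: complex
  assumes c: "Re c > 0"
  defines "K \<equiv> \<lambda>a b. exp (- of_real pi * c * of_real ((norm a)\<^sup>2 + (norm b)\<^sup>2) + 2 * of_real pi * s * of_real (a \<bullet> b))"
  defines "Y \<equiv> Im s *\<^sub>R u - Im c *\<^sub>R x - \<xi>"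
  shows "(LINT p|lborel. K (x + p /\<^sub>R 2) (u + q /\<^sub>R 2) * cnj (K (x - p /\<^sub>R 2) (u - q /\<^sub>R 2)) * cis (- 2 * pi * (p \<bullet> \<xi>))) =
    gauss_const (of_real (Re c / 2)) ^ CARD('n) * exp (of_real pi * Complex
      (- 2 * Re c * (x \<bullet> x + u \<bullet> u + q \<bullet> q / 4) + 4 * Re s * (x \<bullet> u) + 2 / Re c * ((Re s)\<^sup>2 / 4 * (q \<bullet> q) - Y \<bullet> Y))
      (- 2 * Im c * (u \<bullet> q) + 2 * Im s * (x \<bullet> q) + 2 / Re c * (Re s * (q \<bullet> Y))))"
    (is "(LINT p|_. ?I p) = ?c * exp ?X")
proof -
  let ?E = "of_real pi * Complex (- 2 * Re c * (x \<bullet> x + u \<bullet> u + q \<bullet> q / 4) + 4 * Re s * (x \<bullet> u))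
    (- 2 * Im c * (u \<bullet> q) + 2 * Im s * (x \<bullet> q))"
  let ?G = "\<lambda>p. exp (- of_real pi * of_real (Re c / 2) * of_real ((norm p)\<^sup>2)
      + 2 * of_real pi * (of_real (Re s / 2) * of_real (q \<bullet> p) + \<i> * of_real (Y \<bullet> p)))"
  let ?N = "(of_real (Re s / 2))\<^sup>2 * of_real ((norm q)\<^sup>2) + 2 * of_real (Re s / 2) * \<i> * of_real (q \<bullet> Y) + \<i>\<^sup>2 * of_real ((norm Y)\<^sup>2)"
  have split: "?I p = exp ?E * ?G p" for p
    unfolding K_def Y_def cis_conv_exp exp_cnj exp_add[symmetric] power2_norm_eq_inner
    by (intro arg_cong[where f=exp]) (simp add: complex_eq_iff inner_add_left inner_add_right inner_diff_left inner_diff_right inner_commute field_simps)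
  have "(LINT p|lborel. ?I p) = exp ?E * (LINT p|lborel. ?G p)"
    unfolding split by (rule integral_mult_right_zero)
  also have "\<dots> = exp ?E * (?c * exp (of_real pi * ?N / of_real (Re c / 2)))"
    using c by (subst gaussian_integral) auto
  also have "\<dots> = ?c * exp (?E + of_real pi * ?N / of_real (Re c / 2))"
    by (simp only: exp_add mult_ac)
  also have "?E + of_real pi * ?N / of_real (Re c / 2) = ?X"
  proof -
    have "?N = Complex ((Re s)\<^sup>2 / 4 * (q \<bullet> q) - Y \<bullet> Y) (Re s * (q \<bullet> Y))"
      unfolding power2_norm_eq_inner by (simp add: complex_eq_iff power2_eq_square)
    from this[unfolded power2_norm_eq_inner] show ?thesis
      unfolding power2_norm_eq_inner using c by (simp add: complex_eq_iff Re_divide_of_real Im_divide_of_real field_simps)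
  qed
  finally show ?thesis .
qed

text \<open>
The phase space rotation splits into \<open>X\<close>, which pairs with the position \<open>u\<close>, and \<open>Y\<close>, which pairs with
the momentum \<open>\<upsilon>\<close> and is the only part that takes part in the Fourier transform.
\<close>

lemma fourier_hermite_wigner_kernel:
  fixes x \<xi> u q :: "real^'n" and \<alpha> \<beta> :: real
  assumes \<alpha>: "\<alpha> > 0"
  defines "C \<equiv> cosh \<alpha> / sinh \<alpha>" and "S \<equiv> 1 / sinh \<alpha>"
  defines "X \<equiv> cos \<beta> *\<^sub>R x - sin \<beta> *\<^sub>R \<xi>" and "Y \<equiv> sin \<beta> *\<^sub>R x + cos \<beta> *\<^sub>R \<xi>"
  shows "(LINT \<upsilon>|lborel. of_real (hermite_wigner_kernel \<alpha> \<beta> (x, \<xi>) (u, \<upsilon>)) * cis (- 2 * pi * (q \<bullet> \<upsilon>))) =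
    of_real ((2 / sinh \<alpha>) ^ CARD('n)) * gauss_const (of_real (2 * C)) ^ CARD('n) * exp (of_real pi * Complex
      (- 2 * C * (x \<bullet> x + \<xi> \<bullet> \<xi> + u \<bullet> u) + 4 * S * (X \<bullet> u) + 1 / (2 * C) * (4 * S\<^sup>2 * (Y \<bullet> Y) - q \<bullet> q))
      (1 / (2 * C) * (- 4 * S * (Y \<bullet> q))))"
    (is "(LINT \<upsilon>|_. ?I \<upsilon>) = ?A * ?c * exp ?X")
proof -
  have C: "C > 0" using \<alpha> by (simp add: C_def cosh_real_pos)
  have coth: "2 * pi / tanh \<alpha> = 2 * pi * C" "4 * pi / sinh \<alpha> = 4 * pi * S"
    by (simp_all add: C_def S_def tanh_def)
  let ?E = "of_real (pi * (- 2 * C * (x \<bullet> x + \<xi> \<bullet> \<xi> + u \<bullet> u) + 4 * S * (X \<bullet> u))) :: complex"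
  let ?H = "\<lambda>v. - of_real pi * of_real (2 * C) * of_real ((norm v)\<^sup>2)
      + 2 * of_real pi * (of_real (2 * S) * of_real (Y \<bullet> v) + (- \<i>) * of_real (q \<bullet> v))"
  let ?N = "(of_real (2 * S))\<^sup>2 * of_real ((norm Y)\<^sup>2) + 2 * of_real (2 * S) * (- \<i>) * of_real (Y \<bullet> q) + (- \<i>)\<^sup>2 * of_real ((norm q)\<^sup>2)"
  have split: "?I v = ?A * exp ?E * exp (?H v)" for v
  proof -
    have "?I v = ?A * exp (of_real (- (2 * pi * C) * ((norm (x, \<xi>))\<^sup>2 + (norm (u, v))\<^sup>2))
        + of_real (4 * pi * S * (phase_rotation (- \<beta>) (x, \<xi>) \<bullet> (u, v))) + \<i> * of_real (- 2 * pi * (q \<bullet> v)))"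
      unfolding hermite_wigner_kernel_def coth cis_conv_exp
      by (simp only: exp_add exp_of_real) (simp only: of_real_mult mult.assoc)
    also have "of_real (- (2 * pi * C) * ((norm (x, \<xi>))\<^sup>2 + (norm (u, v))\<^sup>2))
        + of_real (4 * pi * S * (phase_rotation (- \<beta>) (x, \<xi>) \<bullet> (u, v))) + \<i> * of_real (- 2 * pi * (q \<bullet> v)) = ?E + ?H v"
      unfolding power2_norm_eq_inner phase_rotation_def X_def Y_def
      by (simp add: complex_eq_iff algebra_simps)
    finally show ?thesis
      by (simp only: exp_add mult.assoc)
  qed
  have "(LINT v|lborel. ?I v) = ?A * exp ?E * (LINT v|lborel. exp (?H v))"
    unfolding split by (rule integral_mult_right_zero)
  also have "\<dots> = ?A * exp ?E * (?c * exp (of_real pi * ?N / of_real (2 * C)))"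
    using C by (subst gaussian_integral) auto
  also have "\<dots> = ?A * ?c * exp (?E + of_real pi * ?N / of_real (2 * C))"
    by (simp only: exp_add mult_ac)
  also have "?E + of_real pi * ?N / of_real (2 * C) = ?X"
  proof -
    have "?N = Complex (4 * S\<^sup>2 * (Y \<bullet> Y) - q \<bullet> q) (- 4 * S * (Y \<bullet> q))"
      unfolding power2_norm_eq_inner by (simp add: complex_eq_iff power2_eq_square)
    from this[unfolded power2_norm_eq_inner] show ?thesis
      unfolding power2_norm_eq_inner using C by (simp add: complex_eq_iff Re_divide_of_real Im_divide_of_real field_simps)
  qed
  finally show ?thesis .
qed

text \<open>
This is the heart of the formula for the kernel: both sides are Gaussians in \<open>(x, \<xi>, y, y')\<close>, whose
exponents agree by \<open>mehler_exponent_identity\<close>. Of the constant of the Mehler kernel only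
\<open>|\<kappa>|\<^sup>2 = |sinh \<zeta>|\<^sup>-\<^sup>d\<close> remains, so that the constants agree as well.
\<close>

lemma mehler_wigner_dual:
  fixes x \<xi> y y' :: "real^'n" and \<alpha> \<beta> :: real
  assumes \<alpha>: "\<alpha> > 0"
  defines "\<zeta> \<equiv> Complex \<alpha> \<beta>"
  shows "(LINT p|lborel. mehler_kernel \<zeta> (x + p /\<^sub>R 2) y * cnj (mehler_kernel \<zeta> (x - p /\<^sub>R 2) y') * cis (- 2 * pi * (p \<bullet> \<xi>))) =
    cross_wigner_dual (\<lambda>w. of_real (hermite_wigner_kernel \<alpha> \<beta> (x, \<xi>) w)) y y'" (is "?lhs = _")
proof -
  define u where "u = (y + y') /\<^sub>R 2"
  define q where "q = y - y'"
  have y: "y = u + q /\<^sub>R 2" "y' = u - q /\<^sub>R 2"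
    by (simp_all add: u_def q_def algebra_simps flip: scaleR_add_left)
  note h = complex_hyperbolic[OF \<alpha>, of \<beta>, folded \<zeta>_def]
  define c where "c = cosh \<zeta> / sinh \<zeta>"
  define s where "s = 1 / sinh \<zeta>"
  define \<kappa> where "\<kappa> = (gauss_const (tanh \<zeta>) / sqrt_cosh \<zeta>) ^ CARD('n)"
  define D where "D = (sinh \<alpha>)\<^sup>2 + (sin \<beta>)\<^sup>2"
  have sh: "sinh \<alpha> > 0" "cosh \<alpha> > 0" using \<alpha> by (auto simp: cosh_real_pos)
  have cs: "Re c = sinh \<alpha> * cosh \<alpha> / D" "Im c = - (sin \<beta> * cos \<beta> / D)"
    "Re s = sinh \<alpha> * cos \<beta> / D" "Im s = - (cosh \<alpha> * sin \<beta> / D)"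
    by (simp_all add: c_def s_def h(5,6) D_def)
  have D: "D > 0" using h(1) by (simp add: D_def)
  have c_pos: "Re c > 0" using D sh by (simp add: cs)
  let ?e = "\<lambda>a b. exp (- of_real pi * c * of_real ((norm a)\<^sup>2 + (norm b)\<^sup>2) + 2 * of_real pi * s * of_real (a \<bullet> b))"
  have "?lhs = (LINT p|lborel. (\<kappa> * cnj \<kappa>) * (?e (x + p /\<^sub>R 2) (u + q /\<^sub>R 2) * cnj (?e (x - p /\<^sub>R 2) (u - q /\<^sub>R 2)) * cis (- 2 * pi * (p \<bullet> \<xi>))))"
    unfolding mehler_kernel_def c_def[symmetric] s_def[symmetric] \<kappa>_def[symmetric] y complex_cnj_mult by (simp only: mult_ac)
  also have "\<dots> = (\<kappa> * cnj \<kappa>) * (LINT p|lborel. ?e (x + p /\<^sub>R 2) (u + q /\<^sub>R 2) * cnj (?e (x - p /\<^sub>R 2) (u - q /\<^sub>R 2)) * cis (- 2 * pi * (p \<bullet> \<xi>)))"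
    by (rule integral_mult_right_zero)
  finally have lhs: "?lhs = \<dots>" .
  have n: "(Im s *\<^sub>R u - Im c *\<^sub>R x - \<xi>) \<bullet> (Im s *\<^sub>R u - Im c *\<^sub>R x - \<xi>) =
      (Im s)\<^sup>2 * (u \<bullet> u) + (Im c)\<^sup>2 * (x \<bullet> x) + \<xi> \<bullet> \<xi> - 2 * Im s * Im c * (x \<bullet> u) - 2 * Im s * (u \<bullet> \<xi>) + 2 * Im c * (x \<bullet> \<xi>)"
    "q \<bullet> (Im s *\<^sub>R u - Im c *\<^sub>R x - \<xi>) = Im s * (u \<bullet> q) - Im c * (x \<bullet> q) - q \<bullet> \<xi>"
    "(cos \<beta> *\<^sub>R x - sin \<beta> *\<^sub>R \<xi>) \<bullet> u = cos \<beta> * (x \<bullet> u) - sin \<beta> * (u \<bullet> \<xi>)"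
    "(sin \<beta> *\<^sub>R x + cos \<beta> *\<^sub>R \<xi>) \<bullet> (sin \<beta> *\<^sub>R x + cos \<beta> *\<^sub>R \<xi>) =
      (sin \<beta>)\<^sup>2 * (x \<bullet> x) + 2 * sin \<beta> * cos \<beta> * (x \<bullet> \<xi>) + (cos \<beta>)\<^sup>2 * (\<xi> \<bullet> \<xi>)"
    "(sin \<beta> *\<^sub>R x + cos \<beta> *\<^sub>R \<xi>) \<bullet> q = sin \<beta> * (x \<bullet> q) + cos \<beta> * (q \<bullet> \<xi>)"
    by (simp_all add: inner_add_left inner_add_right inner_diff_left inner_diff_right algebra_simps power2_eq_square inner_commute)
  note id = mehler_exponent_identity[OF sh cosh_square_eq cos_squared_eq[of \<beta>], folded D_def, folded cs]
  \<comment> \<open>Both sides are the \<open>d\<close>-th power of \<open>(2 / sinh \<alpha>) (2 coth \<alpha>)\<^sup>-\<^sup>1\<^sup>/\<^sup>2\<close>, as \<open>|sinh \<zeta>|\<^sup>2 Re (coth \<zeta>) = sinh \<alpha> cosh \<alpha>\<close>.\<close>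
  have const: "\<kappa> * cnj \<kappa> * gauss_const (of_real (Re c / 2)) ^ CARD('n) =
      of_real ((2 / sinh \<alpha>) ^ CARD('n)) * gauss_const (of_real (2 * (cosh \<alpha> / sinh \<alpha>))) ^ CARD('n)"
  proof -
    let ?k = "norm (gauss_const (tanh \<zeta>) / sqrt_cosh \<zeta>)"
    have k: "?k\<^sup>2 = 1 / sqrt D"
      using norm_mehler_const[of \<zeta>] \<alpha> h(4) by (simp add: \<zeta>_def D_def real_sqrt_unique)
    have "\<kappa> * cnj \<kappa> = of_real ((?k\<^sup>2) ^ CARD('n))"
      unfolding complex_norm_square[symmetric] \<kappa>_def norm_power by (simp add: power_mult[symmetric] mult.commute)
    moreover have "?k\<^sup>2 * (1 / sqrt (Re c / 2)) = 2 / sinh \<alpha> * (1 / sqrt (2 * (cosh \<alpha> / sinh \<alpha>)))"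
    proof -
      have "?k\<^sup>2 * (1 / sqrt (Re c / 2)) = sqrt (1 / D * (1 / (Re c / 2)))"
        unfolding k real_sqrt_mult real_sqrt_divide by simp
      also have "1 / D * (1 / (Re c / 2)) = (2 / sinh \<alpha>)\<^sup>2 * (1 / (2 * (cosh \<alpha> / sinh \<alpha>)))"
        using D sh by (simp add: cs field_simps power2_eq_square)
      also have "sqrt \<dots> = 2 / sinh \<alpha> * (1 / sqrt (2 * (cosh \<alpha> / sinh \<alpha>)))"
        using sh unfolding real_sqrt_mult real_sqrt_divide by (simp add: real_sqrt_mult)
      finally show ?thesis .
    qed
    moreover have "gauss_const (of_real (Re c / 2)) = of_real (1 / sqrt (Re c / 2))"
      "gauss_const (of_real (2 * (cosh \<alpha> / sinh \<alpha>))) = of_real (1 / sqrt (2 * (cosh \<alpha> / sinh \<alpha>)))"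
      using c_pos sh by (intro gauss_const_of_real; simp)+
    ultimately show ?thesis
      by (simp only: of_real_power[symmetric] of_real_mult[symmetric] power_mult_distrib[symmetric])
  qed
  show ?thesis
    unfolding lhs wigner_mehler_exponential[OF c_pos] n id mult.assoc[of "\<kappa> * cnj \<kappa>", symmetric] const
      cross_wigner_dual_def u_def[symmetric] q_def[symmetric] fourier_hermite_wigner_kernel[OF \<alpha>] n ..
qed

section \<open>The propagator on phase space\<close>

text \<open>
After inserting the Mehler kernel twice, Fubini's theorem brings the integration over the difference
\<open>p\<close> to the inside. There it acts on the two kernels alone and produces the dual transform of the
Wigner kernel, which \<open>wigner_pairing\<close> moves back to \<open>f\<close> and \<open>g\<close>. For integrability in \<open>p\<close> the decay of
one of the two kernels is enough, the other one being bounded.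
\<close>

lemma cross_wigner_hermite_propagator:
  fixes f g :: "real^'n \<Rightarrow> complex" and \<alpha> \<beta> :: real
  assumes \<alpha>: "\<alpha> > 0" and f: "integrable lborel f" "\<And>x. norm (f x) \<le> B" and g: "integrable lborel g"
  defines "\<zeta> \<equiv> Complex \<alpha> \<beta>"
  shows "cross_wigner (hermite_propagator \<zeta> f) (hermite_propagator \<zeta> g) z =
    (LINT w|lborel. of_real (hermite_wigner_kernel \<alpha> \<beta> z w) * cross_wigner f g w)"
proof -
  obtain x \<xi> where z: "z = (x, \<xi>)" by (cases z)
  have \<zeta>: "Re \<zeta> > 0" using \<alpha> by (simp add: \<zeta>_def)
  have [measurable]: "f \<in> borel_measurable borel" "g \<in> borel_measurable borel"
    using f(1) g by (auto dest: borel_measurable_integrable)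
  let ?K = "mehler_kernel \<zeta>"
  obtain \<kappa> \<epsilon> where k: "\<kappa> \<ge> 0" "\<epsilon> > 0"
    "\<And>x y :: real^'n. norm (?K x y) \<le> \<kappa> * exp (- (\<epsilon> * (norm x)\<^sup>2))"
    using mehler_kernel_bound[OF \<zeta>, where 'n='n] by metis
  note intK = integrable_mehler_kernel_mult[OF \<zeta>]
  obtain A \<delta> where A: "A \<ge> 0" "\<delta> > 0"
    "\<And>z w :: (real^'n) \<times> (real^'n). 0 \<le> hermite_wigner_kernel \<alpha> \<beta> z w \<and> hermite_wigner_kernel \<alpha> \<beta> z w \<le> A * exp (- (\<delta> * (norm w)\<^sup>2))"
    using hermite_wigner_kernel_bound[OF \<alpha>, where 'n='n] by metis
  define J where "J p v = ?K (x + p /\<^sub>R 2) (fst v) * cnj (?K (x - p /\<^sub>R 2) (snd v)) * cis (- 2 * pi * (p \<bullet> \<xi>)) * (f (fst v) * cnj (g (snd v)))"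
    for p and v :: "(real^'n) \<times> (real^'n)"
  have J: "integrable lborel (\<lambda>(p, v). J p v)"
  proof -
    have fg: "integrable lborel (\<lambda>v. norm (f (fst v) * cnj (g (snd v))))"
      using integrable_tensor[OF f(1), of "\<lambda>y. cnj (g y)"] g by (intro integrable_norm) (simp add: case_prod_unfold)
    have "integrable lborel (\<lambda>p. exp (- (\<epsilon> * (norm (x + (1/2) *\<^sub>R p))\<^sup>2)))"
      by (subst lborel_integrable_affine[where f="\<lambda>p. exp (- (\<epsilon> * (norm p)\<^sup>2))"]) (simp_all add: integrable_gaussian_norm k)
    then have e: "integrable lborel (\<lambda>p. \<kappa> * \<kappa> * exp (- (\<epsilon> * (norm (x + p /\<^sub>R 2))\<^sup>2)))"
      by simp
    have le: "norm (J p v) \<le> (\<kappa> * \<kappa> * exp (- (\<epsilon> * (norm (x + p /\<^sub>R 2))\<^sup>2))) * norm (f (fst v) * cnj (g (snd v)))" for p v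
    proof -
      have "norm (?K (x - p /\<^sub>R 2) (snd v)) \<le> \<kappa>"
        by (rule order_trans[OF k(3)]) (use k(1,2) in \<open>simp add: mult_left_le\<close>)
      with k(3)[of "x + p /\<^sub>R 2" "fst v"]
      have "norm (?K (x + p /\<^sub>R 2) (fst v)) * norm (?K (x - p /\<^sub>R 2) (snd v)) \<le> \<kappa> * exp (- (\<epsilon> * (norm (x + p /\<^sub>R 2))\<^sup>2)) * \<kappa>"
        by (intro mult_mono) (use k(1) in auto)
      then have "norm (?K (x + p /\<^sub>R 2) (fst v)) * norm (?K (x - p /\<^sub>R 2) (snd v)) * norm (f (fst v) * cnj (g (snd v)))
          \<le> \<kappa> * exp (- (\<epsilon> * (norm (x + p /\<^sub>R 2))\<^sup>2)) * \<kappa> * norm (f (fst v) * cnj (g (snd v)))"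
        by (rule mult_right_mono) simp
      then show ?thesis
        by (simp add: J_def norm_mult mult_ac)
    qed
    show ?thesis
    proof (rule integrable_of_norm_le[OF integrable_tensor[OF e fg]])
      show "(\<lambda>(p, v). J p v) \<in> borel_measurable borel"
        unfolding J_def case_prod_unfold borel_prod[symmetric] by measurable
    qed (use le in auto)
  qed
  have "cross_wigner (hermite_propagator \<zeta> f) (hermite_propagator \<zeta> g) z = (LINT p|lborel. LINT v|lborel. J p v)"
    unfolding z cross_wigner_def prod.case
  proof (rule Bochner_Integration.integral_cong[OF refl])
    fix p :: "real^'n"
    let ?F = "\<lambda>y. ?K (x + p /\<^sub>R 2) y * f y" and ?G = "\<lambda>y. cnj (?K (x - p /\<^sub>R 2) y * g y)"
    have FG: "integrable lborel (\<lambda>(y, y'). ?F y * ?G y')"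
      by (intro integrable_tensor intK f) (simp add: intK g del: complex_cnj_mult)
    have "hermite_propagator \<zeta> f (x + p /\<^sub>R 2) * cnj (hermite_propagator \<zeta> g (x - p /\<^sub>R 2)) = (LINT y|lborel. ?F y) * (LINT y|lborel. ?G y)"
      by (simp add: hermite_propagator_eq_mehler[OF \<zeta>] f g del: complex_cnj_mult)
    also have "\<dots> = (LINT y|lborel. LINT y'|lborel. ?F y * ?G y')"
      by (simp only: integral_mult_right_zero integral_mult_left_zero)
    also have "\<dots> = (LINT v|lborel. ?F (fst v) * ?G (snd v))"
      using integral_lborel_fst[OF FG] by (simp only: prod.case case_prod_unfold fst_conv snd_conv)
    finally have prod: "hermite_propagator \<zeta> f (x + p /\<^sub>R 2) * cnj (hermite_propagator \<zeta> g (x - p /\<^sub>R 2)) =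
        (LINT v|lborel. ?F (fst v) * ?G (snd v))" .
    have "(LINT v|lborel. J p v) = (LINT v|lborel. ?F (fst v) * ?G (snd v) * cis (- 2 * pi * (p \<bullet> \<xi>)))"
      by (simp only: J_def complex_cnj_mult mult_ac)
    also have "\<dots> = (LINT v|lborel. ?F (fst v) * ?G (snd v)) * cis (- 2 * pi * (p \<bullet> \<xi>))"
      by (rule integral_mult_left_zero)
    finally show "hermite_propagator \<zeta> f (x + p /\<^sub>R 2) * cnj (hermite_propagator \<zeta> g (x - p /\<^sub>R 2)) * cis (- 2 * pi * (p \<bullet> \<xi>)) = (LINT v|lborel. J p v)"
      unfolding prod ..
  qed
  also have "\<dots> = (LINT v|lborel. LINT p|lborel. J p v)"
    using integral_lborel_swap[OF J] by (simp only: prod.case)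
  also have "\<dots> = (LINT v|lborel. (case v of (a, b) \<Rightarrow> f a * cnj (g b) * cross_wigner_dual (\<lambda>w. of_real (hermite_wigner_kernel \<alpha> \<beta> z w)) a b))"
  proof (rule Bochner_Integration.integral_cong[OF refl])
    fix v :: "(real^'n) \<times> (real^'n)"
    obtain a b where v: "v = (a, b)" by (cases v)
    have "(LINT p|lborel. J p v) = (LINT p|lborel. ?K (x + p /\<^sub>R 2) a * cnj (?K (x - p /\<^sub>R 2) b) * cis (- 2 * pi * (p \<bullet> \<xi>))) * (f a * cnj (g b))"
      unfolding J_def v fst_conv snd_conv by (rule integral_mult_left_zero)
    also have "\<dots> = cross_wigner_dual (\<lambda>w. of_real (hermite_wigner_kernel \<alpha> \<beta> z w)) a b * (f a * cnj (g b))"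
      unfolding \<zeta>_def mehler_wigner_dual[OF \<alpha>] z ..
    finally show "(LINT p|lborel. J p v) = (case v of (a, b) \<Rightarrow> f a * cnj (g b) * cross_wigner_dual (\<lambda>w. of_real (hermite_wigner_kernel \<alpha> \<beta> z w)) a b)"
      by (simp only: v prod.case mult.commute)
  qed
  also have "\<dots> = (LINT w|lborel. of_real (hermite_wigner_kernel \<alpha> \<beta> z w) * cross_wigner f g w)"
  proof (rule wigner_pairing(2)[OF f g, symmetric])
    show "integrable lborel (\<lambda>w. complex_of_real (hermite_wigner_kernel \<alpha> \<beta> z w))"
      by (rule integrable_of_norm_le[OF integrable_mult_right[OF integrable_gaussian_norm[OF A(2)], of A]])
        (use A(3) in auto)
    show "integrable lborel (\<lambda>\<upsilon>::real^'n. A * exp (- (\<delta> * (norm \<upsilon>)\<^sup>2)))"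
      by (intro integrable_mult_right integrable_gaussian_norm A)
    show "norm (complex_of_real (hermite_wigner_kernel \<alpha> \<beta> z (u, \<upsilon>))) \<le> A * exp (- (\<delta> * (norm \<upsilon>)\<^sup>2))" for u \<upsilon>
    proof -
      have "\<delta> * (norm \<upsilon>)\<^sup>2 \<le> \<delta> * (norm (u, \<upsilon>))\<^sup>2"
        using A(2) by (simp add: norm_Pair)
      then have "A * exp (- (\<delta> * (norm (u, \<upsilon>))\<^sup>2)) \<le> A * exp (- (\<delta> * (norm \<upsilon>)\<^sup>2))"
        using A(1) by (intro mult_left_mono) auto
      with A(3)[of z "(u, \<upsilon>)"] show ?thesis by simp
    qed
  qed
  finally show ?thesis .
qed

lemma hermite_wigner_identity:
  assumes \<alpha>: "\<alpha> > 0"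
  shows "wigner_identity (\<lambda>u :: real^'n \<Rightarrow> complex. distr_of_fun (hermite_propagator (Complex \<alpha> \<beta>) u))
    (distr_of_fun (\<lambda>(z, w). of_real (hermite_wigner_kernel \<alpha> \<beta> z w)))"
  unfolding wigner_identity_def
proof (intro ballI)
  fix f g :: "real^'n \<Rightarrow> complex" and \<Phi> :: "(real^'n) \<times> (real^'n) \<Rightarrow> complex"
  assume f: "f \<in> schwartz" and g: "g \<in> schwartz" and \<Phi>: "\<Phi> \<in> schwartz"
  let ?R = "hermite_propagator (Complex \<alpha> \<beta>)" and ?k = "\<lambda>z w. complex_of_real (hermite_wigner_kernel \<alpha> \<beta> z w)"
  have \<zeta>: "Re (Complex \<alpha> \<beta>) > 0" using \<alpha> by simp
  note fi = schwartz_integrable[OF f] and gi = schwartz_integrable[OF g]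
  note Ri = hermite_propagator_integrable[OF \<zeta>]
  note [measurable] = schwartz_measurable[OF f] schwartz_measurable[OF g] schwartz_measurable[OF \<Phi>]
  obtain B' where Rb: "\<And>x. norm (?R f x) \<le> B'"
    using hermite_propagator_bounded[OF \<zeta>, where 'n='n] fi by blast
  obtain B where B: "\<And>x. norm (f x) \<le> B"
    using schwartz_bounded[OF f] by metis
  obtain A \<delta> where A: "A \<ge> 0" "\<delta> > 0"
    "\<And>z w :: (real^'n) \<times> (real^'n). 0 \<le> hermite_wigner_kernel \<alpha> \<beta> z w \<and> hermite_wigner_kernel \<alpha> \<beta> z w \<le> A * exp (- (\<delta> * (norm w)\<^sup>2))"
    using hermite_wigner_kernel_bound[OF \<alpha>, where 'n='n] by metis
  define M where "M = B * (2 ^ CARD('n) * (LINT y|lborel. norm (g y)))"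
  have M: "norm (cross_wigner f g w) \<le> M" for w
    unfolding M_def by (rule cross_wigner_bounded[OF _ B gi]) measurable
  have int: "integrable lborel (\<lambda>(z, w). ?k z w * (\<Phi> z * cross_wigner f g w))"
  proof (rule integrable_of_norm_le)
    show "integrable lborel (\<lambda>(z, w :: (real^'n) \<times> (real^'n)). norm (\<Phi> z) * (A * M * exp (- (\<delta> * (norm w)\<^sup>2))))"
      by (intro integrable_tensor integrable_norm schwartz_integrable \<Phi> integrable_mult_right integrable_gaussian_norm A)
    show "(\<lambda>(z, w). ?k z w * (\<Phi> z * cross_wigner f g w)) \<in> borel_measurable borel"
      unfolding case_prod_unfold borel_prod[symmetric, where 'a="(real^'n) \<times> (real^'n)"] by measurable
    fix v :: "((real^'n) \<times> (real^'n)) \<times> ((real^'n) \<times> (real^'n))"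
    obtain z w where v: "v = (z, w)" by (cases v)
    have "norm (?k z w) * norm (cross_wigner f g w) \<le> (A * exp (- (\<delta> * (norm w)\<^sup>2))) * M"
      using A(1) A(3)[of z w] by (intro mult_mono M) auto
    from mult_left_mono[OF this norm_ge_zero[of "\<Phi> z"]]
    show "norm (case v of (z, w) \<Rightarrow> ?k z w * (\<Phi> z * cross_wigner f g w)) \<le>
        (case v of (z, w) \<Rightarrow> norm (\<Phi> z) * (A * M * exp (- (\<delta> * (norm w)\<^sup>2))))"
      by (simp only: v prod.case norm_mult) (simp add: mult_ac)
  qed
  have "cross_wigner_distr (distr_of_fun (?R f)) (distr_of_fun (?R g)) \<Phi> = (LINT z|lborel. \<Phi> z * cross_wigner (?R f) (?R g) z)"
    by (rule cross_wigner_distr_eq[OF Ri[OF fi] Rb Ri[OF gi] \<Phi>])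
  also have "\<dots> = (LINT z|lborel. LINT w|lborel. ?k z w * (\<Phi> z * cross_wigner f g w))"
    unfolding cross_wigner_hermite_propagator[OF \<alpha> fi B gi] integral_mult_right_zero[symmetric]
    by (simp only: mult_ac)
  also have "\<dots> = (LINT v|lborel. (case v of (z, w) \<Rightarrow> ?k z w * (\<Phi> z * cross_wigner f g w)))"
    using integral_lborel_fst[OF int] by (simp only: prod.case)
  finally show "cross_wigner_distr (distr_of_fun (?R f)) (distr_of_fun (?R g)) \<Phi> =
      distr_of_fun (\<lambda>(z, w). ?k z w) (\<lambda>(z, w). \<Phi> z * cross_wigner f g w)"
    by (simp only: distr_of_fun_def case_prod_unfold)
qed

lemma hermite_propagator_schwartz_operator:
  assumes \<zeta>: "Re \<zeta> > 0"
  shows "schwartz_operator (\<lambda>u :: real^'n \<Rightarrow> complex. distr_of_fun (hermite_propagator \<zeta> u))"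
proof -
  let ?R = "hermite_propagator \<zeta>"
  obtain \<kappa> where k: "\<kappa> \<ge> 0" and bound: "\<And>f (x :: real^'n). integrable lborel f \<Longrightarrow>
      norm (?R f x) \<le> \<kappa> * (LINT y|lborel. norm (f y))"
    using hermite_propagator_bounded[OF \<zeta>, where 'n='n] by blast
  note intK = integrable_mehler_kernel_mult[OF \<zeta>]
  define N where "N = (LINT x::real^'n|lborel. inverse ((1 + norm x) ^ (2 * DIM(real^'n))))"
  show ?thesis
    unfolding schwartz_operator_def
  proof (intro conjI ballI)
    show "tempered (distr_of_fun (?R f))" if "f \<in> schwartz" for f :: "real^'n \<Rightarrow> complex"
      by (rule tempered_of_bounded_function[OF hermite_propagator_measurable bound])
        (intro \<zeta> schwartz_integrable that)+
    fix \<phi> :: "real^'n \<Rightarrow> complex" assume \<phi>: "\<phi> \<in> schwartz"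
    have int: "integrable lborel (\<lambda>x. ?R f x * \<phi> x)" if "f \<in> schwartz" for f
      by (rule integrable_mult_bounded(2)[OF schwartz_integrable[OF \<phi>] hermite_propagator_measurable bound])
        (intro \<zeta> schwartz_integrable that)+
    have "linear_on_schwartz (\<lambda>f. distr_of_fun (?R f) \<phi>)"
      unfolding linear_on_schwartz_def
    proof (intro conjI ballI allI)
      fix f g :: "real^'n \<Rightarrow> complex" and c assume f: "f \<in> schwartz"
      note fi = schwartz_integrable[OF f]
      have "?R (\<lambda>x. c * f x) x = c * ?R f x" for x
        using fi by (simp add: hermite_propagator_eq_mehler[OF \<zeta>] mult.left_commute)
      then show "distr_of_fun (?R (\<lambda>x. c * f x)) \<phi> = c * distr_of_fun (?R f) \<phi>"
        by (simp add: distr_of_fun_def mult.assoc)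
      assume g: "g \<in> schwartz"
      note gi = schwartz_integrable[OF g]
      have "?R (\<lambda>x. f x + g x) x = ?R f x + ?R g x" for x
        using fi gi by (simp add: hermite_propagator_eq_mehler[OF \<zeta>] distrib_left intK)
      then show "distr_of_fun (?R (\<lambda>x. f x + g x)) \<phi> = distr_of_fun (?R f) \<phi> + distr_of_fun (?R g) \<phi>"
        using int[OF f] int[OF g] by (simp add: distr_of_fun_def distrib_right)
    qed
    moreover have "norm (distr_of_fun (?R f) \<phi>) \<le>
        (\<kappa> * N * (LINT x|lborel. norm (\<phi> x))) * schwartz_norm (2 * DIM(real^'n)) f" if f: "f \<in> schwartz" for f
    proof -
      note fi = schwartz_integrable[OF f]
      have "norm (distr_of_fun (?R f) \<phi>) \<le> (LINT x|lborel. norm (?R f x * \<phi> x))"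
        unfolding distr_of_fun_def by (rule integral_norm_bound)
      also have "\<dots> \<le> (LINT x|lborel. \<kappa> * (LINT y|lborel. norm (f y)) * norm (\<phi> x))"
        by (intro integral_mono integrable_norm int[OF f] integrable_mult_right schwartz_integrable[OF \<phi>])
          (auto simp: norm_mult intro!: mult_right_mono bound fi)
      also have "\<dots> = \<kappa> * (LINT y|lborel. norm (f y)) * (LINT x|lborel. norm (\<phi> x))"
        by (rule integral_mult_right_zero)
      also have "\<dots> \<le> \<kappa> * (N * schwartz_norm (2 * DIM(real^'n)) f) * (LINT x|lborel. norm (\<phi> x))"
        unfolding N_def using k by (intro mult_right_mono mult_left_mono schwartz_L1_le f) auto
      finally show ?thesis by (simp only: mult_ac)
    qed
    ultimately show "tempered (\<lambda>f. distr_of_fun (?R f) \<phi>)"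
      unfolding tempered_def by blast
  qed
qed

lemma hermite_wigner_kernel_tempered:
  assumes \<alpha>: "\<alpha> > 0"
  shows "tempered (distr_of_fun (\<lambda>(z, w :: (real^'n) \<times> (real^'n)). complex_of_real (hermite_wigner_kernel \<alpha> \<beta> z w)))"
proof -
  obtain A \<delta> where A: "A \<ge> 0" "\<delta> > 0"
    "\<And>z w :: (real^'n) \<times> (real^'n). 0 \<le> hermite_wigner_kernel \<alpha> \<beta> z w \<and> hermite_wigner_kernel \<alpha> \<beta> z w \<le> A * exp (- (\<delta> * (norm w)\<^sup>2))"
    using hermite_wigner_kernel_bound[OF \<alpha>, where 'n='n] by metis
  have "hermite_wigner_kernel \<alpha> \<beta> z w \<le> A" for z w :: "(real^'n) \<times> (real^'n)"
  proof -
    have "A * exp (- (\<delta> * (norm w)\<^sup>2)) \<le> A * 1"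
      using A by (intro mult_left_mono) auto
    with A(3)[of z w] show ?thesis by simp
  qed
  then show ?thesis
    using A(3) unfolding case_prod_unfold
    by (intro tempered_of_bounded_function[where B=A]) (auto simp: borel_prod[symmetric, where 'a="(real^'n) \<times> (real^'n)"])
qed

section \<open>Convergence in the Schwartz space\<close>

lemma linear_on_schwartz_add:
  assumes "linear_on_schwartz F" "f \<in> schwartz" "g \<in> schwartz"
  shows "F (\<lambda>x. f x + g x) = F f + F g"
  using assms by (simp add: linear_on_schwartz_def)

lemma linear_on_schwartz_cmult:
  assumes "linear_on_schwartz F" "f \<in> schwartz"
  shows "F (\<lambda>x. c * f x) = c * F f"
  using assms by (simp add: linear_on_schwartz_def)

lemma
  fixes f :: "'b \<Rightarrow> 'a::euclidean_space \<Rightarrow> complex"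
  assumes "finite A" "\<And>a. a \<in> A \<Longrightarrow> f a \<in> schwartz"
  shows schwartz_sum: "(\<lambda>x. \<Sum>a\<in>A. c a * f a x) \<in> schwartz"
    and iterated_deriv_sum: "set bs \<subseteq> Basis \<Longrightarrow>
      iterated_deriv bs (\<lambda>x. \<Sum>a\<in>A. c a * f a x) = (\<lambda>x. \<Sum>a\<in>A. c a * iterated_deriv bs (f a) x)"
    and linear_on_schwartz_sum: "linear_on_schwartz F \<Longrightarrow> F (\<lambda>x. \<Sum>a\<in>A. c a * f a x) = (\<Sum>a\<in>A. c a * F (f a))"
proof -
  have "(\<lambda>x. \<Sum>a\<in>A. c a * f a x) \<in> schwartz \<and>
      (set bs \<subseteq> Basis \<longrightarrow> iterated_deriv bs (\<lambda>x. \<Sum>a\<in>A. c a * f a x) = (\<lambda>x. \<Sum>a\<in>A. c a * iterated_deriv bs (f a) x)) \<and>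
      (linear_on_schwartz F \<longrightarrow> F (\<lambda>x. \<Sum>a\<in>A. c a * f a x) = (\<Sum>a\<in>A. c a * F (f a)))"
    using assms
  proof (induction A rule: finite_induct)
    case empty
    have jet: "(\<lambda>_::'a. 0) \<in> schwartz" "set bs \<subseteq> Basis \<longrightarrow> iterated_deriv bs (\<lambda>_::'a. 0) = (\<lambda>_. 0)"
    proof -
      have j: "iterated_deriv bs (\<lambda>_::'a. 0) = (\<lambda>_. 0)" if "set bs \<subseteq> Basis" for bs
        using iterated_deriv_jet[of "\<lambda>_ _. 0" "\<lambda>_. 0" bs] that by simp
      then show "set bs \<subseteq> Basis \<longrightarrow> iterated_deriv bs (\<lambda>_::'a. 0) = (\<lambda>_. 0)" by blast
      have "smooth (\<lambda>_::'a. 0)"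
        using smooth_jet[of "\<lambda>_ _. 0" "\<lambda>_. 0"] by simp
      then show "(\<lambda>_::'a. 0) \<in> schwartz"
        by (rule schwartzI) (auto simp: j intro!: exI[of _ 0])
    qed
    moreover have "F (\<lambda>_. 0) = 0" if F: "linear_on_schwartz F"
    proof -
      show ?thesis
        using linear_on_schwartz_cmult[OF F jet(1), of 0] by simp
    qed
    ultimately show ?case by simp
  next
    case (insert a A)
    note S = schwartz_cmult[of "f a" "c a"] and IH = insert.IH[OF insert.prems]
    have fa: "f a \<in> schwartz" using insert.prems by simp
    have "F (\<lambda>x. c a * f a x + (\<Sum>a\<in>A. c a * f a x)) = c a * F (f a) + F (\<lambda>x. \<Sum>a\<in>A. c a * f a x)"
      if "linear_on_schwartz F"
      using linear_on_schwartz_add[OF that S[OF fa]] linear_on_schwartz_cmult[OF that fa] IH by simp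
    with insert.hyps IH schwartz_add[OF S[OF fa]] iterated_deriv_add[OF S[OF fa]] iterated_deriv_cmult[OF fa, of bs "c a"] show ?case
      by simp
  qed
  then show "(\<lambda>x. \<Sum>a\<in>A. c a * f a x) \<in> schwartz"
    "set bs \<subseteq> Basis \<Longrightarrow> iterated_deriv bs (\<lambda>x. \<Sum>a\<in>A. c a * f a x) = (\<lambda>x. \<Sum>a\<in>A. c a * iterated_deriv bs (f a) x)"
    "linear_on_schwartz F \<Longrightarrow> F (\<lambda>x. \<Sum>a\<in>A. c a * f a x) = (\<Sum>a\<in>A. c a * F (f a))"
    by blast+
qed

text \<open>
The topology of the Schwartz space enters the proof of uniqueness only through this criterion.
\<close>

lemma tempered_tendsto:
  assumes F: "tempered F" and S: "\<And>i. f i \<in> schwartz" "g \<in> schwartz"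
    and conv: "\<And>m bs. set bs \<subseteq> Basis \<Longrightarrow> \<exists>e. e \<longlonglongrightarrow> 0 \<and>
      (\<forall>i x. (1 + norm x) ^ m * norm (iterated_deriv bs (f i) x - iterated_deriv bs g x) \<le> e i)"
  shows "(\<lambda>i. F (f i)) \<longlonglongrightarrow> F g"
proof -
  obtain C m where C: "\<And>h. h \<in> schwartz \<Longrightarrow> norm (F h) \<le> C * schwartz_norm m h"
    and lin: "linear_on_schwartz F"
    using F by (auto simp: tempered_def)
  obtain e where e: "\<And>bs. set bs \<subseteq> Basis \<Longrightarrow> e bs \<longlonglongrightarrow> 0"
    and le: "\<And>bs i x. set bs \<subseteq> Basis \<Longrightarrow> (1 + norm x) ^ m * norm (iterated_deriv bs (f i) x - iterated_deriv bs g x) \<le> e bs i"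
    using conv[of _ m] by metis
  have d: "(\<lambda>x. f i x - g x) \<in> schwartz" for i
    by (intro schwartz_diff S)
  have eq: "F (\<lambda>x. f i x - g x) = F (f i) - F g" for i
  proof -
    have "F (\<lambda>x. (f i x - g x) + g x) = F (\<lambda>x. f i x - g x) + F g"
      by (rule linear_on_schwartz_add[OF lin d S(2)])
    then show ?thesis by simp
  qed
  have bound: "norm (F (f i) - F g) \<le> \<bar>C\<bar> * (\<Sum>bs | set bs \<subseteq> Basis \<and> length bs \<le> m. e bs i)" for i
  proof -
    have "norm (F (f i) - F g) \<le> C * schwartz_norm m (\<lambda>x. f i x - g x)"
      using C[OF d[of i]] by (simp add: eq)
    also have "\<dots> \<le> \<bar>C\<bar> * schwartz_norm m (\<lambda>x. f i x - g x)"
    proof (intro mult_right_mono abs_ge_self)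
      show "0 \<le> schwartz_norm m (\<lambda>x. f i x - g x)"
        by (rule order_trans[OF _ schwartz_norm_bound[OF d[of i], of "[]" m 0]]) auto
    qed
    also have "\<dots> \<le> \<bar>C\<bar> * (\<Sum>bs | set bs \<subseteq> Basis \<and> length bs \<le> m. e bs i)"
      by (intro mult_left_mono schwartz_norm_le) (auto simp: iterated_deriv_diff[OF S(1) S(2)] le)
    finally show ?thesis .
  qed
  have "(\<lambda>i. \<bar>C\<bar> * (\<Sum>bs | set bs \<subseteq> Basis \<and> length bs \<le> m. e bs i)) \<longlonglongrightarrow> \<bar>C\<bar> * (\<Sum>bs | set bs \<subseteq> (Basis::'a set) \<and> length bs \<le> m. 0)"
    by (intro tendsto_mult_left tendsto_sum e) auto
  then have lim: "(\<lambda>i. \<bar>C\<bar> * (\<Sum>bs | set bs \<subseteq> (Basis::'a set) \<and> length bs \<le> m. e bs i)) \<longlonglongrightarrow> 0"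
    by simp
  have "(\<lambda>i. F (f i) - F g) \<longlonglongrightarrow> 0"
    by (rule Lim_null_comparison[OF _ lim]) (intro always_eventually allI bound)
  then show ?thesis
    by (simp add: LIM_zero_iff)
qed

section \<open>Superpositions of Schwartz functions\<close>

text \<open>
Families of Schwartz functions that are Lipschitz in the parameter with respect to every seminorm, with
a constant of polynomial growth. This single condition yields polynomial bounds and measurability in the parameter
and allows one to replace the parameter by nearby values, which is how integrals over the parameter
are approximated by finite sums.
\<close>

definition lipschitz_family :: "('u::euclidean_space \<Rightarrow> 'v::euclidean_space \<Rightarrow> complex) \<Rightarrow> bool" where
  "lipschitz_family h \<longleftrightarrow> (\<forall>u. h u \<in> schwartz) \<and>
     (\<forall>m bs. set bs \<subseteq> Basis \<longrightarrow> (\<exists>C k. C \<ge> 0 \<and> (\<forall>u u' v.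
        (1 + norm v) ^ m * norm (iterated_deriv bs (h u) v - iterated_deriv bs (h u') v)
          \<le> C * (1 + norm u + norm u') ^ k * norm (u - u'))))"

definition rapidly_decreasing :: "('u::euclidean_space \<Rightarrow> complex) \<Rightarrow> bool" where
  "rapidly_decreasing w \<longleftrightarrow> w \<in> borel_measurable borel \<and>
     (\<forall>k. integrable lborel (\<lambda>u. (1 + norm u) ^ k * norm (w u)))"

definition superposition :: "('u::euclidean_space \<Rightarrow> complex) \<Rightarrow> ('u \<Rightarrow> 'v \<Rightarrow> complex) \<Rightarrow> 'v \<Rightarrow> complex" where
  "superposition w h v = (LINT u|lborel. w u * h u v)"

lemma rapidly_decreasing_gaussian:
  fixes A :: real
  assumes "A > 0"
  shows "rapidly_decreasing (\<lambda>u::'a::euclidean_space. of_real (exp (- (A * (norm u)\<^sup>2))))"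
  unfolding rapidly_decreasing_def
  using integrable_polynomial_times_gaussian[OF assms, where B=0 and 'a='a] by simp

text \<open>
Compare the parameter \<open>u\<close> with \<open>0\<close>.
\<close>

lemma lipschitz_family_bound:
  assumes h: "lipschitz_family h" and bs: "set bs \<subseteq> Basis"
  obtains C k where "C \<ge> 0" "\<And>u v. (1 + norm v) ^ m * norm (iterated_deriv bs (h u) v) \<le> C * (1 + norm u) ^ k"
proof -
  obtain C k where C: "C \<ge> 0" "\<And>u u' v. (1 + norm v) ^ m * norm (iterated_deriv bs (h u) v - iterated_deriv bs (h u') v)
      \<le> C * (1 + norm u + norm u') ^ k * norm (u - u')"
    using h bs unfolding lipschitz_family_def by meson
  have "h 0 \<in> schwartz" using h by (auto simp: lipschitz_family_def)
  then obtain C\<^sub>0 where C0: "C\<^sub>0 \<ge> 0" "\<And>v. (1 + norm v) ^ m * norm (iterated_deriv bs (h 0) v) \<le> C\<^sub>0"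
    using schwartz_decay[OF _ bs] by metis
  have "(1 + norm v) ^ m * norm (iterated_deriv bs (h u) v) \<le> (C\<^sub>0 + C) * (1 + norm u) ^ Suc k" for u v
  proof -
    have "norm (iterated_deriv bs (h u) v) \<le> norm (iterated_deriv bs (h 0) v) + norm (iterated_deriv bs (h u) v - iterated_deriv bs (h 0) v)"
      using norm_triangle_ineq[of "iterated_deriv bs (h 0) v" "iterated_deriv bs (h u) v - iterated_deriv bs (h 0) v"] by simp
    then have "(1 + norm v) ^ m * norm (iterated_deriv bs (h u) v) \<le> (1 + norm v) ^ m * (norm (iterated_deriv bs (h 0) v) + norm (iterated_deriv bs (h u) v - iterated_deriv bs (h 0) v))"
      by (rule mult_left_mono) simp
    also have "\<dots> \<le> C\<^sub>0 + C * (1 + norm u) ^ k * norm u"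
      using C0(2)[of v] C(2)[of v u 0] by (simp add: distrib_left)
    also have "\<dots> \<le> C\<^sub>0 * (1 + norm u) ^ Suc k + C * ((1 + norm u) ^ k * (1 + norm u))"
    proof (rule add_mono)
      show "C\<^sub>0 \<le> C\<^sub>0 * (1 + norm u) ^ Suc k"
        using mult_left_mono[OF one_le_power[of "1 + norm u" "Suc k"] C0(1)] by simp
      show "C * (1 + norm u) ^ k * norm u \<le> C * ((1 + norm u) ^ k * (1 + norm u))"
        unfolding mult.assoc using C(1) by (intro mult_left_mono) auto
    qed
    finally show ?thesis by (simp add: algebra_simps)
  qed
  with C(1) C0(1) show ?thesis
    by (intro that[of "C\<^sub>0 + C" "Suc k"]) auto
qed

lemma lipschitz_family_measurable:
  assumes h: "lipschitz_family h" and bs: "set bs \<subseteq> Basis"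
  shows "(\<lambda>u. iterated_deriv bs (h u) v) \<in> borel_measurable borel"
proof -
  obtain C k where C: "C \<ge> 0" "\<And>u u' v. (1 + norm v) ^ 0 * norm (iterated_deriv bs (h u) v - iterated_deriv bs (h u') v)
      \<le> C * (1 + norm u + norm u') ^ k * norm (u - u')"
    using h bs unfolding lipschitz_family_def by meson
  have "isCont (\<lambda>u. iterated_deriv bs (h u) v) u\<^sub>0" for u\<^sub>0
    unfolding isCont_def
  proof (rule LIM_zero_cancel, rule Lim_null_comparison)
    show "\<forall>\<^sub>F u in at u\<^sub>0. norm (iterated_deriv bs (h u) v - iterated_deriv bs (h u\<^sub>0) v) \<le> C * (1 + norm u + norm u\<^sub>0) ^ k * norm (u - u\<^sub>0)"
      using C(2)[of v _ u\<^sub>0] by (intro always_eventually) simp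
    have "((\<lambda>u. C * (1 + norm u + norm u\<^sub>0) ^ k * norm (u - u\<^sub>0)) \<longlongrightarrow> C * (1 + norm u\<^sub>0 + norm u\<^sub>0) ^ k * norm (u\<^sub>0 - u\<^sub>0)) (at u\<^sub>0)"
      by (intro tendsto_intros)
    then show "((\<lambda>u. C * (1 + norm u + norm u\<^sub>0) ^ k * norm (u - u\<^sub>0)) \<longlongrightarrow> 0) (at u\<^sub>0)"
      by simp
  qed
  then show ?thesis
    by (intro borel_measurable_continuous_onI continuous_at_imp_continuous_on) auto
qed

lemma superposition_integrable:
  assumes h: "lipschitz_family h" and w: "rapidly_decreasing w" and bs: "set bs \<subseteq> Basis"
  shows "integrable lborel (\<lambda>u. w u * iterated_deriv bs (h u) v)"
proof -
  obtain C k where C: "C \<ge> 0" "\<And>u v. (1 + norm v) ^ 0 * norm (iterated_deriv bs (h u) v) \<le> C * (1 + norm u) ^ k"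
    using lipschitz_family_bound[OF h bs] by metis
  show ?thesis
  proof (rule integrable_of_norm_le)
    show "integrable lborel (\<lambda>u. C * ((1 + norm u) ^ k * norm (w u)))"
      using w by (simp add: rapidly_decreasing_def)
    show "(\<lambda>u. w u * iterated_deriv bs (h u) v) \<in> borel_measurable borel"
      using w lipschitz_family_measurable[OF h bs] by (auto simp: rapidly_decreasing_def)
    show "norm (w u * iterated_deriv bs (h u) v) \<le> C * ((1 + norm u) ^ k * norm (w u))" for u
      using mult_left_mono[OF C(2)[of v u] norm_ge_zero[of "w u"]] by (simp add: norm_mult mult_ac)
  qed
qed

text \<open>
The integrals of the derivatives form a jet, by differentiation under the integral sign; the
polynomial growth in the parameter is compensated by the weight.
\<close>

lemma
  assumes h: "lipschitz_family h" and w: "rapidly_decreasing w"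
  shows superposition_schwartz: "superposition w h \<in> schwartz"
    and iterated_deriv_superposition: "set bs \<subseteq> Basis \<Longrightarrow>
      iterated_deriv bs (superposition w h) = (\<lambda>v. LINT u|lborel. w u * iterated_deriv bs (h u) v)"
proof -
  let ?J = "\<lambda>bs v. LINT u|lborel. w u * iterated_deriv bs (h u) v"
  have hS: "h u \<in> schwartz" for u using h by (auto simp: lipschitz_family_def)
  have J: "(?J bs has_derivative (\<lambda>y. \<Sum>b\<in>Basis. (y \<bullet> b) *\<^sub>R ?J (b # bs) v)) (at v)" if bs: "set bs \<subseteq> Basis" for bs v
  proof -
    have bsb: "set (b # bs) \<subseteq> Basis" if "b \<in> Basis" for b using bs that by simp
    have "\<exists>C k. C \<ge> 0 \<and> (\<forall>u v. norm (iterated_deriv (b # bs) (h u) v) \<le> C * (1 + norm u) ^ k)" if "b \<in> Basis" for b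
      using lipschitz_family_bound[OF h bsb[OF that], where m=0] by (metis mult_1 power_0)
    then obtain C k where C: "\<And>b. b \<in> Basis \<Longrightarrow> C b \<ge> 0"
      "\<And>b u v. b \<in> Basis \<Longrightarrow> norm (iterated_deriv (b # bs) (h u) v) \<le> C b * (1 + norm u) ^ k b"
      by metis
    let ?f' = "\<lambda>v u y. w u * (\<Sum>b\<in>Basis. (y \<bullet> b) *\<^sub>R iterated_deriv (b # bs) (h u) v)"
    let ?B = "\<lambda>u. \<Sum>b\<in>Basis. C b * ((1 + norm u) ^ k b * norm (w u))"
    have f': "?f' v u y = (\<Sum>b\<in>Basis. (y \<bullet> b) *\<^sub>R (w u * iterated_deriv (b # bs) (h u) v))" for v u y
      by (simp add: sum_distrib_left)
    have "((\<lambda>v. LINT u|lborel. w u * iterated_deriv bs (h u) v) has_derivative (\<lambda>y. LINT u|lborel. ?f' v u y)) (at v)"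
    proof (rule has_derivative_integral_dominated[where S=UNIV and B="?B"])
      show "integrable lborel (\<lambda>u. w u * iterated_deriv bs (h u) v)" for v
        by (rule superposition_integrable[OF h w bs])
      show "((\<lambda>v. w u * iterated_deriv bs (h u) v) has_derivative ?f' v u) (at v)" for v u
        by (intro has_derivative_mult_right iterated_deriv_has_derivative schwartz_smooth hS bs)
      show "(\<lambda>u. ?f' v u y) \<in> borel_measurable lborel" for y
        unfolding f'
        by (intro borel_measurable_sum borel_measurable_scaleR borel_measurable_const borel_measurable_integrable
            superposition_integrable[OF h w bsb])
      show "integrable lborel ?B"
        using w by (intro Bochner_Integration.integrable_sum integrable_mult_right) (auto simp: rapidly_decreasing_def)
      show "0 \<le> ?B u" for u
        using C(1) by (intro sum_nonneg mult_nonneg_nonneg) auto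
      show "norm (?f' v u y) \<le> ?B u * norm y" for v u y
      proof -
        have "norm (?f' v u y) \<le> (\<Sum>b\<in>Basis. norm ((y \<bullet> b) *\<^sub>R (w u * iterated_deriv (b # bs) (h u) v)))"
          unfolding f' by (rule norm_sum)
        also have "\<dots> \<le> (\<Sum>b\<in>Basis. norm y * (norm (w u) * (C b * (1 + norm u) ^ k b)))"
          unfolding norm_scaleR norm_mult real_norm_def
          by (intro sum_mono mult_mono Basis_le_norm order_refl C(2)) auto
        also have "\<dots> = ?B u * norm y"
          by (simp add: sum_distrib_left mult_ac)
        finally show ?thesis .
      qed
    qed auto
    moreover have "(LINT u|lborel. ?f' v u y) = (\<Sum>b\<in>Basis. (y \<bullet> b) *\<^sub>R ?J (b # bs) v)" for y
      unfolding f' using superposition_integrable[OF h w bsb]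
      by (subst Bochner_Integration.integral_sum) (auto intro!: sum.cong)
    ultimately show ?thesis by simp
  qed
  have J0: "?J [] = superposition w h"
    by (simp add: superposition_def fun_eq_iff)
  show eq: "iterated_deriv bs (superposition w h) = ?J bs" if "set bs \<subseteq> Basis" for bs
    by (rule iterated_deriv_jet[of ?J, OF J0 J that])
  show "superposition w h \<in> schwartz"
  proof (rule schwartzI)
    show "smooth (superposition w h)"
      by (rule smooth_jet[of ?J, OF J0 J])
    fix m and bs :: "'b list" assume bs: "set bs \<subseteq> Basis"
    obtain C k where C: "C \<ge> 0" "\<And>u v. (1 + norm v) ^ m * norm (iterated_deriv bs (h u) v) \<le> C * (1 + norm u) ^ k"
      using lipschitz_family_bound[OF h bs] by metis
    have "(1 + norm v) ^ m * norm (?J bs v) \<le> C * (LINT u|lborel. (1 + norm u) ^ k * norm (w u))" for v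
    proof -
      have "(1 + norm v) ^ m * norm (?J bs v) \<le> (1 + norm v) ^ m * (LINT u|lborel. norm (w u * iterated_deriv bs (h u) v))"
        by (intro mult_left_mono integral_norm_bound) auto
      also have "\<dots> = (LINT u|lborel. (1 + norm v) ^ m * norm (w u * iterated_deriv bs (h u) v))"
        by simp
      also have "\<dots> \<le> (LINT u|lborel. C * ((1 + norm u) ^ k * norm (w u)))"
      proof (rule integral_mono)
        show "integrable lborel (\<lambda>u. (1 + norm v) ^ m * norm (w u * iterated_deriv bs (h u) v))"
          by (intro integrable_mult_right integrable_norm superposition_integrable h w bs)
        show "integrable lborel (\<lambda>u. C * ((1 + norm u) ^ k * norm (w u)))"
          using w by (simp add: rapidly_decreasing_def)
        show "(1 + norm v) ^ m * norm (w u * iterated_deriv bs (h u) v) \<le> C * ((1 + norm u) ^ k * norm (w u))" for u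
          using mult_left_mono[OF C(2)[of v u] norm_ge_zero[of "w u"]] by (simp add: norm_mult mult_ac)
      qed
      finally show ?thesis by simp
    qed
    then show "\<exists>C. \<forall>v. (1 + norm v) ^ m * norm (iterated_deriv bs (superposition w h) v) \<le> C"
      unfolding eq[OF bs] by blast
  qed
qed

text \<open>
A linear functional need not commute with an integral, so the integral is replaced by finite sums:
with simple functions \<open>s\<^sub>i\<close> that converge to the identity, the integral of \<open>w(u) h(s\<^sub>i(u))\<close> is a finite
linear combination of members of the family, on which the functionals agree. By the Lipschitz
condition and dominated convergence, these sums converge to the superposition in every seminorm.
\<close>

lemma tempered_superposition_unique:
  assumes h: "lipschitz_family h" and w: "rapidly_decreasing w"
    and F: "tempered F" and G: "tempered G" and eq: "\<And>u. F (h u) = G (h u)"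
  shows "F (superposition w h) = G (superposition w h)"
proof -
  have hS: "h u \<in> schwartz" for u using h by (auto simp: lipschitz_family_def)
  have [measurable]: "w \<in> borel_measurable borel" and wk: "integrable lborel (\<lambda>u. (1 + norm u) ^ k * norm (w u))" for k
    using w by (auto simp: rapidly_decreasing_def)
  obtain s :: "nat \<Rightarrow> 'a \<Rightarrow> 'a" where s: "\<And>i. simple_function borel (s i)" "\<And>u. (\<lambda>i. s i u) \<longlonglongrightarrow> u" "\<And>i u. norm (s i u) \<le> 2 * norm u"
    using borel_measurable_implies_sequence_metric[of "\<lambda>u::'a. u" borel 0] by auto
  have fin: "finite (range (s i))" for i
    using simple_functionD(1)[OF s(1)[of i]] by simp
  have [measurable]: "s i \<in> borel \<rightarrow>\<^sub>M borel" for i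
    using s(1) by (rule borel_measurable_simple_function)
  \<comment> \<open>\<open>\<Phi> i\<close> is the superposition with the parameter rounded by \<open>s i\<close>.\<close>
  define c where "c i p = (LINT u|lborel. indicator (s i -` {p}) u * w u)" for i p
  define \<Phi> where "\<Phi> i v = (\<Sum>p\<in>range (s i). c i p * h p v)" for i v
  have \<Phi>S: "\<Phi> i \<in> schwartz" for i
    unfolding \<Phi>_def[abs_def] by (rule schwartz_sum[OF fin hS])
  have wi: "integrable lborel (\<lambda>u. indicator (s i -` {p}) u * w u :: complex)" for i p
  proof -
    have [measurable]: "s i -` {p} \<in> sets borel"
      using measurable_sets_borel[of "s i" borel "{p}"] by simp
    have "integrable lborel (\<lambda>u. norm (w u))"
      using wk[of 0] by simp
    then show ?thesis
      by (rule integrable_of_norm_le) (auto simp: norm_mult indicator_def)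
  qed
  have \<Phi>d: "iterated_deriv bs (\<Phi> i) v = (LINT u|lborel. w u * iterated_deriv bs (h (s i u)) v)" if bs: "set bs \<subseteq> Basis" for bs i v
  proof -
    have "iterated_deriv bs (\<Phi> i) v = (\<Sum>p\<in>range (s i). c i p * iterated_deriv bs (h p) v)"
      unfolding \<Phi>_def[abs_def] by (simp add: iterated_deriv_sum[OF fin hS bs])
    also have "\<dots> = (\<Sum>p\<in>range (s i). LINT u|lborel. (indicator (s i -` {p}) u * w u) * iterated_deriv bs (h p) v)"
      unfolding c_def by (simp only: integral_mult_left_zero)
    also have "\<dots> = (LINT u|lborel. (\<Sum>p\<in>range (s i). (indicator (s i -` {p}) u * w u) * iterated_deriv bs (h p) v))"
      by (rule Bochner_Integration.integral_sum[symmetric]) (intro integrable_mult_left wi)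
    also have "\<dots> = (LINT u|lborel. w u * iterated_deriv bs (h (s i u)) v)"
    proof (rule Bochner_Integration.integral_cong[OF refl])
      fix u
      have "(\<Sum>p\<in>range (s i). (indicator (s i -` {p}) u * w u) * iterated_deriv bs (h p) v) =
          (\<Sum>p\<in>range (s i). if s i u = p then w u * iterated_deriv bs (h p) v else 0)"
        by (rule sum.cong) (auto simp: indicator_def)
      then show "(\<Sum>p\<in>range (s i). (indicator (s i -` {p}) u * w u) * iterated_deriv bs (h p) v) = w u * iterated_deriv bs (h (s i u)) v"
        using fin by (simp add: sum.delta)
    qed
    finally show ?thesis .
  qed
  have conv: "\<exists>e. e \<longlonglongrightarrow> 0 \<and> (\<forall>i v. (1 + norm v) ^ m * norm (iterated_deriv bs (\<Phi> i) v - iterated_deriv bs (superposition w h) v) \<le> e i)"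
    if bs: "set bs \<subseteq> Basis" for m bs
  proof -
    obtain C k where C: "C \<ge> 0" "\<And>u u' v. (1 + norm v) ^ m * norm (iterated_deriv bs (h u) v - iterated_deriv bs (h u') v)
        \<le> C * (1 + norm u + norm u') ^ k * norm (u - u')"
      using h bs unfolding lipschitz_family_def by meson
    let ?D = "\<lambda>i u. C * (1 + norm (s i u) + norm u) ^ k * norm (s i u - u) * norm (w u)"
    let ?W = "\<lambda>u. C * (3 ^ Suc k * ((1 + norm u) ^ Suc k * norm (w u)))"
    have W: "integrable lborel ?W"
      by (intro integrable_mult_right wk)
    have DW: "?D i u \<le> ?W u" for i u
    proof -
      have "norm (s i u - u) \<le> 2 * norm u + norm u"
        by (rule order_trans[OF norm_triangle_ineq4 add_right_mono[OF s(3)]])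
      also have "\<dots> \<le> 3 * (1 + norm u)"
        by simp
      finally have 1: "norm (s i u - u) \<le> 3 * (1 + norm u)" .
      have "1 + norm (s i u) + norm u \<le> 1 + 2 * norm u + norm u"
        by (intro add_mono order_refl s(3))
      also have "\<dots> \<le> 3 * (1 + norm u)"
        by simp
      finally have "1 + norm (s i u) + norm u \<le> 3 * (1 + norm u)" .
      then have "(1 + norm (s i u) + norm u) ^ k \<le> (3 * (1 + norm u)) ^ k"
        by (rule power_mono) simp
      then have "(1 + norm (s i u) + norm u) ^ k * norm (s i u - u) \<le> (3 * (1 + norm u)) ^ k * (3 * (1 + norm u))"
        using 1 by (rule mult_mono) auto
      then have "C * ((1 + norm (s i u) + norm u) ^ k * norm (s i u - u)) * norm (w u) \<le> C * ((3 * (1 + norm u)) ^ k * (3 * (1 + norm u))) * norm (w u)"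
        using C(1) by (intro mult_right_mono mult_left_mono) auto
      then show ?thesis by (simp only: power_mult_distrib power_Suc mult_ac)
    qed
    have D0: "0 \<le> ?D i u" for i u
      using C(1) by simp
    have Di: "integrable lborel (?D i)" for i
      by (rule Bochner_Integration.integrable_bound[OF W]) (use DW D0 in \<open>auto intro!: AE_I2 order_trans[OF _ abs_ge_self]\<close>)
    have "(\<lambda>i. LINT u|lborel. ?D i u) \<longlonglongrightarrow> (LINT u::'a|lborel. 0)"
    proof (rule integral_dominated_convergence[OF _ _ W])
      show "AE u in lborel. (\<lambda>i. ?D i u) \<longlonglongrightarrow> 0"
      proof (rule AE_I2)
        fix u
        have "(\<lambda>i. ?D i u) \<longlonglongrightarrow> C * (1 + norm u + norm u) ^ k * norm (u - u) * norm (w u)"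
          by (intro tendsto_intros s(2))
        then show "(\<lambda>i. ?D i u) \<longlonglongrightarrow> 0" by simp
      qed
      show "AE u in lborel. norm (?D i u) \<le> ?W u" for i
        using DW D0 by (intro AE_I2) (simp only: real_norm_def abs_of_nonneg)
    qed measurable
    moreover have "(1 + norm v) ^ m * norm (iterated_deriv bs (\<Phi> i) v - iterated_deriv bs (superposition w h) v) \<le> (LINT u|lborel. ?D i u)" for i v
    proof -
      let ?d = "\<lambda>u. w u * (iterated_deriv bs (h (s i u)) v - iterated_deriv bs (h u) v)"
      have [measurable]: "(\<lambda>u. iterated_deriv bs (h u) v) \<in> borel_measurable borel"
        by (rule lipschitz_family_measurable[OF h bs])
      have hs [measurable]: "(\<lambda>u. iterated_deriv bs (h (s i u)) v) \<in> borel_measurable borel"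
        using measurable_compose[of "s i" borel borel "\<lambda>u. iterated_deriv bs (h u) v" borel] by simp
      have dle: "(1 + norm v) ^ m * norm (?d u) \<le> ?D i u" for u
        using mult_left_mono[OF C(2)[of v "s i u" u] norm_ge_zero[of "w u"]] by (simp add: norm_mult mult_ac)
      have one: "1 \<le> (1 + norm v) ^ m" by simp
      have "norm (?d u) \<le> ?D i u" for u
        using mult_right_mono[OF one norm_ge_zero[of "?d u"]] dle[of u] by linarith
      then have int: "integrable lborel ?d"
        by (intro integrable_of_norm_le[OF Di[of i]]) measurable
      have int2: "integrable lborel (\<lambda>u. w u * iterated_deriv bs (h u) v)"
        by (rule superposition_integrable[OF h w bs])
      have "integrable lborel (\<lambda>u. ?d u + w u * iterated_deriv bs (h u) v)"
        by (intro Bochner_Integration.integrable_add int int2)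
      then have int1: "integrable lborel (\<lambda>u. w u * iterated_deriv bs (h (s i u)) v)"
        by (simp add: algebra_simps)
      have "iterated_deriv bs (\<Phi> i) v - iterated_deriv bs (superposition w h) v = (LINT u|lborel. ?d u)"
        unfolding \<Phi>d[OF bs] iterated_deriv_superposition[OF h w bs] right_diff_distrib
        by (rule Bochner_Integration.integral_diff[OF int1 int2, symmetric])
      then have "(1 + norm v) ^ m * norm (iterated_deriv bs (\<Phi> i) v - iterated_deriv bs (superposition w h) v) \<le>
          (1 + norm v) ^ m * (LINT u|lborel. norm (?d u))"
        by (simp add: mult_left_mono integral_norm_bound)
      also have "\<dots> = (LINT u|lborel. (1 + norm v) ^ m * norm (?d u))"
        by (rule integral_mult_right_zero[symmetric])
      also have "\<dots> \<le> (LINT u|lborel. ?D i u)"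
        by (intro integral_mono integrable_mult_right integrable_norm int Di dle)
      finally show ?thesis .
    qed
    ultimately show ?thesis
      by (intro exI[of _ "\<lambda>i. LINT u|lborel. ?D i u"]) simp
  qed
  have sS: "superposition w h \<in> schwartz"
    by (rule superposition_schwartz[OF h w])
  have lin: "linear_on_schwartz F" "linear_on_schwartz G"
    using F G by (auto simp: tempered_def)
  have FG: "F (\<Phi> i) = G (\<Phi> i)" for i
    unfolding \<Phi>_def[abs_def] linear_on_schwartz_sum[OF fin hS lin(1)] linear_on_schwartz_sum[OF fin hS lin(2)] eq ..
  have limF: "(\<lambda>i. F (\<Phi> i)) \<longlonglongrightarrow> F (superposition w h)"
    by (rule tempered_tendsto[OF F \<Phi>S sS conv])
  have limG: "(\<lambda>i. G (\<Phi> i)) \<longlonglongrightarrow> G (superposition w h)"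
    by (rule tempered_tendsto[OF G \<Phi>S sS conv])
  show ?thesis
    using limF unfolding FG by (rule LIMSEQ_unique[OF _ limG])
qed

section \<open>Regularisation by Gaussians\<close>

text \<open>
The mean value inequality with a weight \<open>W\<close>, from bounds on the partial derivatives. In the
applications \<open>W\<close> is a power of \<open>1 + |v|\<close> at a point \<open>v\<close> that does not move along the segment.
\<close>

lemma partial_derivatives_lipschitz:
  fixes g :: "'a::euclidean_space \<Rightarrow> complex"
  assumes S: "convex S" "x \<in> S" "y \<in> S" and W: "W > 0"
    and d: "\<And>q. q \<in> S \<Longrightarrow> (g has_derivative D q) (at q)"
    and K: "\<And>q c. q \<in> S \<Longrightarrow> c \<in> Basis \<Longrightarrow> W * norm (D q c) \<le> K c"
  shows "W * norm (g x - g y) \<le> (\<Sum>c\<in>Basis. K c) * norm (x - y)"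
proof -
  have K0: "0 \<le> K c" if "c \<in> Basis" for c
    using W by (intro order_trans[OF _ K[OF S(2) that]]) simp
  have le: "norm (D q h) \<le> (\<Sum>c\<in>Basis. K c) / W * norm h" if q: "q \<in> S" for q h
  proof -
    have lin: "linear (D q)"
      using d[OF q] has_derivative_linear by blast
    have "D q (\<Sum>c\<in>Basis. (h \<bullet> c) *\<^sub>R c) = (\<Sum>c\<in>Basis. (h \<bullet> c) *\<^sub>R D q c)"
      unfolding linear_sum[OF lin] linear_scale[OF lin] ..
    then have "norm (D q h) \<le> (\<Sum>c\<in>Basis. norm ((h \<bullet> c) *\<^sub>R D q c))"
      by (simp only: euclidean_representation norm_sum)
    also have "\<dots> \<le> (\<Sum>c\<in>Basis. norm h * (K c / W))"
      unfolding norm_scaleR real_norm_def using W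
      by (intro sum_mono mult_mono Basis_le_norm) (auto simp: pos_le_divide_eq mult.commute K q)
    also have "\<dots> = (\<Sum>c\<in>Basis. K c) / W * norm h"
      by (simp add: sum_distrib_left sum_distrib_right sum_divide_distrib mult_ac)
    finally show ?thesis .
  qed
  have "norm (g x - g y) \<le> (\<Sum>c\<in>Basis. K c) / W * norm (x - y)"
  proof (rule differentiable_bound[OF S(1)])
    show "(g has_derivative D q) (at q within S)" if "q \<in> S" for q
      by (rule has_derivative_at_withinI[OF d[OF that]])
    show "onorm (D q) \<le> (\<Sum>c\<in>Basis. K c) / W" if "q \<in> S" for q
      using W K0 by (intro onorm_bound le that divide_nonneg_nonneg sum_nonneg) auto
  qed (use S in auto)
  from mult_left_mono[OF this less_imp_le[OF W]] W show ?thesis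
    by simp
qed

lemma norm_in_closed_segment:
  fixes p :: "'a::real_normed_vector"
  assumes "p \<in> closed_segment a b"
  shows "norm p \<le> norm a + norm b"
proof -
  obtain t where t: "0 \<le> t" "t \<le> 1" "p = (1 - t) *\<^sub>R a + t *\<^sub>R b"
    using assms by (auto simp: closed_segment_def)
  have "norm p \<le> (1 - t) * norm a + t * norm b"
    using norm_triangle_ineq[of "(1 - t) *\<^sub>R a" "t *\<^sub>R b"] t by simp
  also have "\<dots> \<le> 1 * norm a + 1 * norm b"
    using t by (intro add_mono mult_right_mono) auto
  finally show ?thesis by simp
qed

lemma iterated_deriv_translate:
  assumes f: "f \<in> schwartz" and bs: "set bs \<subseteq> Basis"
  shows "iterated_deriv bs (\<lambda>v. f (v - a)) = (\<lambda>v. iterated_deriv bs f (v - a))"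
    and smooth_translate: "smooth (\<lambda>v. f (v - a))"
proof -
  let ?J = "\<lambda>bs v. iterated_deriv bs f (v - a)"
  have J: "(?J bs has_derivative (\<lambda>h. \<Sum>b\<in>Basis. (h \<bullet> b) *\<^sub>R ?J (b # bs) v)) (at v)" if "set bs \<subseteq> Basis" for bs v
    using has_derivative_compose[of "\<lambda>v. v - a" "\<lambda>h. h" v UNIV "iterated_deriv bs f",
        OF _ iterated_deriv_has_derivative[OF schwartz_smooth[OF f] that]]
    by (simp add: has_derivative_diff[OF has_derivative_ident has_derivative_const, simplified])
  show "iterated_deriv bs (\<lambda>v. f (v - a)) = ?J bs"
    by (rule iterated_deriv_jet[of ?J, OF _ J bs]) simp_all
  show "smooth (\<lambda>v. f (v - a))"
    by (rule smooth_jet[of ?J, OF _ J]) simp_all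
qed

text \<open>
For \<open>p\<close> on the segment from \<open>v - a\<close> to \<open>v - b\<close>, the weight at \<open>v\<close> is at most the weight at \<open>p\<close> times
\<open>1 + |a| + |b|\<close>, so the decay of the next derivatives at \<open>p\<close> is available at \<open>v\<close>.
\<close>

lemma translation_lipschitz:
  fixes f :: "'a::euclidean_space \<Rightarrow> complex"
  assumes f: "f \<in> schwartz" and bs: "set bs \<subseteq> Basis"
  obtains C where "C \<ge> 0" "\<And>v a b. (1 + norm v) ^ m * norm (iterated_deriv bs f (v - a) - iterated_deriv bs f (v - b))
    \<le> C * (1 + norm a + norm b) ^ m * norm (a - b)"
proof -
  have "\<exists>C\<ge>0. \<forall>x. (1 + norm x) ^ m * norm (iterated_deriv (b # bs) f x) \<le> C" if "b \<in> Basis" for b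
    using schwartz_decay[OF f, of "b # bs" m] bs that by (metis insert_subset list.simps(15))
  then obtain C where C: "\<And>b. b \<in> Basis \<Longrightarrow> C b \<ge> 0"
    "\<And>b x. b \<in> Basis \<Longrightarrow> (1 + norm x) ^ m * norm (iterated_deriv (b # bs) f x) \<le> C b"
    by metis
  have "(1 + norm v) ^ m * norm (iterated_deriv bs f (v - a) - iterated_deriv bs f (v - b))
    \<le> (\<Sum>c\<in>Basis. C c) * (1 + norm a + norm b) ^ m * norm (a - b)" for v a b
  proof -
    let ?S = "closed_segment (v - a) (v - b)" and ?M = "1 + norm a + norm b"
    have "(1 + norm v) ^ m * norm (iterated_deriv bs f (v - a) - iterated_deriv bs f (v - b))
      \<le> (\<Sum>c\<in>Basis. C c * ?M ^ m) * norm ((v - a) - (v - b))"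
    proof (rule partial_derivatives_lipschitz[of ?S])
      show "0 < (1 + norm v) ^ m"
        by (intro zero_less_power) (simp add: add_pos_nonneg)
      show "(iterated_deriv bs f has_derivative (\<lambda>h. \<Sum>b\<in>Basis. (h \<bullet> b) *\<^sub>R iterated_deriv (b # bs) f p)) (at p)" for p
        by (rule iterated_deriv_has_derivative[OF schwartz_smooth[OF f] bs])
      fix p c assume p: "p \<in> ?S" and c: "(c::'a) \<in> Basis"
      have "(\<Sum>b\<in>Basis. (c \<bullet> b) *\<^sub>R iterated_deriv (b # bs) f p) = (\<Sum>b\<in>Basis. if c = b then iterated_deriv (b # bs) f p else 0)"
        using c by (intro sum.cong) (auto simp: inner_Basis)
      then have D: "(\<Sum>b\<in>Basis. (c \<bullet> b) *\<^sub>R iterated_deriv (b # bs) f p) = iterated_deriv (c # bs) f p"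
        using c by simp
      obtain t where "0 \<le> t" "t \<le> 1" "p = (1 - t) *\<^sub>R (v - a) + t *\<^sub>R (v - b)"
        using p by (auto simp: closed_segment_def)
      moreover from this(3) have "v - p = (1 - t) *\<^sub>R a + t *\<^sub>R b"
        by (simp add: algebra_simps)
      ultimately have "v - p \<in> closed_segment a b"
        unfolding closed_segment_def by blast
      from norm_in_closed_segment[OF this] have "1 + norm v \<le> 1 + (norm p + (norm a + norm b))"
        using norm_triangle_ineq[of p "v - p"] by simp
      also have "\<dots> \<le> (1 + norm p) * ?M"
        by (simp add: algebra_simps)
      finally have "(1 + norm v) ^ m \<le> ((1 + norm p) * ?M) ^ m"
        by (rule power_mono) simp
      then have "(1 + norm v) ^ m * norm (iterated_deriv (c # bs) f p) \<le> ((1 + norm p) * ?M) ^ m * norm (iterated_deriv (c # bs) f p)"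
        by (rule mult_right_mono) simp
      also have "\<dots> = (1 + norm p) ^ m * norm (iterated_deriv (c # bs) f p) * ?M ^ m"
        by (simp add: power_mult_distrib mult_ac)
      also have "\<dots> \<le> C c * ?M ^ m"
        by (intro mult_right_mono C c) simp
      finally show "(1 + norm v) ^ m * norm (\<Sum>b\<in>Basis. (c \<bullet> b) *\<^sub>R iterated_deriv (b # bs) f p) \<le> C c * ?M ^ m"
        unfolding D .
    qed auto
    then show ?thesis
      by (simp add: norm_minus_commute flip: sum_distrib_right)
  qed
  moreover have "(\<Sum>c\<in>Basis. C c) \<ge> 0" using C(1) by (rule sum_nonneg)
  ultimately show ?thesis using that by blast
qed

lemma schwartz_translate:
  assumes f: "f \<in> schwartz"
  shows "(\<lambda>v. f (v - a)) \<in> schwartz"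
proof (rule schwartzI)
  show "smooth (\<lambda>v. f (v - a))" by (rule smooth_translate[OF f, of "[]"]) simp
  fix k and bs :: "'a list" assume bs: "set bs \<subseteq> Basis"
  obtain C D where C: "\<And>x. (1 + norm x) ^ k * norm (iterated_deriv bs f x) \<le> C"
    and D: "\<And>v. (1 + norm v) ^ k * norm (iterated_deriv bs f (v - a) - iterated_deriv bs f (v - 0)) \<le> D"
    using schwartz_decay[OF f bs] translation_lipschitz[OF f bs] by metis
  have "(1 + norm v) ^ k * norm (iterated_deriv bs f (v - a)) \<le> D + C" for v
  proof -
    have "norm (iterated_deriv bs f (v - a)) \<le> norm (iterated_deriv bs f (v - a) - iterated_deriv bs f v) + norm (iterated_deriv bs f v)"
      using norm_triangle_ineq[of "iterated_deriv bs f (v - a) - iterated_deriv bs f v" "iterated_deriv bs f v"] by simp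
    then have "(1 + norm v) ^ k * norm (iterated_deriv bs f (v - a)) \<le>
        (1 + norm v) ^ k * (norm (iterated_deriv bs f (v - a) - iterated_deriv bs f v) + norm (iterated_deriv bs f v))"
      by (rule mult_left_mono) simp
    with C[of v] D[of v] show ?thesis by (simp add: distrib_left)
  qed
  then show "\<exists>C. \<forall>v. (1 + norm v) ^ k * norm (iterated_deriv bs (\<lambda>v. f (v - a)) v) \<le> C"
    unfolding iterated_deriv_translate[OF f bs] by blast
qed

text \<open>
The factor \<open>\<epsilon>\<close> on the right-hand side is what makes regularisations converge.
\<close>

lemma scaled_translation_lipschitz:
  fixes f :: "'a::euclidean_space \<Rightarrow> complex"
  assumes f: "f \<in> schwartz" and bs: "set bs \<subseteq> Basis"
  obtains C where "C \<ge> 0" "\<And>\<epsilon> v y y'. 0 \<le> \<epsilon> \<Longrightarrow> \<epsilon> \<le> 1 \<Longrightarrow>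
    (1 + norm v) ^ m * norm (iterated_deriv bs f (v - \<epsilon> *\<^sub>R y) - iterated_deriv bs f (v - \<epsilon> *\<^sub>R y'))
      \<le> \<epsilon> * (C * (1 + norm y + norm y') ^ m * norm (y - y'))"
proof -
  obtain C where C: "C \<ge> 0" "\<And>v a b. (1 + norm v) ^ m * norm (iterated_deriv bs f (v - a) - iterated_deriv bs f (v - b))
    \<le> C * (1 + norm a + norm b) ^ m * norm (a - b)"
    using translation_lipschitz[OF f bs] by metis
  have "(1 + norm v) ^ m * norm (iterated_deriv bs f (v - \<epsilon> *\<^sub>R y) - iterated_deriv bs f (v - \<epsilon> *\<^sub>R y'))
      \<le> \<epsilon> * (C * (1 + norm y + norm y') ^ m * norm (y - y'))" if e: "0 \<le> \<epsilon>" "\<epsilon> \<le> 1" for \<epsilon> v y y'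
  proof -
    have "\<epsilon> * norm y \<le> 1 * norm y" "\<epsilon> * norm y' \<le> 1 * norm y'"
      using e by (intro mult_right_mono; simp)+
    then have "1 + norm (\<epsilon> *\<^sub>R y) + norm (\<epsilon> *\<^sub>R y') \<le> 1 + norm y + norm y'"
      using e by simp
    then have "(1 + norm (\<epsilon> *\<^sub>R y) + norm (\<epsilon> *\<^sub>R y')) ^ m \<le> (1 + norm y + norm y') ^ m"
      by (rule power_mono) simp
    note M = this
    have "(1 + norm v) ^ m * norm (iterated_deriv bs f (v - \<epsilon> *\<^sub>R y) - iterated_deriv bs f (v - \<epsilon> *\<^sub>R y'))
      \<le> C * (1 + norm (\<epsilon> *\<^sub>R y) + norm (\<epsilon> *\<^sub>R y')) ^ m * norm (\<epsilon> *\<^sub>R y - \<epsilon> *\<^sub>R y')"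
      by (rule C(2))
    also have "\<dots> \<le> C * (1 + norm y + norm y') ^ m * norm (\<epsilon> *\<^sub>R y - \<epsilon> *\<^sub>R y')"
      using C(1) by (intro mult_right_mono mult_left_mono M) auto
    also have "norm (\<epsilon> *\<^sub>R y - \<epsilon> *\<^sub>R y') = \<epsilon> * norm (y - y')"
      using e by (simp flip: scaleR_diff_right)
    finally show ?thesis
      by (simp only: mult_ac)
  qed
  with C(1) show ?thesis by (rule that)
qed

lemma lipschitz_family_translations:
  fixes f :: "'a::euclidean_space \<Rightarrow> complex"
  assumes f: "f \<in> schwartz" and e: "0 \<le> \<epsilon>" "\<epsilon> \<le> 1"
  shows "lipschitz_family (\<lambda>y v. f (v - \<epsilon> *\<^sub>R y))"
  unfolding lipschitz_family_def
proof (intro conjI allI impI)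
  show "(\<lambda>v. f (v - \<epsilon> *\<^sub>R y)) \<in> schwartz" for y
    by (rule schwartz_translate[OF f])
  fix m and bs :: "'a list" assume bs: "set bs \<subseteq> Basis"
  obtain C where C: "C \<ge> 0" "\<And>\<epsilon> v y y'. 0 \<le> \<epsilon> \<Longrightarrow> \<epsilon> \<le> 1 \<Longrightarrow>
    (1 + norm v) ^ m * norm (iterated_deriv bs f (v - \<epsilon> *\<^sub>R y) - iterated_deriv bs f (v - \<epsilon> *\<^sub>R y'))
      \<le> \<epsilon> * (C * (1 + norm y + norm y') ^ m * norm (y - y'))"
    using scaled_translation_lipschitz[OF f bs] by metis
  show "\<exists>C k. C \<ge> 0 \<and> (\<forall>u u' v. (1 + norm v) ^ m *
      norm (iterated_deriv bs (\<lambda>v. f (v - \<epsilon> *\<^sub>R u)) v - iterated_deriv bs (\<lambda>v. f (v - \<epsilon> *\<^sub>R u')) v)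
      \<le> C * (1 + norm u + norm u') ^ k * norm (u - u'))"
    unfolding iterated_deriv_translate[OF f bs]
    using C(1) C(2)[OF e] e(1) by (intro exI[of _ "\<epsilon> * C"] exI[of _ m]) (simp add: mult.assoc)
qed

text \<open>
The convolution of \<open>f\<close> with the Gaussian \<open>\<epsilon>\<^sup>-\<^sup>d exp (-\<pi> |y|\<^sup>2 / \<epsilon>\<^sup>2)\<close>, in the rescaled form in which only
the translations depend on \<open>\<epsilon>\<close>.
\<close>

definition regularise :: "real \<Rightarrow> ('a::euclidean_space \<Rightarrow> complex) \<Rightarrow> 'a \<Rightarrow> complex" where
  "regularise \<epsilon> f = superposition (\<lambda>y. of_real (exp (- (pi * (norm y)\<^sup>2)))) (\<lambda>y v. f (v - \<epsilon> *\<^sub>R y))"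

text \<open>
The Gaussian has integral 1, so the error is an average of differences of translates of \<open>f\<close>, each of
which is of order \<open>\<epsilon>\<close> in every seminorm.
\<close>

lemma regularise_tendsto:
  fixes f :: "'a::euclidean_space \<Rightarrow> complex" and \<epsilon> :: "nat \<Rightarrow> real"
  assumes f: "f \<in> schwartz" and e: "\<And>i. 0 \<le> \<epsilon> i" "\<And>i. \<epsilon> i \<le> 1" "\<epsilon> \<longlonglongrightarrow> 0" and F: "tempered F"
  shows "(\<lambda>i. F (regularise (\<epsilon> i) f)) \<longlonglongrightarrow> F f"
proof (rule tempered_tendsto[OF F _ f])
  let ?w = "\<lambda>y::'a. exp (- (pi * (norm y)\<^sup>2))"
  have w: "rapidly_decreasing (\<lambda>y::'a. of_real (?w y))"
    by (rule rapidly_decreasing_gaussian) simp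
  have wk: "integrable lborel (\<lambda>y. (1 + norm y) ^ k * ?w y)" for k
    using w by (simp add: rapidly_decreasing_def)
  have w1: "integrable lborel (\<lambda>y. complex_of_real (?w y))" "(LINT y::'a|lborel. complex_of_real (?w y)) = 1"
    using integrable_gaussian[of 1 0 "0::'a" 0 0] gaussian_integral[of 1 0 "0::'a" 0 0] gauss_const_of_real[of 1]
    by (simp_all add: exp_of_real[symmetric])
  have lip: "lipschitz_family (\<lambda>y v. f (v - \<epsilon> i *\<^sub>R y))" for i
    by (rule lipschitz_family_translations[OF f e(1,2)])
  show "regularise (\<epsilon> i) f \<in> schwartz" for i
    unfolding regularise_def by (rule superposition_schwartz[OF lip w])
  fix m and bs :: "'a list" assume bs: "set bs \<subseteq> Basis"
  obtain C where C: "C \<ge> 0" "\<And>\<epsilon> v y y'. 0 \<le> \<epsilon> \<Longrightarrow> \<epsilon> \<le> 1 \<Longrightarrow>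
    (1 + norm v) ^ m * norm (iterated_deriv bs f (v - \<epsilon> *\<^sub>R y) - iterated_deriv bs f (v - \<epsilon> *\<^sub>R y'))
      \<le> \<epsilon> * (C * (1 + norm y + norm y') ^ m * norm (y - y'))"
    using scaled_translation_lipschitz[OF f bs] by metis
  let ?I = "LINT y|lborel. C * ((1 + norm y) ^ Suc m * ?w y)"
  have "(1 + norm v) ^ m * norm (iterated_deriv bs (regularise (\<epsilon> i) f) v - iterated_deriv bs f v) \<le> \<epsilon> i * ?I" for i v
  proof -
    let ?d = "\<lambda>y. of_real (?w y) * (iterated_deriv bs f (v - \<epsilon> i *\<^sub>R y) - iterated_deriv bs f v)"
    have int1: "integrable lborel (\<lambda>y. of_real (?w y) * iterated_deriv bs f (v - \<epsilon> i *\<^sub>R y))"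
      using superposition_integrable[OF lip w bs] by (simp add: iterated_deriv_translate[OF f bs])
    have int2: "integrable lborel (\<lambda>y. of_real (?w y) * iterated_deriv bs f v)"
      by (rule integrable_mult_left[OF w1(1)])
    have int: "integrable lborel ?d"
      unfolding right_diff_distrib by (rule Bochner_Integration.integrable_diff[OF int1 int2])
    have "iterated_deriv bs (regularise (\<epsilon> i) f) v - iterated_deriv bs f v =
        (LINT y|lborel. of_real (?w y) * iterated_deriv bs f (v - \<epsilon> i *\<^sub>R y)) - (LINT y|lborel. of_real (?w y) * iterated_deriv bs f v)"
      unfolding regularise_def iterated_deriv_superposition[OF lip w bs] iterated_deriv_translate[OF f bs] integral_mult_left_zero w1(2) by simp
    also have "\<dots> = (LINT y|lborel. ?d y)"
      unfolding right_diff_distrib by (rule Bochner_Integration.integral_diff[OF int1 int2, symmetric])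
    finally have "(1 + norm v) ^ m * norm (iterated_deriv bs (regularise (\<epsilon> i) f) v - iterated_deriv bs f v) \<le>
        (1 + norm v) ^ m * (LINT y|lborel. norm (?d y))"
      by (simp add: mult_left_mono integral_norm_bound)
    also have "\<dots> = (LINT y|lborel. (1 + norm v) ^ m * norm (?d y))"
      by (rule integral_mult_right_zero[symmetric])
    also have "\<dots> \<le> (LINT y|lborel. \<epsilon> i * (C * ((1 + norm y) ^ Suc m * ?w y)))"
    proof (rule integral_mono)
      show "integrable lborel (\<lambda>y. (1 + norm v) ^ m * norm (?d y))"
        by (intro integrable_mult_right integrable_norm int)
      show "integrable lborel (\<lambda>y. \<epsilon> i * (C * ((1 + norm y) ^ Suc m * ?w y)))"
        by (intro integrable_mult_right wk)
      fix y :: 'a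
      \<comment> \<open>Compare the translation by \<open>\<epsilon>\<^sub>i y\<close> with the one by \<open>0\<close>.\<close>
      have "(1 + norm v) ^ m * norm (iterated_deriv bs f (v - \<epsilon> i *\<^sub>R y) - iterated_deriv bs f v) \<le> \<epsilon> i * (C * (1 + norm y) ^ m * norm y)"
        using C(2)[OF e(1,2), of v i y 0] by simp
      also have "\<dots> \<le> \<epsilon> i * (C * (1 + norm y) ^ m * (1 + norm y))"
        using e(1) C(1) by (intro mult_left_mono) auto
      finally have "?w y * ((1 + norm v) ^ m * norm (iterated_deriv bs f (v - \<epsilon> i *\<^sub>R y) - iterated_deriv bs f v)) \<le> ?w y * (\<epsilon> i * (C * (1 + norm y) ^ m * (1 + norm y)))"
        by (rule mult_left_mono) simp
      then show "(1 + norm v) ^ m * norm (?d y) \<le> \<epsilon> i * (C * ((1 + norm y) ^ Suc m * ?w y))"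
        by (simp add: norm_mult mult_ac)
    qed
    finally show ?thesis by (simp only: integral_mult_right_zero)
  qed
  moreover have "(\<lambda>i. \<epsilon> i * ?I) \<longlonglongrightarrow> 0"
    by (rule tendsto_mult_left_zero[OF e(3)])
  ultimately show "\<exists>e. e \<longlonglongrightarrow> 0 \<and> (\<forall>i v. (1 + norm v) ^ m * norm (iterated_deriv bs (regularise (\<epsilon> i) f) v - iterated_deriv bs f v) \<le> e i)"
    by blast
qed

section \<open>Gaussian packets\<close>

text \<open>
Polynomials in the real coordinates of \<open>x\<close> with complex coefficients. The generators are the
inner products with arbitrary vectors, so that no basis has to be chosen.
\<close>

inductive coord_poly :: "('a::euclidean_space \<Rightarrow> complex) \<Rightarrow> bool" where
  const: "coord_poly (\<lambda>x. c)"
| inner: "coord_poly (\<lambda>x. of_real (x \<bullet> b))"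
| add: "coord_poly f \<Longrightarrow> coord_poly g \<Longrightarrow> coord_poly (\<lambda>x. f x + g x)"
| mult: "coord_poly f \<Longrightarrow> coord_poly g \<Longrightarrow> coord_poly (\<lambda>x. f x * g x)"

text \<open>
The class is closed under differentiation: for each direction \<open>h\<close> the derivative is a polynomial in
\<open>x\<close> again.
\<close>

lemma coord_poly_has_derivative:
  assumes "coord_poly f"
  shows "\<exists>f'. (\<forall>x. (f has_derivative f' x) (at x)) \<and> (\<forall>h. coord_poly (\<lambda>x. f' x h))"
  using assms
proof induction
  case (const c)
  show ?case
    by (intro exI[of _ "\<lambda>_ _. 0"]) (auto intro: coord_poly.const)
next
  case (inner b)
  show ?case
    by (intro exI[of _ "\<lambda>_ h. of_real (h \<bullet> b)"]) (auto intro!: coord_poly.const derivative_eq_intros)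
next
  case (add f g)
  then obtain f' g' where "\<And>x. (f has_derivative f' x) (at x)" "\<And>h. coord_poly (\<lambda>x. f' x h)"
    "\<And>x. (g has_derivative g' x) (at x)" "\<And>h. coord_poly (\<lambda>x. g' x h)"
    by metis
  then show ?case
    by (intro exI[of _ "\<lambda>x h. f' x h + g' x h"]) (auto intro: coord_poly.add has_derivative_add)
next
  case (mult f g)
  then obtain f' g' where d: "\<And>x. (f has_derivative f' x) (at x)" "\<And>x. (g has_derivative g' x) (at x)"
    and p: "\<And>h. coord_poly (\<lambda>x. f' x h)" "\<And>h. coord_poly (\<lambda>x. g' x h)"
    by metis
  have "coord_poly (\<lambda>x. f x * g' x h + f' x h * g x)" for h
    by (rule coord_poly.add[OF coord_poly.mult[OF mult.hyps(1) p(2)] coord_poly.mult[OF p(1) mult.hyps(2)]])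
  with has_derivative_mult[OF d] show ?case
    by (intro exI[of _ "\<lambda>x h. f x * g' x h + f' x h * g x"] conjI allI)
qed

lemma coord_poly_bound:
  assumes "coord_poly f"
  shows "\<exists>C k. C \<ge> 0 \<and> (\<forall>x. norm (f x) \<le> C * (1 + norm x) ^ k)"
  using assms
proof induction
  case (const c)
  show ?case by (intro exI[of _ "norm c"] exI[of _ 0]) auto
next
  case (inner b)
  have "\<bar>x \<bullet> b\<bar> \<le> norm b * (1 + norm x)" for x
  proof -
    have "\<bar>x \<bullet> b\<bar> \<le> norm b * norm x"
      using Cauchy_Schwarz_ineq2[of x b] by (simp add: mult.commute)
    also have "\<dots> \<le> norm b * (1 + norm x)"
      by (intro mult_left_mono) auto
    finally show ?thesis .
  qed
  then show ?case by (intro exI[of _ "norm b"] exI[of _ 1]) auto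
next
  case (add f g)
  then obtain C D k l where C: "C \<ge> 0" "\<And>x. norm (f x) \<le> C * (1 + norm x) ^ k"
    and D: "D \<ge> 0" "\<And>x. norm (g x) \<le> D * (1 + norm x) ^ l"
    by metis
  have "norm (f x + g x) \<le> (C + D) * (1 + norm x) ^ (k + l)" for x
  proof -
    have "norm (f x + g x) \<le> C * (1 + norm x) ^ k + D * (1 + norm x) ^ l"
      by (rule order_trans[OF norm_triangle_ineq add_mono[OF C(2) D(2)]])
    also have "\<dots> \<le> C * (1 + norm x) ^ (k + l) + D * (1 + norm x) ^ (k + l)"
      using C(1) D(1) by (intro add_mono mult_left_mono power_increasing) auto
    finally show ?thesis by (simp add: distrib_right)
  qed
  with C(1) D(1) show ?case by (intro exI[of _ "C + D"] exI[of _ "k + l"]) auto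
next
  case (mult f g)
  then obtain C D k l where C: "C \<ge> 0" "\<And>x. norm (f x) \<le> C * (1 + norm x) ^ k"
    and D: "D \<ge> 0" "\<And>x. norm (g x) \<le> D * (1 + norm x) ^ l"
    by metis
  have "norm (f x * g x) \<le> (C * D) * (1 + norm x) ^ (k + l)" for x
    using mult_mono[OF C(2) D(2), of x x] C(1) by (simp add: norm_mult power_add mult_ac)
  with C(1) D(1) show ?case by (intro exI[of _ "C * D"] exI[of _ "k + l"]) auto
qed

lemma coord_poly_sum: "finite A \<Longrightarrow> (\<And>a. a \<in> A \<Longrightarrow> coord_poly (f a)) \<Longrightarrow> coord_poly (\<lambda>x. \<Sum>a\<in>A. f a x)"
  by (induction A rule: finite_induct) (auto intro: coord_poly.const coord_poly.add)

text \<open>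
A Gaussian of width \<open>\<sigma>\<^sup>-\<^sup>1\<^sup>/\<^sup>2\<close> that is centred at \<open>fst p\<close> and oscillates with frequency \<open>snd p\<close>. The phase
vanishes at the centre, so that packets of a given width depend on \<open>v - fst p\<close> and the frequency only.
\<close>

definition gaussian_packet :: "real \<Rightarrow> 'v::euclidean_space \<times> 'v \<Rightarrow> 'v \<Rightarrow> complex" where
  "gaussian_packet \<sigma> p v = exp (- of_real (pi * \<sigma>) * of_real ((norm (v - fst p))\<^sup>2)
     + 2 * of_real pi * \<i> * of_real (snd p \<bullet> (v - fst p)))"

lemma norm_gaussian_packet: "norm (gaussian_packet \<sigma> p v) = exp (- (pi * \<sigma> * (norm (v - fst p))\<^sup>2))"
  by (simp add: gaussian_packet_def)

text \<open>
The exponent is regarded as a polynomial in the parameter and the point jointly. All derivatives of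
a packet, with respect to either, are then polynomials times the packet, and one estimate covers
them uniformly in the parameter.
\<close>

lemma coord_poly_packet_exponent:
  "coord_poly (\<lambda>x::('v::euclidean_space \<times> 'v) \<times> 'v. - of_real (pi * \<sigma>) * of_real ((norm (snd x - fst (fst x)))\<^sup>2)
     + 2 * of_real pi * \<i> * of_real (snd (fst x) \<bullet> (snd x - fst (fst x))))"
proof -
  have e: "(snd x - fst (fst x)) \<bullet> b = x \<bullet> ((- b, 0), b)" "snd (fst x) \<bullet> b = x \<bullet> ((0, b), 0)"
    for x :: "('v \<times> 'v) \<times> 'v" and b
    by (simp_all add: inner_prod_def inner_diff_left)
  have eq: "- of_real (pi * \<sigma>) * of_real ((norm (snd x - fst (fst x)))\<^sup>2)
     + 2 * of_real pi * \<i> * of_real (snd (fst x) \<bullet> (snd x - fst (fst x))) =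
     - of_real (pi * \<sigma>) * (\<Sum>b\<in>Basis. of_real (x \<bullet> ((- b, 0), b)) * of_real (x \<bullet> ((- b, 0), b)))
     + 2 * of_real pi * \<i> * (\<Sum>b\<in>Basis. of_real (x \<bullet> ((0, b), 0)) * of_real (x \<bullet> ((- b, 0), b)))"
    for x :: "('v \<times> 'v) \<times> 'v"
    unfolding power2_norm_eq_inner e[symmetric]
    by (subst (1 2) euclidean_inner) (simp only: of_real_sum of_real_mult)
  show ?thesis
    unfolding eq by (intro coord_poly.add coord_poly.mult coord_poly.const coord_poly_sum coord_poly.inner finite_Basis)
qed

text \<open>
The derivative is taken in the pair of parameter and point. Its restriction to the point gives the
derivatives of a packet, and its restriction to the parameter gives the Lipschitz estimates.
\<close>

lemma packet_derivative:
  fixes P :: "('v::euclidean_space \<times> 'v) \<times> 'v \<Rightarrow> complex"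
  assumes "coord_poly P"
  shows "\<exists>P'. (\<forall>h. coord_poly (P' h)) \<and> (\<forall>x. ((\<lambda>x. P x * gaussian_packet \<sigma> (fst x) (snd x)) has_derivative
       (\<lambda>h. P' h x * gaussian_packet \<sigma> (fst x) (snd x))) (at x))"
proof -
  define Q where "Q = (\<lambda>x::('v \<times> 'v) \<times> 'v. - of_real (pi * \<sigma>) * of_real ((norm (snd x - fst (fst x)))\<^sup>2)
     + 2 * of_real pi * \<i> * of_real (snd (fst x) \<bullet> (snd x - fst (fst x))))"
  have E: "gaussian_packet \<sigma> (fst x) (snd x) = exp (Q x)" for x
    by (simp only: gaussian_packet_def Q_def)
  have Q: "coord_poly Q"
    unfolding Q_def by (rule coord_poly_packet_exponent)
  obtain P1 where P1: "\<And>x. (P has_derivative P1 x) (at x)" "\<And>h. coord_poly (\<lambda>x. P1 x h)"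
    using coord_poly_has_derivative[OF assms] by metis
  obtain Q1 where Q1: "\<And>x. (Q has_derivative Q1 x) (at x)" "\<And>h. coord_poly (\<lambda>x. Q1 x h)"
    using coord_poly_has_derivative[OF Q] by metis
  have "((\<lambda>x. P x * exp (Q x)) has_derivative (\<lambda>h. (P1 x h + P x * Q1 x h) * exp (Q x))) (at x)" for x
  proof -
    have "((\<lambda>x. exp (Q x)) has_derivative (\<lambda>h. exp (Q x) * Q1 x h)) (at x)"
      using has_derivative_compose[OF Q1(1)[of x] DERIV_exp[unfolded has_field_derivative_def]] .
    from has_derivative_mult[OF P1(1)[of x] this] show ?thesis
      by (rule has_derivative_eq_rhs) (simp add: fun_eq_iff algebra_simps)
  qed
  moreover have "coord_poly (\<lambda>x. P1 x h + P x * Q1 x h)" for h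
    by (rule coord_poly.add[OF P1(2) coord_poly.mult[OF assms Q1(2)]])
  ultimately show ?thesis
    unfolding E by (intro exI[of _ "\<lambda>h x. P1 x h + P x * Q1 x h"] conjI allI)
qed

lemma iterated_deriv_gaussian_packet:
  fixes \<sigma> :: real
  assumes "set bs \<subseteq> (Basis :: 'v::euclidean_space set)"
  shows "\<exists>P. coord_poly P \<and> (\<forall>p. iterated_deriv bs (gaussian_packet \<sigma> p) = (\<lambda>v. P (p, v) * gaussian_packet \<sigma> p v))"
  using assms
proof (induction bs)
  case Nil
  show ?case by (intro exI[of _ "\<lambda>_. 1"]) (auto intro: coord_poly.const)
next
  case (Cons b bs)
  then obtain P where P: "coord_poly P" "\<And>p. iterated_deriv bs (gaussian_packet \<sigma> p) = (\<lambda>v. P (p, v) * gaussian_packet \<sigma> p v)"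
    by auto
  obtain P' where P': "\<forall>h. coord_poly (P' h)" "\<forall>x. ((\<lambda>x. P x * gaussian_packet \<sigma> (fst x) (snd x)) has_derivative
       (\<lambda>h. P' h x * gaussian_packet \<sigma> (fst x) (snd x))) (at x)"
    using packet_derivative[OF P(1)] by blast
  have "((\<lambda>v. P (p, v) * gaussian_packet \<sigma> p v) has_derivative (\<lambda>h. P' (0, h) (p, v) * gaussian_packet \<sigma> p v)) (at v)" for p v
    using has_derivative_compose[OF has_derivative_Pair[OF has_derivative_const[of p] has_derivative_ident] spec[OF P'(2), of "(p, v)"]] by simp
  from frechet_derivative_at[OF this, symmetric]
  have "iterated_deriv (b # bs) (gaussian_packet \<sigma> p) = (\<lambda>v. P' (0, b) (p, v) * gaussian_packet \<sigma> p v)" for p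
    by (simp only: iterated_deriv_Cons P(2))
  with P'(1) show ?case by blast
qed

text \<open>
The distance \<open>|v - fst p|\<close> is controlled by the Gaussian, and both \<open>1 + |v|\<close> and \<open>1 + |(p, v)|\<close> are at
most that distance plus 1, up to a power of \<open>1 + |p|\<close>.
\<close>

lemma packet_derivative_decay:
  fixes \<sigma> :: real and P :: "('v::euclidean_space \<times> 'v) \<times> 'v \<Rightarrow> complex"
  assumes "coord_poly P" and \<sigma>: "\<sigma> > 0"
  shows "\<exists>C K. C \<ge> 0 \<and> (\<forall>p v. (1 + norm v) ^ m * norm (P (p, v) * gaussian_packet \<sigma> p v) \<le> C * (1 + norm p) ^ K)"
proof -
  obtain C k where C: "C \<ge> 0" "\<And>x. norm (P x) \<le> C * (1 + norm x) ^ k"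
    using coord_poly_bound[OF assms(1)] by metis
  obtain D where D: "D \<ge> 0" "\<And>r. r \<ge> 0 \<Longrightarrow> (1 + r) ^ (m + k) * exp (- (pi * \<sigma> * r\<^sup>2) + 0 * r) \<le> D"
    using polynomial_times_gaussian_bounded[of "pi * \<sigma>" "m + k" 0] \<sigma> by (metis mult_pos_pos pi_gt_zero)
  have "(1 + norm v) ^ m * norm (P (p, v) * gaussian_packet \<sigma> p v) \<le> (C * D) * (1 + norm p) ^ (k + (m + k))" for p v
  proof -
    let ?r = "norm (v - fst p)" and ?N = "1 + norm p"
    have prod: "1 + (x + y) \<le> (1 + x) * (1 + y)" if "0 \<le> x" "0 \<le> y" for x y :: real
      using mult_nonneg_nonneg[OF that] by (simp add: algebra_simps)
    have "norm (p, v) \<le> norm p + norm v"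
      by (rule norm_Pair_le)
    then have 1: "1 + norm (p, v) \<le> ?N * (1 + norm v)"
      using prod[of "norm p" "norm v"] by simp
    have "norm v \<le> norm (fst p) + ?r"
      using norm_triangle_ineq[of "fst p" "v - fst p"] by simp
    also have "norm (fst p) \<le> norm p"
      by (cases p) (simp add: norm_fst_le)
    finally have 2: "1 + norm v \<le> ?N * (1 + ?r)"
      using prod[of "norm p" ?r] by simp
    have "(1 + norm v) ^ m * norm (P (p, v) * gaussian_packet \<sigma> p v) \<le> (1 + norm v) ^ m * (C * (1 + norm (p, v)) ^ k * norm (gaussian_packet \<sigma> p v))"
      unfolding norm_mult by (intro mult_left_mono mult_right_mono C) auto
    also have "\<dots> \<le> (1 + norm v) ^ m * (C * (?N * (1 + norm v)) ^ k * norm (gaussian_packet \<sigma> p v))"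
      using C(1) by (intro mult_left_mono mult_right_mono power_mono 1) auto
    also have "\<dots> = C * ?N ^ k * ((1 + norm v) ^ (m + k) * norm (gaussian_packet \<sigma> p v))"
      by (simp only: power_mult_distrib power_add mult_ac)
    also have "\<dots> \<le> C * ?N ^ k * ((?N * (1 + ?r)) ^ (m + k) * norm (gaussian_packet \<sigma> p v))"
      using C(1) by (intro mult_left_mono mult_right_mono power_mono 2) auto
    also have "\<dots> = C * ?N ^ k * (?N ^ (m + k) * ((1 + ?r) ^ (m + k) * norm (gaussian_packet \<sigma> p v)))"
      by (simp only: power_mult_distrib mult_ac)
    also have "\<dots> \<le> C * ?N ^ k * (?N ^ (m + k) * D)"
      using C(1) D(2)[of ?r] unfolding norm_gaussian_packet by (intro mult_left_mono) auto
    also have "\<dots> = (C * D) * ?N ^ (k + (m + k))"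
      by (simp only: power_add mult_ac)
    finally show ?thesis .
  qed
  with C(1) D(1) show ?thesis
    by (intro exI[of _ "C * D"] exI[of _ "k + (m + k)"]) auto
qed

lemma gaussian_packet_schwartz:
  fixes \<sigma> :: real
  assumes \<sigma>: "\<sigma> > 0"
  shows "gaussian_packet \<sigma> p \<in> schwartz"
proof (rule schwartzI)
  show "smooth (gaussian_packet \<sigma> p)"
    unfolding smooth_def
  proof (intro allI impI)
    fix bs v assume bs: "set bs \<subseteq> (Basis :: 'a set)"
    obtain P where P: "coord_poly P" "\<And>p. iterated_deriv bs (gaussian_packet \<sigma> p) = (\<lambda>v. P (p, v) * gaussian_packet \<sigma> p v)"
      using iterated_deriv_gaussian_packet[OF bs] by metis
    obtain P' where P': "\<forall>x. ((\<lambda>x. P x * gaussian_packet \<sigma> (fst x) (snd x)) has_derivative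
       (\<lambda>h. P' h x * gaussian_packet \<sigma> (fst x) (snd x))) (at x)"
      using packet_derivative[OF P(1)] by blast
    have "((\<lambda>v. P (p, v) * gaussian_packet \<sigma> p v) has_derivative (\<lambda>h. P' (0, h) (p, v) * gaussian_packet \<sigma> p v)) (at v)"
      using has_derivative_compose[OF has_derivative_Pair[OF has_derivative_const[of p] has_derivative_ident] spec[OF P', of "(p, v)"]] by simp
    then show "iterated_deriv bs (gaussian_packet \<sigma> p) differentiable at v"
      unfolding P(2) by (rule differentiableI)
  qed
  fix k and bs :: "'a list" assume bs: "set bs \<subseteq> Basis"
  obtain P where P: "coord_poly P" "\<And>p. iterated_deriv bs (gaussian_packet \<sigma> p) = (\<lambda>v. P (p, v) * gaussian_packet \<sigma> p v)"
    using iterated_deriv_gaussian_packet[OF bs] by metis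
  show "\<exists>C. \<forall>x. (1 + norm x) ^ k * norm (iterated_deriv bs (gaussian_packet \<sigma> p) x) \<le> C"
    unfolding P(2) using packet_derivative_decay[OF P(1) \<sigma>, of k] by blast
qed

lemma lipschitz_family_gaussian_packet:
  fixes \<sigma> :: real
  assumes \<sigma>: "\<sigma> > 0"
  shows "lipschitz_family (gaussian_packet \<sigma> :: 'v::euclidean_space \<times> 'v \<Rightarrow> _)"
  unfolding lipschitz_family_def
proof (intro conjI allI impI gaussian_packet_schwartz \<sigma>)
  fix m and bs :: "'v list" assume bs: "set bs \<subseteq> Basis"
  obtain P where P: "coord_poly P" "\<And>p. iterated_deriv bs (gaussian_packet \<sigma> p) = (\<lambda>v. P (p, v) * gaussian_packet \<sigma> p v)"
    using iterated_deriv_gaussian_packet[OF bs] by metis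
  obtain P' where P': "\<forall>h. coord_poly (P' h)" "\<forall>x. ((\<lambda>x. P x * gaussian_packet \<sigma> (fst x) (snd x)) has_derivative
       (\<lambda>h. P' h x * gaussian_packet \<sigma> (fst x) (snd x))) (at x)"
    using packet_derivative[OF P(1)] by blast
  let ?D = "\<lambda>v q h. P' (h, 0) (q, v) * gaussian_packet \<sigma> q v"
  have d: "((\<lambda>p. P (p, v) * gaussian_packet \<sigma> p v) has_derivative ?D v q) (at q)" for q v
    using has_derivative_compose[OF has_derivative_Pair[OF has_derivative_ident has_derivative_const[of v]] spec[OF P'(2), of "(q, v)"]] by simp
  have "\<exists>C K. C \<ge> 0 \<and> (\<forall>p v. (1 + norm v) ^ m * norm (?D v p c) \<le> C * (1 + norm p) ^ K)" for c
    by (rule packet_derivative_decay[OF spec[OF P'(1)] \<sigma>])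
  then obtain C K where C: "\<And>c. C c \<ge> 0" "\<And>c p v. (1 + norm v) ^ m * norm (?D v p c) \<le> C c * (1 + norm p) ^ K c"
    by metis
  \<comment> \<open>Sum of the exponents, an exponent that serves for all directions \<open>c\<close> at once.\<close>
  define k where "k = (\<Sum>c\<in>(Basis :: ('v \<times> 'v) set). K c)"
  let ?C = "\<Sum>c\<in>(Basis :: ('v \<times> 'v) set). C c"
  have "(1 + norm v) ^ m * norm (iterated_deriv bs (gaussian_packet \<sigma> p) v - iterated_deriv bs (gaussian_packet \<sigma> p') v)
      \<le> ?C * (1 + norm p + norm p') ^ k * norm (p - p')" for p p' v
  proof -
    let ?M = "1 + norm p + norm p'"
    have "(1 + norm v) ^ m * norm (P (p, v) * gaussian_packet \<sigma> p v - P (p', v) * gaussian_packet \<sigma> p' v)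
      \<le> (\<Sum>c\<in>Basis. C c * ?M ^ k) * norm (p - p')"
    proof (rule partial_derivatives_lipschitz[OF _ _ _ _ d, of "closed_segment p p'"])
      show "0 < (1 + norm v) ^ m"
        by (intro zero_less_power) (simp add: add_pos_nonneg)
      fix q c assume q: "q \<in> closed_segment p p'" and c: "(c :: 'v \<times> 'v) \<in> Basis"
      have "(1 + norm v) ^ m * norm (?D v q c) \<le> C c * (1 + norm q) ^ K c"
        by (rule C)
      also have "\<dots> \<le> C c * ?M ^ K c"
        using C(1)[of c] norm_in_closed_segment[OF q] by (intro mult_left_mono power_mono) auto
      also have "\<dots> \<le> C c * ?M ^ k"
        using C(1)[of c] member_le_sum[OF c, of K] unfolding k_def
        by (intro mult_left_mono power_increasing) auto
      finally show "(1 + norm v) ^ m * norm (?D v q c) \<le> C c * ?M ^ k" .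
    qed auto
    then show ?thesis
      unfolding P(2) by (simp flip: sum_distrib_right)
  qed
  moreover have "?C \<ge> 0" using C(1) by (rule sum_nonneg)
  ultimately show "\<exists>C k. C \<ge> 0 \<and> (\<forall>p p' v. (1 + norm v) ^ m * norm (iterated_deriv bs (gaussian_packet \<sigma> p) v - iterated_deriv bs (gaussian_packet \<sigma> p') v)
      \<le> C * (1 + norm p + norm p') ^ k * norm (p - p'))"
    by blast
qed

text \<open>
Integrating over the frequency against \<open>exp (-\<pi> |\<nu>|\<^sup>2 / \<rho>)\<close> multiplies the packet, up to a constant, by
\<open>exp (-\<pi> \<rho> |v - u|\<^sup>2)\<close>. The product with the envelope \<open>exp (-2\<pi> |v - u|\<^sup>2)\<close> is a Gaussian of width
\<open>\<epsilon> = (\<rho> + 2)\<^sup>-\<^sup>1\<^sup>/\<^sup>2\<close>, which is as small as desired. Integrating over the centre \<open>u\<close> against \<open>f\<close> then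
gives a convolution.
\<close>

lemma superposition_packets_eq_regularise:
  fixes f :: "'v::euclidean_space \<Rightarrow> complex"
  assumes f: "f \<in> schwartz" and \<rho>: "\<rho> > 0"
  defines "w \<equiv> \<lambda>p. f (fst p) * of_real (exp (- (pi * (1 / \<rho>) * (norm (snd p))\<^sup>2)))"
    and "\<epsilon> \<equiv> 1 / sqrt (\<rho> + 2)"
  shows "rapidly_decreasing w"
    and "\<exists>c. c \<noteq> 0 \<and> superposition w (gaussian_packet 2) = (\<lambda>v. c * regularise \<epsilon> f v)"
proof -
  have [measurable]: "f \<in> borel_measurable borel"
    by (rule schwartz_measurable[OF f])
  have \<epsilon>: "\<epsilon> > 0" "\<epsilon> \<le> 1" "\<epsilon>\<^sup>2 = 1 / (\<rho> + 2)"
    using \<rho> by (auto simp: \<epsilon>_def power_divide)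
  let ?g = "\<lambda>\<nu>::'v. complex_of_real (exp (- (pi * (1 / \<rho>) * (norm \<nu>)\<^sup>2)))"
  have g: "rapidly_decreasing ?g"
    using rapidly_decreasing_gaussian[of "pi * (1 / \<rho>)", where 'a='v] \<rho> by simp
  show w: "rapidly_decreasing w"
    unfolding rapidly_decreasing_def
  proof (intro conjI allI)
    show wm: "w \<in> borel_measurable borel"
      unfolding w_def borel_prod[symmetric] by measurable
    fix k
    have "integrable lborel (\<lambda>(u, \<nu>). ((1 + norm u) ^ k * norm (f u)) * ((1 + norm \<nu>) ^ k * norm (?g \<nu>)))"
      using g schwartz_weighted_integrable[OF f] by (intro integrable_tensor) (auto simp: rapidly_decreasing_def)
    then show "integrable lborel (\<lambda>p. (1 + norm p) ^ k * norm (w p))"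
    proof (rule Bochner_Integration.integrable_bound)
      show "(\<lambda>p. (1 + norm p) ^ k * norm (w p)) \<in> borel_measurable lborel"
        using wm by simp
      show "AE p in lborel. norm ((1 + norm p) ^ k * norm (w p)) \<le>
          norm (case p of (u, \<nu>) \<Rightarrow> ((1 + norm u) ^ k * norm (f u)) * ((1 + norm \<nu>) ^ k * norm (?g \<nu>)))"
      proof (rule AE_I2)
        fix p :: "'v \<times> 'v"
        obtain u \<nu> where p: "p = (u, \<nu>)" by (cases p)
        have "1 + norm (u, \<nu>) \<le> 1 + (norm u + norm \<nu>)"
          using norm_Pair_le[of u \<nu>] by simp
        also have "\<dots> \<le> (1 + norm u) * (1 + norm \<nu>)"
          by (simp add: algebra_simps)
        finally have "(1 + norm (u, \<nu>)) ^ k \<le> ((1 + norm u) * (1 + norm \<nu>)) ^ k"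
          by (rule power_mono) simp
        then have "(1 + norm (u, \<nu>)) ^ k * norm (w (u, \<nu>)) \<le> ((1 + norm u) * (1 + norm \<nu>)) ^ k * norm (w (u, \<nu>))"
          by (rule mult_right_mono) simp
        then show "norm ((1 + norm p) ^ k * norm (w p)) \<le>
          norm (case p of (u, \<nu>) \<Rightarrow> ((1 + norm u) ^ k * norm (f u)) * ((1 + norm \<nu>) ^ k * norm (?g \<nu>)))"
          unfolding p by (simp add: w_def norm_mult power_mult_distrib mult_ac)
      qed
    qed
  qed
  have lip: "lipschitz_family (gaussian_packet 2 :: 'v \<times> 'v \<Rightarrow> _)"
    by (rule lipschitz_family_gaussian_packet) simp
  define \<gamma> where "\<gamma> = gauss_const (of_real (1 / \<rho>)) ^ DIM('v)"
  have "\<gamma> \<noteq> 0"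
  proof -
    have "gauss_const (of_real (1 / \<rho>)) \<noteq> 0"
      using gauss_const_of_real[of "1 / \<rho>"] \<rho> by simp
    then show ?thesis by (simp add: \<gamma>_def)
  qed
  have "superposition w (gaussian_packet 2) v = (\<gamma> * of_real (\<epsilon> ^ DIM('v))) * regularise \<epsilon> f v" for v
  proof -
    let ?e = "\<lambda>u. of_real (exp (- (pi * (\<rho> + 2) * (norm (v - u))\<^sup>2))) :: complex"
    have int: "integrable lborel (\<lambda>p. w p * gaussian_packet 2 p v)"
      using superposition_integrable[OF lip w, of "[]" v] by simp
    have inner: "(LINT \<nu>|lborel. w (u, \<nu>) * gaussian_packet 2 (u, \<nu>) v) = \<gamma> * (f u * ?e u)" for u
    proof -
      have "w (u, \<nu>) * gaussian_packet 2 (u, \<nu>) v = (f u * exp (of_real (- (2 * pi * (norm (v - u))\<^sup>2)))) *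
          exp (- of_real pi * of_real (1 / \<rho>) * of_real ((norm \<nu>)\<^sup>2) + 2 * of_real pi * (\<i> * of_real ((v - u) \<bullet> \<nu>) + 0 * of_real ((0::'v) \<bullet> \<nu>)))" for \<nu>
        unfolding w_def gaussian_packet_def exp_of_real[symmetric] exp_add fst_conv snd_conv
        by (simp add: inner_commute exp_add[symmetric] mult_ac diff_diff_eq add_ac)
      then have "(LINT \<nu>|lborel. w (u, \<nu>) * gaussian_packet 2 (u, \<nu>) v) = (f u * exp (of_real (- (2 * pi * (norm (v - u))\<^sup>2)))) *
          (LINT \<nu>|lborel. exp (- of_real pi * of_real (1 / \<rho>) * of_real ((norm \<nu>)\<^sup>2) + 2 * of_real pi * (\<i> * of_real ((v - u) \<bullet> \<nu>) + 0 * of_real ((0::'v) \<bullet> \<nu>))))"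
        by (simp only: integral_mult_right_zero)
      also have "\<dots> = (f u * exp (of_real (- (2 * pi * (norm (v - u))\<^sup>2)))) * (\<gamma> * exp (of_real (- (pi * \<rho> * (norm (v - u))\<^sup>2))))"
        using \<rho> by (subst gaussian_integral) (simp_all add: \<gamma>_def mult_ac)
      also have "\<dots> = \<gamma> * (f u * (exp (of_real (- (2 * pi * (norm (v - u))\<^sup>2))) * exp (of_real (- (pi * \<rho> * (norm (v - u))\<^sup>2)))))"
        by (simp only: mult_ac)
      also have "exp (of_real (- (2 * pi * (norm (v - u))\<^sup>2))) * exp (of_real (- (pi * \<rho> * (norm (v - u))\<^sup>2))) = ?e u"
        unfolding exp_add[symmetric] exp_of_real[symmetric] by (simp add: algebra_simps)
      finally show ?thesis .
    qed
    have "superposition w (gaussian_packet 2) v = (LINT u|lborel. LINT \<nu>|lborel. w (u, \<nu>) * gaussian_packet 2 (u, \<nu>) v)"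
      unfolding superposition_def by (rule integral_lborel_fst[OF int, symmetric])
    also have "\<dots> = \<gamma> * (LINT u|lborel. f u * ?e u)"
      unfolding inner by (rule integral_mult_right_zero)
    also have "(LINT u|lborel. f u * ?e u) = \<bar>- \<epsilon>\<bar> ^ DIM('v) *\<^sub>R (LINT y|lborel. f (v + (- \<epsilon>) *\<^sub>R y) * ?e (v + (- \<epsilon>) *\<^sub>R y))"
      using \<epsilon>(1) by (intro lborel_integral_affine) simp
    also have "\<dots> = of_real (\<epsilon> ^ DIM('v)) * regularise \<epsilon> f v"
    proof -
      have scale: "?e (v + (- \<epsilon>) *\<^sub>R y) = of_real (exp (- (pi * (norm y)\<^sup>2)))" for y
      proof -
        have "pi * (\<rho> + 2) * (norm (v - (v + (- \<epsilon>) *\<^sub>R y)))\<^sup>2 = pi * ((\<rho> + 2) * \<epsilon>\<^sup>2) * (norm y)\<^sup>2"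
          by (simp add: power_mult_distrib)
        also have "(\<rho> + 2) * \<epsilon>\<^sup>2 = 1"
          using \<rho> by (simp add: \<epsilon>(3))
        finally show ?thesis by simp
      qed
      show ?thesis
        using \<epsilon>(1) unfolding scale regularise_def superposition_def by (simp add: scaleR_conv_of_real mult.commute)
    qed
    finally show ?thesis by (simp only: mult.assoc)
  qed
  moreover have "\<gamma> * of_real (\<epsilon> ^ DIM('v)) \<noteq> 0"
    using \<open>\<gamma> \<noteq> 0\<close> \<epsilon>(1) by simp
  ultimately show "\<exists>c. c \<noteq> 0 \<and> superposition w (gaussian_packet 2) = (\<lambda>v. c * regularise \<epsilon> f v)"
    by blast
qed

text \<open>
The finite linear combinations of packets are dense in the Schwartz space: the regularisations of
\<open>f\<close> are superpositions of packets, and they converge to \<open>f\<close>.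
\<close>

lemma gaussian_packets_total:
  fixes F G :: "'v::euclidean_space distr"
  assumes F: "tempered F" and G: "tempered G"
    and eq: "\<And>p. F (gaussian_packet 2 p) = G (gaussian_packet 2 p)" and f: "f \<in> schwartz"
  shows "F f = G f"
proof -
  let ?\<epsilon> = "\<lambda>i::nat. 1 / sqrt (real (Suc i) + 2)"
  have lin: "linear_on_schwartz F" "linear_on_schwartz G"
    using F G by (auto simp: tempered_def)
  have lip: "lipschitz_family (gaussian_packet 2 :: 'v \<times> 'v \<Rightarrow> _)"
    by (rule lipschitz_family_gaussian_packet) simp
  have e: "0 \<le> ?\<epsilon> i" "?\<epsilon> i \<le> 1" for i by auto
  have e0: "?\<epsilon> \<longlonglongrightarrow> 0"
  proof -
    have "filterlim (\<lambda>i. sqrt (real (Suc i) + 2)) at_top sequentially"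
    proof (rule filterlim_compose[OF sqrt_at_top])
      show "filterlim (\<lambda>i. real (Suc i) + 2) at_top sequentially"
        by (rule filterlim_at_top_mono[OF filterlim_real_sequentially]) (auto intro!: always_eventually)
    qed
    from tendsto_inverse_0_at_top[OF this] show ?thesis
      by (simp add: inverse_eq_divide)
  qed
  \<comment> \<open>The choice \<open>\<rho> = i + 1\<close> in the superposition gives the width \<open>?\<epsilon> i\<close>.\<close>
  have FG: "F (regularise (?\<epsilon> i) f) = G (regularise (?\<epsilon> i) f)" for i
  proof -
    have \<rho>: "real (Suc i) > 0" by simp
    let ?w = "\<lambda>p. f (fst p) * of_real (exp (- (pi * (1 / real (Suc i)) * (norm (snd p))\<^sup>2)))"
    note sup = superposition_packets_eq_regularise[OF f \<rho>]
    obtain c where c: "c \<noteq> 0" "superposition ?w (gaussian_packet 2) = (\<lambda>v. c * regularise (?\<epsilon> i) f v)"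
      using sup(2) by blast
    have "lipschitz_family (\<lambda>y v. f (v - ?\<epsilon> i *\<^sub>R y))"
      by (rule lipschitz_family_translations[OF f e])
    moreover have "rapidly_decreasing (\<lambda>y::'v. complex_of_real (exp (- (pi * (norm y)\<^sup>2))))"
      by (rule rapidly_decreasing_gaussian) simp
    ultimately have S: "regularise (?\<epsilon> i) f \<in> schwartz"
      unfolding regularise_def by (rule superposition_schwartz)
    have "F (superposition ?w (gaussian_packet 2)) = G (superposition ?w (gaussian_packet 2))"
      by (rule tempered_superposition_unique[where h="gaussian_packet 2" and w="?w" and F=F and G=G, OF lip sup(1) F G eq])
    moreover have "F (superposition ?w (gaussian_packet 2)) = c * F (regularise (?\<epsilon> i) f)"
      unfolding c(2) by (rule linear_on_schwartz_cmult[OF lin(1) S])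
    moreover have "G (superposition ?w (gaussian_packet 2)) = c * G (regularise (?\<epsilon> i) f)"
      unfolding c(2) by (rule linear_on_schwartz_cmult[OF lin(2) S])
    ultimately show ?thesis
      using c(1) by simp
  qed
  have limF: "(\<lambda>i. F (regularise (?\<epsilon> i) f)) \<longlonglongrightarrow> F f"
    by (rule regularise_tendsto[OF f e e0 F])
  have limG: "(\<lambda>i. G (regularise (?\<epsilon> i) f)) \<longlonglongrightarrow> G f"
    by (rule regularise_tendsto[OF f e e0 G])
  show ?thesis
    using limF unfolding FG by (rule LIMSEQ_unique[OF _ limG])
qed

section \<open>Uniqueness of Wigner kernels\<close>

lemma gaussian_packet_tensor:
  "gaussian_packet \<sigma> ((u\<^sub>1, u\<^sub>2), (\<nu>\<^sub>1, \<nu>\<^sub>2)) (z, w) =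
    gaussian_packet \<sigma> (u\<^sub>1, \<nu>\<^sub>1) z * gaussian_packet \<sigma> (u\<^sub>2, \<nu>\<^sub>2) w"
  unfolding gaussian_packet_def exp_add[symmetric]
  by (simp add: power2_norm_eq_inner algebra_simps)

text \<open>
For two packets of width 1, the centre and the frequency of the Wigner transform are given by the
midpoint of their phase space positions and by the difference of these positions, rotated by a right
angle. Hence every phase space point and every frequency can be attained.
\<close>

lemma cross_wigner_gaussian_packet:
  fixes p :: "((real^'n) \<times> (real^'n)) \<times> ((real^'n) \<times> (real^'n))"
  obtains q q' c where "c \<noteq> 0"
    "cross_wigner (gaussian_packet 1 q) (gaussian_packet 1 q') = (\<lambda>w. c * gaussian_packet 2 p w)"
proof -
  obtain A B \<kappa> \<tau> where p: "p = ((A, B), (\<kappa>, \<tau>))" by (metis prod.collapse)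
  \<comment> \<open>The prescribed centre \<open>(A, B)\<close> is the midpoint; \<open>\<tau>\<close> and \<open>\<kappa>\<close> are, up to sign, the differences in position and in frequency.\<close>
  define q where "q = (A - (1/2) *\<^sub>R \<tau>, B + (1/2) *\<^sub>R \<kappa>)"
  define q' where "q' = (A + (1/2) *\<^sub>R \<tau>, B - (1/2) *\<^sub>R \<kappa>)"
  let ?c = "gauss_const (of_real (1/2)) ^ CARD('n) * exp (2 * of_real pi * \<i> * of_real (\<tau> \<bullet> B))"
  have "cross_wigner (gaussian_packet 1 q) (gaussian_packet 1 q') (x, \<xi>) = ?c * gaussian_packet 2 p (x, \<xi>)" for x \<xi>
  proof -
    let ?E = "Complex (- pi * (2 * ((x - A) \<bullet> (x - A)) + (\<tau> \<bullet> \<tau>) / 2)) (2 * pi * (\<kappa> \<bullet> (x - A) + B \<bullet> \<tau>))"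
    let ?G = "\<lambda>y. exp (- of_real pi * of_real (1/2) * of_real ((norm y)\<^sup>2)
      + 2 * of_real pi * (of_real (- (1/2)) * of_real (\<tau> \<bullet> y) + \<i> * of_real ((B - \<xi>) \<bullet> y)))"
    have "gaussian_packet 1 q (x + y /\<^sub>R 2) * cnj (gaussian_packet 1 q' (x - y /\<^sub>R 2)) * cis (- 2 * pi * (y \<bullet> \<xi>)) = exp ?E * ?G y" for y
      unfolding gaussian_packet_def q_def q'_def fst_conv snd_conv cis_conv_exp exp_cnj exp_add[symmetric] power2_norm_eq_inner
      by (intro arg_cong[where f=exp]) (simp add: complex_eq_iff inner_add_left inner_add_right inner_diff_left inner_diff_right inner_commute field_simps)
    then have "cross_wigner (gaussian_packet 1 q) (gaussian_packet 1 q') (x, \<xi>) = exp ?E * (LINT y|lborel. ?G y)"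
      unfolding cross_wigner_def prod.case by (simp only: integral_mult_right_zero)
    also have "\<dots> = exp ?E * (gauss_const (of_real (1/2)) ^ CARD('n) * exp (of_real pi *
       ((of_real (- (1/2)))\<^sup>2 * of_real ((norm \<tau>)\<^sup>2) + 2 * of_real (- (1/2)) * \<i> * of_real (\<tau> \<bullet> (B - \<xi>)) + \<i>\<^sup>2 * of_real ((norm (B - \<xi>))\<^sup>2)) / of_real (1/2)))"
      by (subst gaussian_integral) auto
    also have "\<dots> = gauss_const (of_real (1/2)) ^ CARD('n) * exp (?E + of_real pi *
       ((of_real (- (1/2)))\<^sup>2 * of_real ((norm \<tau>)\<^sup>2) + 2 * of_real (- (1/2)) * \<i> * of_real (\<tau> \<bullet> (B - \<xi>)) + \<i>\<^sup>2 * of_real ((norm (B - \<xi>))\<^sup>2)) / of_real (1/2))"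
      by (simp only: exp_add mult_ac)
    also have "?E + of_real pi *
       ((of_real (- (1/2)))\<^sup>2 * of_real ((norm \<tau>)\<^sup>2) + 2 * of_real (- (1/2)) * \<i> * of_real (\<tau> \<bullet> (B - \<xi>)) + \<i>\<^sup>2 * of_real ((norm (B - \<xi>))\<^sup>2)) / of_real (1/2) =
       2 * of_real pi * \<i> * of_real (\<tau> \<bullet> B) + (- of_real (pi * 2) * of_real ((norm ((x, \<xi>) - (A, B)))\<^sup>2)
         + 2 * of_real pi * \<i> * of_real ((\<kappa>, \<tau>) \<bullet> ((x, \<xi>) - (A, B))))"
      unfolding power2_norm_eq_inner
      by (simp add: complex_eq_iff inner_add_left inner_add_right inner_diff_left inner_diff_right inner_commute power2_eq_square field_simps)
    finally show ?thesis
      unfolding gaussian_packet_def p fst_conv snd_conv by (simp only: exp_add mult.assoc)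
  qed
  then have "cross_wigner (gaussian_packet 1 q) (gaussian_packet 1 q') = (\<lambda>w. ?c * gaussian_packet 2 p w)"
    by (intro ext) (metis prod.collapse)
  moreover have "?c \<noteq> 0"
    using gauss_const_of_real[of "1/2"] by simp
  ultimately show ?thesis
    by (rule that[rotated])
qed

text \<open>
A packet on \<open>\<real>\<^sup>4\<^sup>d\<close> is a product of two packets on \<open>\<real>\<^sup>2\<^sup>d\<close>. The first one can be used as the test
function, and the second one is a Wigner transform up to a factor. So the identity determines a
kernel on all packets, and these are total.
\<close>

lemma wigner_kernel_unique:
  fixes T :: "(real^'n \<Rightarrow> complex) \<Rightarrow> (real^'n) distr"
  assumes k: "tempered k" "wigner_identity T k" and k': "tempered k'" "wigner_identity T k'"
    and \<Psi>: "\<Psi> \<in> schwartz"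
  shows "k' \<Psi> = k \<Psi>"
proof (rule gaussian_packets_total[OF k'(1) k(1) _ \<Psi>])
  fix p :: "(((real^'n) \<times> (real^'n)) \<times> ((real^'n) \<times> (real^'n))) \<times> (((real^'n) \<times> (real^'n)) \<times> ((real^'n) \<times> (real^'n)))"
  obtain u\<^sub>1 u\<^sub>2 \<nu>\<^sub>1 \<nu>\<^sub>2 where p: "p = ((u\<^sub>1, u\<^sub>2), (\<nu>\<^sub>1, \<nu>\<^sub>2))" by (metis prod.collapse)
  obtain q q' c where c: "c \<noteq> 0"
    "cross_wigner (gaussian_packet 1 q) (gaussian_packet 1 q') = (\<lambda>w. c * gaussian_packet 2 (u\<^sub>2, \<nu>\<^sub>2) w)"
    using cross_wigner_gaussian_packet[of "(u\<^sub>2, \<nu>\<^sub>2)"] by metis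
  have S: "gaussian_packet \<sigma> a \<in> schwartz" if "\<sigma> > 0" for \<sigma> and a :: "'a::euclidean_space \<times> 'a"
    by (rule gaussian_packet_schwartz[OF that])
  have pS: "gaussian_packet 2 p \<in> schwartz"
    by (rule gaussian_packet_schwartz) simp
  have test: "(\<lambda>(z, w). gaussian_packet 2 (u\<^sub>1, \<nu>\<^sub>1) z * cross_wigner (gaussian_packet 1 q) (gaussian_packet 1 q') w) =
      (\<lambda>v. c * gaussian_packet 2 p v)"
    by (auto simp: fun_eq_iff c(2) p gaussian_packet_tensor)
  have val: "j (\<lambda>v. c * gaussian_packet 2 p v) = cross_wigner_distr (T (gaussian_packet 1 q)) (T (gaussian_packet 1 q')) (gaussian_packet 2 (u\<^sub>1, \<nu>\<^sub>1))"
    if "wigner_identity T j" for j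
  proof -
    have "cross_wigner_distr (T (gaussian_packet 1 q)) (T (gaussian_packet 1 q')) (gaussian_packet 2 (u\<^sub>1, \<nu>\<^sub>1)) =
      j (\<lambda>(z, w). gaussian_packet 2 (u\<^sub>1, \<nu>\<^sub>1) z * cross_wigner (gaussian_packet 1 q) (gaussian_packet 1 q') w)"
      using that gaussian_packet_schwartz[of 1 q] gaussian_packet_schwartz[of 1 q'] gaussian_packet_schwartz[of 2 "(u\<^sub>1, \<nu>\<^sub>1)"]
      unfolding wigner_identity_def by simp
    then show ?thesis unfolding test ..
  qed
  have "c * k' (gaussian_packet 2 p) = c * k (gaussian_packet 2 p)"
    using val[OF k(2)] val[OF k'(2)] linear_on_schwartz_cmult[of k "gaussian_packet 2 p" c]
      linear_on_schwartz_cmult[of k' "gaussian_packet 2 p" c] k(1) k'(1) pS by (simp add: tempered_def)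
  with c(1) show "k' (gaussian_packet 2 p) = k (gaussian_packet 2 p)"
    by simp
qed

theorem corollary8p2:
  fixes \<theta> \<mu> t :: real
  assumes "\<theta> > 0" and "t > 0"
  shows "is_wigner_kernel
           (\<lambda>u\<^sub>0 :: real^'n \<Rightarrow> complex.
              distr_of_fun (hermite_propagator (Complex \<theta> \<mu> * of_real t) u\<^sub>0))
           (distr_of_fun (\<lambda>(z, w). of_real
              ((2 / sinh (\<theta> * t)) ^ CARD('n) *
               exp (- (2 * pi / tanh (\<theta> * t)) * ((norm z)\<^sup>2 + (norm w)\<^sup>2)) *
               exp (4 * pi / sinh (\<theta> * t) * (inv (phase_rotation (\<mu> * t)) z \<bullet> w)))))"
proof -
  have \<alpha>: "\<theta> * t > 0" using assms by simp
  have \<zeta>: "Complex \<theta> \<mu> * of_real t = Complex (\<theta> * t) (\<mu> * t)"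
    by (simp add: complex_eq_iff)
  note kernel = hermite_wigner_kernel_def[of "\<theta> * t" "\<mu> * t", symmetric]
  show ?thesis
    unfolding \<zeta> inv_phase_rotation kernel is_wigner_kernel_def
  proof (intro conjI allI impI ballI)
    show "schwartz_operator (\<lambda>u\<^sub>0 :: real^'n \<Rightarrow> complex. distr_of_fun (hermite_propagator (Complex (\<theta> * t) (\<mu> * t)) u\<^sub>0))"
      by (rule hermite_propagator_schwartz_operator) (use \<alpha> in simp)
    show k: "tempered (distr_of_fun (\<lambda>(z, w :: (real^'n) \<times> (real^'n)). complex_of_real (hermite_wigner_kernel (\<theta> * t) (\<mu> * t) z w)))"
      by (rule hermite_wigner_kernel_tempered[OF \<alpha>])
    show id: "wigner_identity (\<lambda>u\<^sub>0 :: real^'n \<Rightarrow> complex. distr_of_fun (hermite_propagator (Complex (\<theta> * t) (\<mu> * t)) u\<^sub>0))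
        (distr_of_fun (\<lambda>(z, w). complex_of_real (hermite_wigner_kernel (\<theta> * t) (\<mu> * t) z w)))"
      by (rule hermite_wigner_identity[OF \<alpha>])
    fix k' :: "(((real^'n) \<times> (real^'n)) \<times> ((real^'n) \<times> (real^'n))) distr" and \<Psi> :: "((real^'n) \<times> (real^'n)) \<times> ((real^'n) \<times> (real^'n)) \<Rightarrow> complex"
    assume "tempered k' \<and> wigner_identity (\<lambda>u\<^sub>0 :: real^'n \<Rightarrow> complex. distr_of_fun (hermite_propagator (Complex (\<theta> * t) (\<mu> * t)) u\<^sub>0)) k'"
      and "\<Psi> \<in> schwartz"
    then show "k' \<Psi> = distr_of_fun (\<lambda>(z, w). complex_of_real (hermite_wigner_kernel (\<theta> * t) (\<mu> * t) z w)) \<Psi>"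
      using wigner_kernel_unique[OF k id] by blast
  qed
qed

end
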